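(* Let $n\ge 2$ and let $\alpha\subset\mathbb{R}^n$ be a germ of $C^6$-smooth hypersurface with positive definite second fundamental form. Suppose that for every class $\mathcal L$ of parallel lines in $\mathbb{R}^n$ that contains at least one line intersecting $\alpha$ twice, the involution $\mathcal R_{\mathcal L}$ defined by $\alpha$ and $\mathcal L$ is the lifting, under the tautological projection $S^{n-1}\to\mathbb{RP}^{n-1}$, of a projective involution $\mathbb{RP}^{n-1}\to\mathbb{RP}^{n-1}$. Then $\alpha$ is a quadric (that is, $\alpha$ is a germ of a quadric hypersurface).
   Context: The germ $\alpha$ is represented by a sufficiently small hypersurface, still denoted $\alpha$, which in suitable orthogonal coordinates is the graph of a strictly convex function over a convex domain; every line not contained in $\alpha$ meets it in at most two points. For $A\in\alpha$, $\vec n(A)\in S^{n-1}$ denotes the exterior unit normal vector to $\alpha$ at $A$ (pointing to the side opposite to the convex side). The map $A\mapsto\vec n(A)$ is injective. A class $\mathcal L$ of parallel lines is the set of all lines parallel to a given line. The involution $\mathcal R_{\mathcal L}$ is the (partially defined) map of $S^{n-1}$ defined as follows: for a line $\Lambda\in\mathcal L$ intersecting $\alpha$ at two points $A,B$ (with $A=B$ in the case of tangency), $\mathcal R_{\mathcal L}(\vec n(A))=\vec n(B)$ and $\mathcal R_{\mathcal L}(\vec n(B))=\vec n(A)$. The tautological projection $\pi:S^{n-1}\to\mathbb{RP}^{n-1}$ is the double covering sending each unit vector to the point representing the line it spans. $\mathcal R_{\mathcal L}$ is the lifting of a projective involution $J:\mathbb{RP}^{n-1}\to\mathbb{RP}^{n-1}$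 (a projective transformation with $J\circ J=\mathrm{id}$) if $\pi\circ\mathcal R_{\mathcal L}=J\circ\pi$ on the domain of definition of $\mathcal R_{\mathcal L}$. *)

theory Defs
  imports "HOL-Analysis.Analysis"
begin

section \<open>Strictly convex hypersurfaces\<close>

text \<open>\<open>Ck_on k S f\<close> is meant for open \<open>S\<close>: all iterated directional derivatives of
  order at most \<open>k\<close> exist and are continuous on \<open>S\<close>.\<close>

primrec Ck_on ::
  "nat \<Rightarrow> 'a::euclidean_space set \<Rightarrow> ('a \<Rightarrow> 'b::real_normed_vector) \<Rightarrow> bool" where
  "Ck_on 0 S f \<longleftrightarrow> continuous_on S f"
| "Ck_on (Suc k) S f \<longleftrightarrow>
     f differentiable_on S \<and> (\<forall>v. Ck_on k S (\<lambda>x. frechet_derivative f (at x) v))"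

definition strictly_convex_on :: "'a::real_vector set \<Rightarrow> ('a \<Rightarrow> real) \<Rightarrow> bool" where
  "strictly_convex_on D f \<longleftrightarrow>
     convex D \<and>
     (\<forall>x\<in>D. \<forall>y\<in>D. \<forall>t. x \<noteq> y \<and> 0 < t \<and> t < 1 \<longrightarrow>
        f ((1 - t) *\<^sub>R x + t *\<^sub>R y) < (1 - t) * f x + t * f y)"

text \<open>The orthogonal coordinates are given by a unit vector \<open>e\<close> (the vertical axis) and its
  orthogonal complement. The domain of the graph is the relatively open subset
  \<open>U \<inter> {y. e \<bullet> y = 0}\<close> of that complement; as usual, smoothness of the function on
  it means that it is the restriction of a smooth function on the open set \<open>U\<close>.
  Only the restriction has to be convex.\<close>

definition strictly_convex_hypersurface :: "nat \<Rightarrow> 'a::euclidean_space set \<Rightarrow> bool" where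
  "strictly_convex_hypersurface k \<alpha> \<longleftrightarrow>
     (\<exists>e U f. norm e = 1 \<and> open U \<and> Ck_on k U f \<and>
        strictly_convex_on (U \<inter> {y. e \<bullet> y = 0}) f \<and>
        \<alpha> = (\<lambda>y. y + f y *\<^sub>R e) ` (U \<inter> {y. e \<bullet> y = 0}))"

text \<open>Velocity vectors of curves in \<open>\<alpha>\<close>. Only the germ of the curve at \<open>0\<close> matters:
  away from \<open>0\<close> it may be redefined as constant, so it is harmless that it is total.\<close>

definition tangent_space :: "'a::real_normed_vector set \<Rightarrow> 'a \<Rightarrow> 'a set" where
  "tangent_space \<alpha> A =
     {v. \<exists>\<gamma>. range \<gamma> \<subseteq> \<alpha> \<and> \<gamma> 0 = A \<and> (\<gamma> has_vector_derivative v) (at (0::real))}"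

text \<open>The last condition selects the side: the convex side is the one on which \<open>\<alpha>\<close> lies
  with respect to its tangent hyperplane at \<open>A\<close>.\<close>

definition exterior_normal :: "'a::euclidean_space set \<Rightarrow> 'a \<Rightarrow> 'a" where
  "exterior_normal \<alpha> A =
     (THE u. norm u = 1 \<and> (\<forall>v\<in>tangent_space \<alpha> A. u \<bullet> v = 0) \<and> (\<forall>B\<in>\<alpha>. u \<bullet> (B - A) \<le> 0))"

text \<open>Second fundamental form with respect to the interior normal \<open>N = - exterior_normal \<alpha>\<close>,
  that is \<open>II (v, w) = - (dN v) \<bullet> w\<close> for tangent vectors \<open>v\<close>, \<open>w\<close>. The derivative
  is taken within \<open>\<alpha>\<close>; its values on tangent vectors are uniquely determined.\<close>

definition second_fundamental_form ::
  "'a::euclidean_space set \<Rightarrow> 'a \<Rightarrow> 'a \<Rightarrow> 'a \<Rightarrow> real" where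
  "second_fundamental_form \<alpha> A v w =
     frechet_derivative (exterior_normal \<alpha>) (at A within \<alpha>) v \<bullet> w"

definition positive_definite_at :: "'a::euclidean_space set \<Rightarrow> 'a \<Rightarrow> bool" where
  "positive_definite_at \<alpha> A \<longleftrightarrow>
     (\<forall>v\<in>tangent_space \<alpha> A. v \<noteq> 0 \<longrightarrow> second_fundamental_form \<alpha> A v v > 0)"

section \<open>Classes of parallel lines and their involutions\<close>

definition affine_line :: "'a::euclidean_space set \<Rightarrow> bool" where
  "affine_line \<Lambda> \<longleftrightarrow> affine \<Lambda> \<and> aff_dim \<Lambda> = 1"

definition parallel_class :: "'a::euclidean_space set set \<Rightarrow> bool" where
  "parallel_class \<L> \<longleftrightarrow>
     (\<exists>\<Lambda>\<^sub>0. affine_line \<Lambda>\<^sub>0 \<and> \<L> = {\<Lambda>. affine_line \<Lambda> \<and> affine_parallel \<Lambda>\<^sub>0 \<Lambda>})"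

text \<open>For \<open>A = B\<close> tangency is required: a transversal line may also meet the representative
  \<open>\<alpha>\<close> in a single point.\<close>

definition meets_at ::
  "'a::euclidean_space set \<Rightarrow> 'a set set \<Rightarrow> 'a \<Rightarrow> 'a \<Rightarrow> bool" where
  "meets_at \<alpha> \<L> A B \<longleftrightarrow>
     (\<exists>\<Lambda>\<in>\<L>. \<Lambda> \<inter> \<alpha> = {A, B} \<and> (A = B \<longrightarrow> (\<forall>x\<in>\<Lambda>. x - A \<in> tangent_space \<alpha> A)))"

definition line_involution ::
  "'a::euclidean_space set \<Rightarrow> 'a set set \<Rightarrow> ('a \<rightharpoonup> 'a)" where
  "line_involution \<alpha> \<L> u =
     (if \<exists>A B. meets_at \<alpha> \<L> A B \<and> exterior_normal \<alpha> A = u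
      then Some (THE w. \<exists>A B. meets_at \<alpha> \<L> A B \<and>
                   exterior_normal \<alpha> A = u \<and> exterior_normal \<alpha> B = w)
      else None)"

section \<open>Projective involutions and liftings\<close>

definition projective_space :: "'a::euclidean_space set set" where
  "projective_space = {l. subspace l \<and> dim l = 1}"

definition tautological_projection :: "'a::euclidean_space \<Rightarrow> 'a set" where
  "tautological_projection u = span {u}"

definition projective_transformation :: "('a::euclidean_space set \<Rightarrow> 'a set) \<Rightarrow> bool" where
  "projective_transformation J \<longleftrightarrow>
     (\<exists>T. linear T \<and> inj T \<and> (\<forall>l\<in>projective_space. J l = T ` l))"

definition projective_involution :: "('a::euclidean_space set \<Rightarrow> 'a set) \<Rightarrow> bool" where
  "projective_involution J \<longleftrightarrow>
     projective_transformation J \<and> (\<forall>l\<in>projective_space. J (J l) = l)"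

definition is_lifting_of ::
  "('a::euclidean_space \<rightharpoonup> 'a) \<Rightarrow> ('a set \<Rightarrow> 'a set) \<Rightarrow> bool" where
  "is_lifting_of R J \<longleftrightarrow>
     (\<forall>u\<in>dom R. tautological_projection (the (R u)) = J (tautological_projection u))"

section \<open>Quadrics\<close>

definition quadric :: "'a::euclidean_space set \<Rightarrow> bool" where
  "quadric Q \<longleftrightarrow>
     (\<exists>M b c. linear M \<and> (\<exists>x. M x \<bullet> x \<noteq> 0) \<and> Q = {x. M x \<bullet> x + b \<bullet> x + c = 0})"

definition same_germ_at :: "'a::topological_space \<Rightarrow> 'a set \<Rightarrow> 'a set \<Rightarrow> bool" where
  "same_germ_at p S T \<longleftrightarrow> (\<forall>\<^sub>F x in nhds p. x \<in> S \<longleftrightarrow> x \<in> T)"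

end

theory Submission
  imports Defs
begin

text \<open>
  Restrict to a plane spanned by the graph direction \<open>e\<close> and a horizontal direction \<open>w\<close>. For the
  class of lines along \<open>v = w + s e\<close>, the lifted projective involution fixes the normals of all points
  whose tangent hyperplane contains \<open>v\<close>. These fill an open part of \<open>v\<^sup>\<bottom>\<close>, so the involution is a
  scalar there, and a linear map that is scalar on a hyperplane is scalar plus rank one. For the
  slopes \<open>g'(a)\<close>, \<open>g'(b)\<close> at the ends of a chord of slope \<open>s\<close> this says that
  \<open>1/(g'(a) - s) + 1/(g'(b) - s)\<close> depends only on \<open>s\<close>. Comparing with the osculating conic gives
  Monge's equation \<open>9 g\<^sub>2\<^sup>2 g\<^sub>5 - 45 g\<^sub>2 g\<^sub>3 g\<^sub>4 + 40 g\<^sub>3\<^sup>3 = 0\<close> for the derivatives of \<open>g\<close>, so every such plane section is a conic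
  \<open>A t\<^sup>2 + B t y + C y\<^sup>2 = y\<close> (in coordinates adapted to the tangent at the base point).

  Read as a polynomial identity in the direction, Monge's equation shows that the second derivative
  of the graph function divides the third: the cubic form of Maschke, Pick and Berwald vanishes.
  Hence \<open>B\<close> is linear in the direction, and differentiating the divisibility relation once shows that
  \<open>C\<close> does not depend on the direction. So the conics through a point are the sections of one quadric.
\<close>

section \<open>Monge's equation in one variable\<close>

text \<open>The sum of reciprocal slopes is exploited on shrinking chords: at a given point let
  \<open>s\<close> be the slope there, so that the chords parallel to the tangent contract to the
  point. On a conic \<open>A t^2 + B t y + C y^2 = y\<close> such chords give exactly
  \<open>- B / A\<close>. The osculating conic of a general curve leaves an error of order five, and
  this error moves the sum by a nonzero multiple of \<open>b^2\<close> to leading order. A constant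
  sum therefore kills the error, which is Monge's equation. Monge's equation is then available at
  every point and in every direction, and both freedoms are needed: the first integrates it along a
  line to a conic, the second makes it a polynomial identity in the direction. Two obstacles remain
  at the end. Directions are compared in linearly independent pairs; proportional directions, the
  only ones when n = 2, are covered by homogeneity. And inclusion of the graph in a quadric is
  weaker than equality of germs, so a second intersection of vertical lines with the quadric has to
  be excluded near the point.\<close>

lemma vanishing_jet_tendsto:
  fixes D :: "nat \<Rightarrow> real \<Rightarrow> real"
  assumes "\<epsilon> > 0"
    and "\<And>i t. i < n \<Longrightarrow> \<bar>t\<bar> < \<epsilon> \<Longrightarrow> (D i has_real_derivative D (Suc i) t) (at t)"
    and "\<And>i. i < n \<Longrightarrow> D i 0 = 0"
    and "isCont (D n) 0"
  shows "((\<lambda>t. D 0 t / t ^ n) \<longlongrightarrow> D n 0 / fact n) (at 0)"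
  using assms
proof (induction n arbitrary: D)
  case 0
  then show ?case by (simp add: isCont_def)
next
  case (Suc n)
  have near: "\<forall>\<^sub>F t in at 0. \<bar>t\<bar> < \<epsilon>"
    unfolding eventually_at using Suc.prems(1) by (auto simp: dist_real_def)
  have lim1: "((\<lambda>t. D (Suc 0) t / t ^ n) \<longlongrightarrow> D (Suc n) 0 / fact n) (at 0)"
    using Suc.IH[of "\<lambda>i. D (Suc i)"] Suc.prems by simp
  have "((\<lambda>t. D (Suc 0) t / t ^ n / real (Suc n)) \<longlongrightarrow> D (Suc n) 0 / fact n / real (Suc n)) (at 0)"
    by (intro tendsto_intros lim1) simp
  then have lim: "((\<lambda>t. D (Suc 0) t / (real (Suc n) * t ^ n)) \<longlongrightarrow> D (Suc n) 0 / fact (Suc n)) (at 0)"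
    by (simp add: field_simps)
  show ?case
  proof (rule lhopital[OF _ _ _ _ _ _ lim])
    have "isCont (D 0) 0" using DERIV_isCont[OF Suc.prems(2)[of 0 0]] Suc.prems(1) by simp
    then show "(D 0 \<longlongrightarrow> 0) (at 0)" using Suc.prems(3)[of 0] by (simp add: isCont_def)
    have "((\<lambda>t::real. t ^ Suc n) \<longlongrightarrow> 0 ^ Suc n) (at 0)" by (intro tendsto_intros)
    then show "((\<lambda>t::real. t ^ Suc n) \<longlongrightarrow> 0) (at 0)" by simp
    show "\<forall>\<^sub>F x::real in at 0. x ^ Suc n \<noteq> 0"
      unfolding eventually_at by (intro exI[of _ 1]) auto
    show "\<forall>\<^sub>F x::real in at 0. real (Suc n) * x ^ n \<noteq> 0"
      unfolding eventually_at by (intro exI[of _ 1]) auto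
    show "\<forall>\<^sub>F x in at 0. (D 0 has_real_derivative D (Suc 0) x) (at x)"
      using near by eventually_elim (use Suc.prems(2) in auto)
    show "\<forall>\<^sub>F x in at 0. ((\<lambda>t. t ^ Suc n) has_real_derivative real (Suc n) * x ^ n) (at x)"
      using DERIV_pow[of "Suc n"] by (intro always_eventually allI) simp
  qed
qed

text \<open>Provides short chords parallel to the tangent at \<open>0\<close>. The common height is
  the smaller of the two boundary values, so the intermediate value theorem reaches it on both
  sides.\<close>

lemma chord_pairs_exist:
  fixes h :: "real \<Rightarrow> real"
  assumes "\<epsilon> > 0" and "continuous_on {-\<epsilon>..\<epsilon>} h" and "h 0 = 0"
    and "\<And>t. \<bar>t\<bar> \<le> \<epsilon> \<Longrightarrow> t \<noteq> 0 \<Longrightarrow> h t > 0"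
  shows "\<exists>a b. -\<epsilon> \<le> a \<and> a < 0 \<and> 0 < b \<and> b \<le> \<epsilon> \<and> h a = h b"
proof -
  define y where "y = min (h (-\<epsilon>)) (h \<epsilon>)"
  have y: "0 < y" "y \<le> h (-\<epsilon>)" "y \<le> h \<epsilon>" using assms(1,4) by (auto simp: y_def)
  have "\<exists>x. -\<epsilon> \<le> x \<and> x \<le> 0 \<and> h x = y"
    using y assms by (intro IVT2') (auto intro: continuous_on_subset)
  moreover have "\<exists>x. 0 \<le> x \<and> x \<le> \<epsilon> \<and> h x = y"
    using y assms by (intro IVT') (auto intro: continuous_on_subset)
  ultimately obtain a b where "-\<epsilon> \<le> a" "a \<le> 0" "h a = y" "0 \<le> b" "b \<le> \<epsilon>" "h b = y" by blast
  moreover from this have "a \<noteq> 0" "b \<noteq> 0" using y assms(3) by auto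
  ultimately show ?thesis by (metis order_le_less)
qed

text \<open>The chord of height \<open>y\<close> has end points \<open>-\<kappa> b\<close> and \<open>b\<close>, where the slopes are \<open>p\<close> and \<open>q\<close>. The
  numbers \<open>\<rho>\<close>, \<open>\<sigma>\<close>, \<open>\<eta>\<close> are the remainders of the conic equation, of its derivative and of the slope
  after dividing by the expected power of the argument, so they have limits as \<open>b \<longrightarrow> 0\<close>; the
  factor \<open>b\<^sup>2\<close> on the right then forces both sides to vanish in the limit.\<close>

lemma osculating_chord_identity:
  fixes A B C c \<kappa> b y p q \<rho>a \<rho>b \<sigma>a \<sigma>b \<eta>a \<eta>b :: real
  assumes b: "b \<noteq> 0" and \<kappa>: "\<kappa> > 0" and \<eta>: "\<eta>a \<noteq> 0" "\<eta>b \<noteq> 0"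
    and p: "p = - \<kappa> * b * \<eta>a" and q: "q = b * \<eta>b"
    and c: "1 / p + 1 / q = c"
    and a0: "A * (\<kappa> * b)^2 - B * \<kappa> * b * y + C * y^2 - y = - ((\<kappa> * b)^5 * \<rho>a)"
    and b0: "A * b^2 + B * b * y + C * y^2 - y = b^5 * \<rho>b"
    and a1: "- 2 * A * \<kappa> * b + B * y + (- B * \<kappa> * b + 2 * C * y - 1) * p = (\<kappa> * b)^4 * \<sigma>a"
    and b1: "2 * A * b + B * y + (B * b + 2 * C * y - 1) * q = b^4 * \<sigma>b"
  defines "E \<equiv> (\<kappa>^5 * \<rho>a + \<rho>b) / (\<kappa> + 1)"
  shows "(1 + \<kappa>) * (A * c + B) =
    b^2 * ((\<kappa>^3 * \<sigma>a / \<eta>a + \<sigma>b / \<eta>b) - E * (1 / (\<kappa> * \<eta>a) + 1 / \<eta>b))"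
proof -
  have p0: "p \<noteq> 0" and q0: "q \<noteq> 0" using p q b \<kappa> \<eta> by auto
  have E: "E * (\<kappa> + 1) = \<kappa>^5 * \<rho>a + \<rho>b" using \<kappa> by (simp add: E_def)
  \<comment> \<open>The end points have the same height, so subtracting the two conic equations
    removes \<open>C * y^2 - y\<close>; a common factor \<open>b * (1 + \<kappa>)\<close> then
    splits off.\<close>
  have "b * (1 + \<kappa>) * (A * b * (1 - \<kappa>) + B * y) = b * (1 + \<kappa>) * (b^4 * E)"
  proof -
    have "b * (1 + \<kappa>) * (A * b * (1 - \<kappa>) + B * y) = b^5 * (\<kappa>^5 * \<rho>a + \<rho>b)"
      using a0 b0 by algebra
    then show ?thesis using E by algebra
  qed
  then have m: "A * b * (1 - \<kappa>) + B * y = b^4 * E" using b \<kappa> by simp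
  \<comment> \<open>Dividing by the slopes produces the reciprocals in \<open>c\<close> and leaves
    the same term \<open>2 * C * y - 1\<close> in both equations, so their difference is free of
    \<open>C\<close>.\<close>
  have a1': "(- 2 * A * \<kappa> * b + B * y) / p - B * \<kappa> * b + 2 * C * y - 1 = - (b^3 * \<kappa>^3 * \<sigma>a / \<eta>a)"
  proof -
    have "(- 2 * A * \<kappa> * b + B * y) / p - B * \<kappa> * b + 2 * C * y - 1 = (\<kappa> * b)^4 * \<sigma>a / p"
      using a1 p0 by (simp add: field_simps)
    also have "\<dots> = - (b^3 * \<kappa>^3 * \<sigma>a / \<eta>a)"
      using p b \<kappa> \<eta> by (simp add: field_simps power_numeral_reduce)
    finally show ?thesis .
  qed
  have b1': "(2 * A * b + B * y) / q + B * b + 2 * C * y - 1 = b^3 * \<sigma>b / \<eta>b"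
  proof -
    have "(2 * A * b + B * y) / q + B * b + 2 * C * y - 1 = b^4 * \<sigma>b / q"
      using b1 q0 by (simp add: field_simps)
    also have "\<dots> = b^3 * \<sigma>b / \<eta>b"
      using q b \<eta> by (simp add: field_simps power_numeral_reduce)
    finally show ?thesis .
  qed
  \<comment> \<open>\<open>m\<close> removes \<open>y\<close> as well. What remains of
    \<open>A\<close> has the same coefficient up to sign at both ends, which is what makes
    \<open>1 / p + 1 / q\<close> appear.\<close>
  have e1: "- 2 * A * \<kappa> * b + B * y = b^4 * E - A * b * (1 + \<kappa>)" using m by algebra
  have e2: "2 * A * b + B * y = b^4 * E + A * b * (1 + \<kappa>)" using m by algebra
  have "(b^4 * E - A * b * (1 + \<kappa>)) * (1/p) - (b^4 * E + A * b * (1 + \<kappa>)) * (1/q) - B * b * (1 + \<kappa>)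
      = - (b^3 * \<kappa>^3 * \<sigma>a / \<eta>a) - b^3 * \<sigma>b / \<eta>b"
    using a1' b1' unfolding e1 e2
    by (simp add: divide_inverse algebra_simps)
  then have "b * ((1 + \<kappa>) * (A * c + B)) = b^4 * E * (1/p - 1/q) + b^3 * (\<kappa>^3 * \<sigma>a / \<eta>a + \<sigma>b / \<eta>b)"
    unfolding c[symmetric] by (simp add: divide_inverse algebra_simps)
  also have "1/p - 1/q = - (1 / (\<kappa> * \<eta>a) + 1 / \<eta>b) / b"
    using p q b \<kappa> \<eta> by (simp add: field_simps)
  also have "b^4 * E * (- (1 / (\<kappa> * \<eta>a) + 1 / \<eta>b) / b) + b^3 * (\<kappa>^3 * \<sigma>a / \<eta>a + \<sigma>b / \<eta>b)
    = b * (b^2 * ((\<kappa>^3 * \<sigma>a / \<eta>a + \<sigma>b / \<eta>b) - E * (1 / (\<kappa> * \<eta>a) + 1 / \<eta>b)))"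
  proof -
    have "b^4 * E * (- X / b) + b^3 * Y = b * (b^2 * (Y - E * X))" for X Y
      using b by (simp add: field_simps power_numeral_reduce)
    then show ?thesis .
  qed
  finally show ?thesis using b by simp
qed


text \<open>\<open>osculating_chord_identity\<close> is read twice. As the chords shrink, its right
  side tends to \<open>0\<close>, so the constant satisfies \<open>A * c + B = 0\<close>. Then the
  factor next to \<open>b^2\<close> must vanish for all small chords considered, and its limit is a
  nonzero multiple of the fifth derivative \<open>D\<close> of the conic equation at
  \<open>0\<close>.\<close>

lemma monge_of_chords:
  fixes H :: "nat \<Rightarrow> real \<Rightarrow> real"
  assumes \<epsilon>: "\<epsilon> > 0"
    and deriv: "\<And>i t. i < 5 \<Longrightarrow> \<bar>t\<bar> < \<epsilon> \<Longrightarrow> (H i has_real_derivative H (Suc i) t) (at t)"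
    and cont5: "isCont (H 5) 0"
    and H0: "H 0 0 = 0" and H1: "H 1 0 = 0" and H2: "H 2 0 > 0"
    and chord: "\<And>a b. - \<epsilon> < a \<Longrightarrow> a < 0 \<Longrightarrow> 0 < b \<Longrightarrow> b < \<epsilon> \<Longrightarrow> H 0 a = H 0 b \<Longrightarrow>
                  1 / H 1 a + 1 / H 1 b = c"
  shows "9 * (H 2 0)^2 * H 5 0 - 45 * H 2 0 * H 3 0 * H 4 0 + 40 * (H 3 0)^3 = 0"
proof -
  note der = deriv[of 0, simplified] deriv[of 1, simplified] deriv[of 2, simplified]
    deriv[of 3, simplified] deriv[of 4, simplified]
  \<comment> \<open>\<open>A t\<^sup>2 + B t y + C y\<^sup>2 = y\<close> is the conic with the same 4-jet at \<open>0\<close>. The fifth derivative of its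
    equation along the curve is a multiple of Monge's expression.\<close>
  define A where "A = H 2 0 / 2"
  define B where "B = H 3 0 / (3 * H 2 0)"
  define C where "C = (H 4 0 - 4 * B * H 3 0) / (6 * (H 2 0)^2)"
  have A: "A > 0" using H2 by (simp add: A_def)
  have B3: "3 * B * H 2 0 = H 3 0" using H2 by (simp add: B_def)
  have C4: "4 * B * H 3 0 + 6 * C * (H 2 0)^2 = H 4 0" using H2 by (simp add: C_def field_simps)
  define \<Phi> :: "nat \<Rightarrow> real \<Rightarrow> real" where "\<Phi> = (\<lambda>i. [
    \<lambda>t. A * t^2 + B * (t * H 0 t) + C * (H 0 t)^2 - H 0 t,
    \<lambda>t. 2 * A * t + B * (H 0 t + t * H 1 t) + 2 * C * (H 0 t * H 1 t) - H 1 t,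
    \<lambda>t. 2 * A + B * (2 * H 1 t + t * H 2 t) + 2 * C * ((H 1 t)^2 + H 0 t * H 2 t) - H 2 t,
    \<lambda>t. B * (3 * H 2 t + t * H 3 t) + 2 * C * (3 * H 1 t * H 2 t + H 0 t * H 3 t) - H 3 t,
    \<lambda>t. B * (4 * H 3 t + t * H 4 t)
        + 2 * C * (3 * (H 2 t)^2 + 4 * H 1 t * H 3 t + H 0 t * H 4 t) - H 4 t,
    \<lambda>t. B * (5 * H 4 t + t * H 5 t)
        + 2 * C * (10 * H 2 t * H 3 t + 5 * H 1 t * H 4 t + H 0 t * H 5 t) - H 5 t] ! i)"
  have \<Phi>_der: "(\<Phi> i has_real_derivative \<Phi> (Suc i) t) (at t)" if "i < 5" "\<bar>t\<bar> < \<epsilon>" for i t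
  proof -
    note d = der[OF that(2)]
    consider "i = 0" | "i = 1" | "i = 2" | "i = 3" | "i = 4" using \<open>i < 5\<close> by linarith
    then show ?thesis
      by cases (simp_all add: \<Phi>_def,
        (rule derivative_eq_intros d refl | simp add: algebra_simps power2_eq_square numeral_eq_Suc)+)
  qed
  have \<Phi>_0: "\<Phi> i 0 = 0" if "i < 5" for i
  proof -
    consider "i = 0" | "i = 1" | "i = 2" | "i = 3" | "i = 4" using \<open>i < 5\<close> by linarith
    then show ?thesis
      using H0 H1 B3 C4 by cases (simp_all add: \<Phi>_def A_def)
  qed
  have isC: "isCont (H i) 0" if "i < 5" for i
    using DERIV_isCont[OF deriv[OF that]] \<epsilon> by simp
  have "isCont (\<Phi> 5) 0"
    unfolding \<Phi>_def using isC[of 0] isC[of 1] isC[of 2] isC[of 3] isC[of 4] cont5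
    by (simp add: continuous_intros)
  define D where "D = \<Phi> 5 0"
  have lim_\<rho>: "((\<lambda>t. \<Phi> 0 t / t^5) \<longlongrightarrow> D / 120) (at 0)"
    using vanishing_jet_tendsto[of \<epsilon> 5 \<Phi>] \<epsilon> \<Phi>_der \<Phi>_0 \<open>isCont (\<Phi> 5) 0\<close>
    by (simp add: D_def fact_numeral)
  have lim_\<sigma>: "((\<lambda>t. \<Phi> 1 t / t^4) \<longlongrightarrow> D / 24) (at 0)"
    using vanishing_jet_tendsto[of \<epsilon> 4 "\<lambda>i. \<Phi> (Suc i)"] \<epsilon> \<Phi>_der \<Phi>_0 \<open>isCont (\<Phi> 5) 0\<close>
    by (simp add: D_def fact_numeral)
  have lim_\<eta>: "((\<lambda>t. H 1 t / t) \<longlongrightarrow> 2 * A) (at 0)"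
    using vanishing_jet_tendsto[of \<epsilon> 1 "\<lambda>i. H (Suc i)"] \<epsilon> deriv isC[of 2] H1
    by (simp add: A_def numeral_2_eq_2)
  have lim_\<theta>: "((\<lambda>t. H 0 t / t^2) \<longlongrightarrow> A) (at 0)"
  proof -
    have "H i 0 = 0" if "i < 2" for i using that H0 H1 by (cases i) auto
    then show ?thesis
      using vanishing_jet_tendsto[of \<epsilon> 2 H] \<epsilon> deriv isC[of 2] by (simp add: A_def)
  qed
  have "\<forall>\<^sub>F t in at 0. H 0 t / t^2 > 0"
    using order_tendstoD(1)[OF lim_\<theta> A] .
  then obtain \<epsilon>1 where \<epsilon>1: "\<epsilon>1 > 0" "\<And>t. t \<noteq> 0 \<Longrightarrow> \<bar>t\<bar> < \<epsilon>1 \<Longrightarrow> H 0 t > 0"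
    unfolding eventually_at by (auto simp: dist_real_def zero_less_divide_iff)
  have "\<exists>a b. -\<epsilon> < a \<and> a < 0 \<and> 0 < b \<and> b < \<epsilon> \<and> H 0 a = H 0 b \<and> \<bar>a\<bar> \<le> 1 / (1 + real n) \<and> \<bar>b\<bar> \<le> 1 / (1 + real n)" for n
  proof -
    define \<delta> where "\<delta> = min (min \<epsilon> \<epsilon>1 / 2) (1 / (1 + real n))"
    have \<delta>: "\<delta> > 0" "\<delta> < \<epsilon>" "\<delta> < \<epsilon>1" "\<delta> \<le> 1 / (1 + real n)" using \<epsilon> \<epsilon>1(1) by (auto simp: \<delta>_def)
    have "continuous_on {-\<delta>..\<delta>} (H 0)"
      using \<delta> by (intro continuous_at_imp_continuous_on ballI DERIV_isCont[OF deriv[of 0]]) auto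
    with chord_pairs_exist[of \<delta> "H 0"] \<delta> H0 \<epsilon>1(2)
    obtain a b where "-\<delta> \<le> a \<and> a < 0 \<and> 0 < b \<and> b \<le> \<delta> \<and> H 0 a = H 0 b" by force
    then show ?thesis using \<delta> by (intro exI[of _ a] exI[of _ b]) auto
  qed
  then obtain a b where ab: "\<And>n. -\<epsilon> < a n" "\<And>n. a n < 0" "\<And>n. 0 < b n" "\<And>n. b n < \<epsilon>"
    "\<And>n. H 0 (a n) = H 0 (b n)" "\<And>n. \<bar>a n\<bar> \<le> 1 / (1 + real n)" "\<And>n. \<bar>b n\<bar> \<le> 1 / (1 + real n)"
    by metis
  have null: "(\<lambda>n. 1 / (1 + real n)) \<longlonglongrightarrow> 0"
    using LIMSEQ_inverse_real_of_nat by (simp add: inverse_eq_divide add.commute)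
  have "a \<longlonglongrightarrow> 0" "b \<longlonglongrightarrow> 0"
    using ab(6,7) by (auto intro!: Lim_null_comparison[OF _ null] always_eventually)
  then have a: "filterlim a (at 0) sequentially" and b: "filterlim b (at 0) sequentially"
    using ab(2,3) by (auto simp: filterlim_at less_imp_neq intro!: always_eventually)
      (metis less_irrefl)+
  define \<kappa> where "\<kappa> = (\<lambda>n. - a n / b n)"
  have \<kappa>: "\<kappa> n > 0" for n using ab(2)[of n] ab(3)[of n] by (simp add: \<kappa>_def divide_neg_pos)
  have a_eq: "a n = - \<kappa> n * b n" for n using ab(3)[of n] by (simp add: \<kappa>_def)
  \<comment> \<open>Equal heights turn \<open>\<kappa>^2\<close> into the quotient of the ratios
    \<open>H 0 t / t^2\<close> at the two ends, both of which tend to \<open>A\<close>. Cancelling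
    the heights needs them nonzero, hence the bound by \<open>\<epsilon>1\<close>.\<close>
  have lim_\<kappa>: "\<kappa> \<longlonglongrightarrow> 1"
  proof -
    have "(\<lambda>n. (H 0 (b n) / (b n)^2) / (H 0 (a n) / (a n)^2)) \<longlonglongrightarrow> A / A"
      using filterlim_compose[OF lim_\<theta> a] filterlim_compose[OF lim_\<theta> b] A
      by (intro tendsto_divide) auto
    moreover have "(H 0 (b n) / (b n)^2) / (H 0 (a n) / (a n)^2) = (\<kappa> n)^2" if "\<bar>b n\<bar> < \<epsilon>1" for n
    proof -
      have "H 0 (a n) > 0" using \<epsilon>1(2)[of "b n"] that ab(3)[of n] ab(5)[of n] by auto
      then show ?thesis using ab(5)[of n] by (simp add: \<kappa>_def power_divide)
    qed
    moreover have "\<forall>\<^sub>F n in sequentially. \<bar>b n\<bar> < \<epsilon>1"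
      using order_tendstoD(2)[OF tendsto_rabs[OF \<open>b \<longlonglongrightarrow> 0\<close>]] \<epsilon>1(1) by simp
    ultimately have "(\<lambda>n. (\<kappa> n)^2) \<longlonglongrightarrow> 1"
      using A by (auto elim!: Lim_transform_eventually eventually_mono)
    then have "(\<lambda>n. sqrt ((\<kappa> n)^2)) \<longlonglongrightarrow> sqrt 1" by (rule tendsto_real_sqrt)
    then show ?thesis using \<kappa> by (simp add: less_imp_le)
  qed
  define \<rho> \<sigma> \<eta> where "\<rho> = (\<lambda>t. \<Phi> 0 t / t^5)" and "\<sigma> = (\<lambda>t. \<Phi> 1 t / t^4)" and "\<eta> = (\<lambda>t. H 1 t / t)"
  define E where "E = (\<lambda>n. ((\<kappa> n)^5 * \<rho> (a n) + \<rho> (b n)) / (\<kappa> n + 1))"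
  define G where "G = (\<lambda>n. ((\<kappa> n)^3 * \<sigma> (a n) / \<eta> (a n) + \<sigma> (b n) / \<eta> (b n))
    - E n * (1 / (\<kappa> n * \<eta> (a n)) + 1 / \<eta> (b n)))"
  have lims: "(\<lambda>n. \<rho> (a n)) \<longlonglongrightarrow> D / 120" "(\<lambda>n. \<rho> (b n)) \<longlonglongrightarrow> D / 120"
    "(\<lambda>n. \<sigma> (a n)) \<longlonglongrightarrow> D / 24" "(\<lambda>n. \<sigma> (b n)) \<longlonglongrightarrow> D / 24"
    "(\<lambda>n. \<eta> (a n)) \<longlonglongrightarrow> 2 * A" "(\<lambda>n. \<eta> (b n)) \<longlonglongrightarrow> 2 * A"
    unfolding \<rho>_def \<sigma>_def \<eta>_def
    using filterlim_compose[OF lim_\<rho> a] filterlim_compose[OF lim_\<rho> b]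
      filterlim_compose[OF lim_\<sigma> a] filterlim_compose[OF lim_\<sigma> b]
      filterlim_compose[OF lim_\<eta> a] filterlim_compose[OF lim_\<eta> b] by auto
  have "E \<longlonglongrightarrow> (1^5 * (D/120) + D/120) / (1 + 1)"
    unfolding E_def by (intro tendsto_intros lims lim_\<kappa>) auto
  then have "E \<longlonglongrightarrow> D / 120" by simp
  then have "G \<longlonglongrightarrow> (1^3 * (D/24) / (2*A) + (D/24) / (2*A)) - D/120 * (1 / (1 * (2*A)) + 1 / (2*A))"
    unfolding G_def using A by (intro tendsto_intros lims lim_\<kappa>) auto
  \<comment> \<open>The slope equation contributes with weight 1/24 and the conic equation with
    1/120. They do not cancel, so the limit still detects \<open>D\<close>.\<close>
  also have "(1^3 * (D/24) / (2*A) + (D/24) / (2*A)) - D/120 * (1 / (1 * (2*A)) + 1 / (2*A)) = D / (30 * A)"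
    using A by (simp add: field_simps)
  finally have lim_G: "G \<longlonglongrightarrow> D / (30 * A)" .
  have "\<forall>\<^sub>F n in sequentially. \<eta> (a n) > 0" "\<forall>\<^sub>F n in sequentially. \<eta> (b n) > 0"
    using order_tendstoD(1)[OF lims(5), of 0] order_tendstoD(1)[OF lims(6), of 0] A by auto
  then have ev: "\<forall>\<^sub>F n in sequentially. (1 + \<kappa> n) * (A * c + B) = (b n)^2 * G n"
  proof eventually_elim
    case (elim n)
    have nz: "a n \<noteq> 0" "b n \<noteq> 0" using ab(2,3)[of n] by auto
    have e: "H 1 (a n) = a n * \<eta> (a n)" "H 1 (b n) = b n * \<eta> (b n)"
      "\<Phi> 0 (a n) = (a n)^5 * \<rho> (a n)" "\<Phi> 0 (b n) = (b n)^5 * \<rho> (b n)"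
      "\<Phi> 1 (a n) = (a n)^4 * \<sigma> (a n)" "\<Phi> 1 (b n) = (b n)^4 * \<sigma> (b n)"
      using nz by (simp_all add: \<eta>_def \<rho>_def \<sigma>_def)
    show ?case unfolding G_def E_def
    proof (rule osculating_chord_identity[where y = "H 0 (b n)" and C = C and p = "H 1 (a n)" and q = "H 1 (b n)"])
      show "b n \<noteq> 0" "\<kappa> n > 0" "\<eta> (a n) \<noteq> 0" "\<eta> (b n) \<noteq> 0" using nz \<kappa> elim by auto
      show "H 1 (a n) = - \<kappa> n * b n * \<eta> (a n)" "H 1 (b n) = b n * \<eta> (b n)" using e a_eq by auto
      show "1 / H 1 (a n) + 1 / H 1 (b n) = c" using chord ab by blast
      have p5: "- ((\<kappa> n * b n)^5 * \<rho> (a n)) = (a n)^5 * \<rho> (a n)"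
        and p4: "(\<kappa> n * b n)^4 * \<sigma> (a n) = (a n)^4 * \<sigma> (a n)"
        and p2: "(\<kappa> n * b n)^2 = (a n)^2" unfolding a_eq by simp_all
      show "A * (\<kappa> n * b n)^2 - B * \<kappa> n * b n * H 0 (b n) + C * (H 0 (b n))^2 - H 0 (b n) =
          - ((\<kappa> n * b n)^5 * \<rho> (a n))"
        unfolding p5 p2 e(3)[symmetric] by (simp add: \<Phi>_def ab(5)) (simp add: a_eq)
      show "A * (b n)^2 + B * b n * H 0 (b n) + C * (H 0 (b n))^2 - H 0 (b n) = (b n)^5 * \<rho> (b n)"
        unfolding e(4)[symmetric] by (simp add: \<Phi>_def)
      show "- 2 * A * \<kappa> n * b n + B * H 0 (b n) + (- B * \<kappa> n * b n + 2 * C * H 0 (b n) - 1) * H 1 (a n) =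
          (\<kappa> n * b n)^4 * \<sigma> (a n)"
        unfolding p4 e(5)[symmetric] \<Phi>_def by (simp add: ab(5)) (simp add: a_eq algebra_simps)
      show "2 * A * b n + B * H 0 (b n) + (B * b n + 2 * C * H 0 (b n) - 1) * H 1 (b n) =
          (b n)^4 * \<sigma> (b n)"
        unfolding e(6)[symmetric] \<Phi>_def by (simp add: algebra_simps)
    qed
  qed
  have "(\<lambda>n. (1 + \<kappa> n) * (A * c + B)) \<longlonglongrightarrow> (1 + 1) * (A * c + B)"
    by (intro tendsto_intros lim_\<kappa>)
  moreover have "(\<lambda>n. (b n)^2 * G n) \<longlonglongrightarrow> 0^2 * (D / (30 * A))"
    by (intro tendsto_intros lim_G \<open>b \<longlonglongrightarrow> 0\<close>)
  ultimately have "(1 + 1) * (A * c + B) = 0^2 * (D / (30 * A))"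
    by (rule LIMSEQ_unique[OF Lim_transform_eventually[OF _ ev]])
  then have "A * c + B = 0" by simp
  then have "(b n)^2 * G n = 0 \<Longrightarrow> G n = 0" for n using ab(3)[of n] by simp
  with \<open>A * c + B = 0\<close> have "\<forall>\<^sub>F n in sequentially. G n = 0"
    by (intro eventually_mono[OF ev]) simp
  then have "G \<longlonglongrightarrow> 0" by (rule tendsto_eventually)
  with lim_G have "D = 0" using A LIMSEQ_unique by fastforce
  then have five: "5 * B * H 4 0 + 20 * C * H 2 0 * H 3 0 = H 5 0"
    using H0 H1 by (simp add: D_def \<Phi>_def)
  \<comment> \<open>Eliminating \<open>B\<close> and \<open>C\<close> from the conditions of orders
    three, four and five leaves a relation in the jet alone.\<close>
  have "9 * x^2 * v - 45 * x * z * w + 40 * z^3 = 0"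
    if "5 * B * w + 20 * C * x * z = v" "3 * B * x = z" "4 * B * z + 6 * C * x^2 = w"
    for x z w v :: real
    unfolding that(1)[symmetric] that(3)[symmetric] that(2)[symmetric]
    by (simp add: algebra_simps power_numeral_reduce)
  from this[OF five B3 C4] show ?thesis .
qed

text \<open>\<open>A\<close>, \<open>B\<close>, \<open>C\<close> are the osculating coefficients of
  \<open>monge_of_chords\<close>, with \<open>C\<close> written in ratios of derivatives to match
  \<open>pick_curvature_const\<close>. In effect Monge's equation keeps the osculating conic
  unchanged along the curve, so the curve stays on the one at \<open>0\<close>.\<close>

lemma conic_of_monge:
  fixes G :: "nat \<Rightarrow> real \<Rightarrow> real"
  assumes S: "convex S" "open S" "0 \<in> S"
    and deriv: "\<And>i t. i < 5 \<Longrightarrow> t \<in> S \<Longrightarrow> (G i has_real_derivative G (Suc i) t) (at t)"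
    and G0: "G 0 0 = 0" and G1: "G 1 0 = 0" and G2: "\<And>t. t \<in> S \<Longrightarrow> G 2 t > 0"
    and monge: "\<And>t. t \<in> S \<Longrightarrow> 9 * (G 2 t)^2 * G 5 t - 45 * G 2 t * G 3 t * G 4 t + 40 * (G 3 t)^3 = 0"
    and t: "t \<in> S"
  defines "A \<equiv> G 2 0 / 2" and "B \<equiv> G 3 0 / (3 * G 2 0)"
    and "C \<equiv> (G 4 0 / G 2 0 - 4 / 3 * (G 3 0 / G 2 0)^2) / (6 * G 2 0)"
  shows "A * t^2 + B * t * G 0 t + C * (G 0 t)^2 = G 0 t"
proof -
  note der = deriv[of 0, simplified] deriv[of 1, simplified] deriv[of 2, simplified]
    deriv[of 3, simplified] deriv[of 4, simplified]
  have const: "F x = F 0" if "x \<in> S" "\<And>u. u \<in> S \<Longrightarrow> (F has_real_derivative 0) (at u)" for F x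
  proof -
    have "\<And>u. u \<in> S \<Longrightarrow> (F has_real_derivative 0) (at u within S)"
      using that(2) has_field_derivative_at_within by blast
    from has_field_derivative_zero_constant[OF S(1) this] show ?thesis using that(1) S(3) by auto
  qed
  \<comment> \<open>Monge's equation says that \<open>q0 = G''\<^bsup>-2/3\<^esup>\<close> is a quadratic polynomial. The conic equation \<open>\<Phi>\<close> below
    satisfies \<open>q0 \<Phi>' = q0' \<Phi>\<close> and vanishes at \<open>0\<close>; this treats all types of conics at once.\<close>
  define r where "r = (\<lambda>x. G 2 x powr (-1/3))"
  have r: "r x > 0" if "x \<in> S" for x using G2[OF that] by (simp add: r_def)
  \<comment> \<open>Once the derivative of \<open>r\<close> is known, this relation and positivity
    are all that is used about the fractional power; the later identities are polynomial.\<close>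
  have r3: "(r x)^3 * G 2 x = 1" if "x \<in> S" for x
    unfolding r_def by (subst powr_power) (use G2[OF that] in \<open>auto simp: powr_minus\<close>)
  have r_der: "(r has_real_derivative - (1/3) * (r x)^4 * G 3 x) (at x)" if "x \<in> S" for x
  proof -
    have "(r has_real_derivative (-1/3) * G 2 x powr (-1/3 - 1) * G 3 x) (at x)"
      unfolding r_def using G2[OF that] der(3)[OF that] by (auto intro!: derivative_eq_intros)
    moreover have "G 2 x powr (-1/3 - 1) = (r x)^4"
      using G2[OF that] by (simp add: r_def powr_power)
    ultimately show ?thesis by simp
  qed
  define q0 q1 q2 where "q0 = (\<lambda>x. (r x)^2)" and "q1 = (\<lambda>x. - (2/3) * ((r x)^5 * G 3 x))"
    and "q2 = (\<lambda>x. - (2/3) * ((r x)^5 * G 4 x - 5/3 * (r x)^8 * (G 3 x)^2))"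
  have q0_der: "(q0 has_real_derivative q1 x) (at x)" if "x \<in> S" for x
    unfolding q0_def q1_def using r_der[OF that]
    by (auto intro!: derivative_eq_intros simp: power_numeral_reduce)
  have q1_der: "(q1 has_real_derivative q2 x) (at x)" if "x \<in> S" for x
    unfolding q1_def q2_def using r_der[OF that] der(4)[OF that]
    by (auto intro!: derivative_eq_intros simp: power_numeral_reduce field_simps)
  have q2_der: "(q2 has_real_derivative 0) (at x)" if "x \<in> S" for x
  proof -
    have "(q2 has_real_derivative - (2/3) * ((r x)^5 * G 5 x - 5 * (r x)^8 * G 3 x * G 4 x + 40/9 * (r x)^11 * (G 3 x)^3)) (at x)"
      unfolding q2_def using r_der[OF that] der(4,5)[OF that]
      by (auto intro!: derivative_eq_intros simp: power_numeral_reduce field_simps)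
    moreover have "(r x)^5 * G 5 x - 5 * (r x)^8 * G 3 x * G 4 x + 40/9 * (r x)^11 * (G 3 x)^3 = 0"
    proof -
      \<comment> \<open>The terms of the derivative of \<open>q2\<close> carry \<open>r^5\<close>,
        \<open>r^8\<close> and \<open>r^11\<close>. Factors \<open>r^3 * G 2 = 1\<close> bring them
        to the common power \<open>r^11\<close>, and Monge's expression splits off.\<close>
      have "(r x)^11 / 9 * (9 * (G 2 x)^2 * G 5 x - 45 * G 2 x * G 3 x * G 4 x + 40 * (G 3 x)^3) = 0"
        using monge[OF that] by simp
      then have "(r x)^5 * ((r x)^3 * G 2 x)^2 * G 5 x - 5 * (r x)^8 * ((r x)^3 * G 2 x) * G 3 x * G 4 x
          + 40/9 * (r x)^11 * (G 3 x)^3 = 0"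
        by (simp add: power_numeral_reduce algebra_simps)
      then show ?thesis using r3[OF that] by simp
    qed
    ultimately show ?thesis by (simp only: mult_zero_right)
  qed
  define \<alpha> \<beta> \<gamma> l where "\<alpha> = q2 0 / 2" and "\<beta> = q1 0" and "\<gamma> = q0 0" and "l = 1 / r 0"
  have \<gamma>: "\<gamma> > 0" and l: "l > 0" "l^2 * \<gamma> = 1"
    using r[OF S(3)] by (auto simp: \<gamma>_def q0_def l_def power_divide)
  have q2: "q2 x = 2 * \<alpha>" if "x \<in> S" for x
    using const[OF that q2_der] by (simp add: \<alpha>_def)
  have q1: "q1 x = 2 * \<alpha> * x + \<beta>" if "x \<in> S" for x
  proof -
    have "q1 x - 2 * \<alpha> * x = q1 0 - 2 * \<alpha> * 0"
    proof (rule const[OF that])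
      fix u assume "u \<in> S"
      show "((\<lambda>x. q1 x - 2 * \<alpha> * x) has_real_derivative 0) (at u)"
        using q1_der[OF \<open>u \<in> S\<close>] q2[OF \<open>u \<in> S\<close>] by (auto intro!: derivative_eq_intros)
    qed
    then show ?thesis by (simp add: \<beta>_def)
  qed
  have q0: "q0 x = \<alpha> * x^2 + \<beta> * x + \<gamma>" if "x \<in> S" for x
  proof -
    have "q0 x - \<alpha> * x^2 - \<beta> * x = q0 0 - \<alpha> * 0^2 - \<beta> * 0"
    proof (rule const[OF that])
      fix u assume "u \<in> S"
      show "((\<lambda>x. q0 x - \<alpha> * x^2 - \<beta> * x) has_real_derivative 0) (at u)"
        using q0_der[OF \<open>u \<in> S\<close>] q1[OF \<open>u \<in> S\<close>] by (auto intro!: derivative_eq_intros)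
    qed
    then show ?thesis by (simp add: \<gamma>_def)
  qed
  \<comment> \<open>\<open>P1\<close> is the derivative of \<open>q0 * G 1 - q1 * G 0 / 2\<close>.
    Its constancy gives, after one integration, the linear first-order equation
    \<open>ode\<close>.\<close>
  define P1 where "P1 = (\<lambda>x. q0 x * G 2 x + q1 x * G 1 x / 2 - q2 x * G 0 x / 2)"
  have P1: "P1 x = l" if "x \<in> S" for x
  proof -
    have "(P1 has_real_derivative 0) (at u)" if "u \<in> S" for u
    proof -
      have "(P1 has_real_derivative q0 u * G 3 u + 3/2 * q1 u * G 2 u) (at u)"
        unfolding P1_def using q0_der[OF that] q1_der[OF that] q2_der[OF that] der[OF that]
        by (auto intro!: derivative_eq_intros simp: numeral_2_eq_2 field_simps)
      moreover have "q0 u * G 3 u + 3/2 * q1 u * G 2 u = (r u)^2 * G 3 u * (1 - (r u)^3 * G 2 u)"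
        by (simp add: q0_def q1_def algebra_simps power_numeral_reduce)
      ultimately show ?thesis using r3[OF that] by simp
    qed
    from const[OF that this] have "P1 x = P1 0" .
    also have "P1 0 = l * ((r 0)^3 * G 2 0)"
      using r[OF S(3)] G1 by (simp add: P1_def G0 q0_def l_def power_numeral_reduce)
    finally show ?thesis using r3[OF S(3)] by simp
  qed
  have ode: "q0 x * G 1 x = q1 x * G 0 x / 2 + l * x" if "x \<in> S" for x
  proof -
    have "q0 x * G 1 x - q1 x * G 0 x / 2 - l * x = q0 0 * G 1 0 - q1 0 * G 0 0 / 2 - l * 0"
    proof (rule const[OF that])
      fix u assume u: "u \<in> S"
      have "((\<lambda>x. q0 x * G 1 x - q1 x * G 0 x / 2 - l * x) has_real_derivative P1 u - l) (at u)"
        unfolding P1_def using q0_der[OF u] q1_der[OF u] der[OF u]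
        by (auto intro!: derivative_eq_intros simp: numeral_2_eq_2 field_simps)
      then show "((\<lambda>x. q0 x * G 1 x - q1 x * G 0 x / 2 - l * x) has_real_derivative 0) (at u)"
        using P1[OF u] by simp
    qed
    then show ?thesis using G1 by (simp add: G0)
  qed
  define \<delta> where "\<delta> = 4 * \<alpha> * \<gamma> - \<beta>^2"
  \<comment> \<open>For nonzero \<open>\<delta>\<close>, the solution of \<open>ode\<close> is an
    affine function plus a multiple of the square root of \<open>q0\<close>. Isolating the root,
    squaring and multiplying by \<open>- \<delta> / 4\<close> gives \<open>\<Phi>\<close>, which
    still makes sense for \<open>\<delta> = 0\<close>.\<close>
  define \<Phi> where "\<Phi> = (\<lambda>x. l^2 * x^2 - \<delta> / 4 * (G 0 x)^2 - l * \<beta> * (x * G 0 x) - 2 * l * \<gamma> * G 0 x)"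
  have q0_pos: "q0 x > 0" if "x \<in> S" for x using r[OF that] by (simp add: q0_def)
  have "\<Phi> t / q0 t = \<Phi> 0 / q0 0"
  proof (rule const[OF t])
    fix x assume x: "x \<in> S"
    define \<Phi>' where "\<Phi>' = 2 * l^2 * x - \<delta> / 2 * G 0 x * G 1 x - l * \<beta> * (G 0 x + x * G 1 x) - 2 * l * \<gamma> * G 1 x"
    have "(\<Phi> has_real_derivative \<Phi>') (at x)"
      unfolding \<Phi>_def \<Phi>'_def using der[OF x] by (auto intro!: derivative_eq_intros simp: algebra_simps)
    then have "((\<lambda>x. \<Phi> x / q0 x) has_real_derivative (\<Phi>' * q0 x - \<Phi> x * q1 x) / (q0 x * q0 x)) (at x)"
      using q0_der[OF x] q0_pos[OF x] by (auto intro!: derivative_eq_intros)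
    moreover have "\<Phi>' * q0 x - \<Phi> x * q1 x = 0"
    proof -
      have "\<Phi>' * q0 x = 2 * l^2 * x * q0 x - \<delta> / 2 * G 0 x * (q1 x * G 0 x / 2 + l * x)
          - l * \<beta> * (G 0 x * q0 x + x * (q1 x * G 0 x / 2 + l * x))
          - 2 * l * \<gamma> * (q1 x * G 0 x / 2 + l * x)"
        unfolding \<Phi>'_def ode[OF x, symmetric] by (simp add: algebra_simps)
      then show ?thesis
        unfolding \<Phi>_def q0[OF x] q1[OF x] \<delta>_def
        by (simp add: field_simps power_numeral_reduce)
    qed
    ultimately show "((\<lambda>x. \<Phi> x / q0 x) has_real_derivative 0) (at x)" by simp
  qed
  then have \<Phi>: "\<Phi> t = 0" using q0_pos[OF t] by (simp add: \<Phi>_def G0)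
  have r0: "r 0 > 0" using r[OF S(3)] .
  \<comment> \<open>\<open>l\<close> is the cube root of \<open>G 2 0\<close>; in terms of it,
    \<open>\<Phi>\<close> is the osculating conic equation up to the factor
    \<open>l / 2\<close>.\<close>
  have G20: "G 2 0 = l^3" using r3[OF S(3)] r0 by (simp add: l_def field_simps)
  have g: "\<gamma> = 1 / l^2" using l by (simp add: field_simps)
  have rl: "r 0 = 1 / l" by (simp add: l_def)
  have "A = l^3 / 2" "B = - (l^2 * \<beta>) / 2" "C = - (l * \<delta>) / 8"
    unfolding A_def B_def C_def \<delta>_def \<alpha>_def \<beta>_def q1_def q2_def g rl G20 using l(1)
    by (auto simp: field_simps power_numeral_reduce)
  then have "A * t^2 + B * t * G 0 t + C * (G 0 t)^2 - l^2 * \<gamma> * G 0 t = l / 2 * \<Phi> t"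
    unfolding \<Phi>_def by (simp add: algebra_simps power_numeral_reduce)
  then show ?thesis using \<Phi> l(2) by simp
qed

section \<open>Iterated directional derivatives\<close>

text \<open>The direction comes first so that \<open>dir_deriv v ^^ k\<close> is the iterated
  derivative along \<open>v\<close>.\<close>

definition dir_deriv :: "'a \<Rightarrow> ('a::euclidean_space \<Rightarrow> real) \<Rightarrow> 'a \<Rightarrow> real" where
  "dir_deriv v f x = frechet_derivative f (at x) v"

lemma Ck_on_Suc_dir_deriv: "Ck_on (Suc k) S f \<Longrightarrow> Ck_on k S (dir_deriv v f)"
  unfolding dir_deriv_def[abs_def] by simp

lemma Ck_on_differentiable:
  assumes "open S" "Ck_on (Suc k) S f" "x \<in> S"
  shows "f differentiable (at x)"
  using assms by (auto simp: differentiable_on_eq_differentiable_at)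

lemma Ck_on_Suc_mono: "Ck_on (Suc k) S f \<Longrightarrow> Ck_on k S f"
proof (induction k arbitrary: f)
  case 0
  then show ?case by (auto intro: differentiable_imp_continuous_on)
next
  case (Suc k)
  then show ?case by (metis Ck_on.simps(2))
qed

lemma Ck_on_mono: "Ck_on k S f \<Longrightarrow> j \<le> k \<Longrightarrow> Ck_on j S f"
proof (induction k)
  case (Suc k)
  then show ?case by (metis Ck_on_Suc_mono le_Suc_eq)
qed simp

lemma Ck_on_continuous_on: "Ck_on k S f \<Longrightarrow> continuous_on S f"
  using Ck_on_mono[of k S f 0] by simp

lemma Ck_on_funpow_dir_deriv:
  "Ck_on k S f \<Longrightarrow> i \<le> k \<Longrightarrow> Ck_on (k - i) S ((dir_deriv v ^^ i) f)"
proof (induction i)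
  case (Suc i)
  then have "Ck_on (Suc (k - Suc i)) S ((dir_deriv v ^^ i) f)" by (simp add: Suc_diff_Suc)
  then show ?case using Ck_on_Suc_dir_deriv by simp
qed simp

lemma dir_deriv_has_derivative:
  "f differentiable (at x) \<Longrightarrow> (f has_derivative (\<lambda>v. dir_deriv v f x)) (at x)"
  unfolding dir_deriv_def by (simp add: frechet_derivative_works[symmetric])

lemma dir_deriv_linear: "f differentiable (at x) \<Longrightarrow> linear (\<lambda>v. dir_deriv v f x)"
  using dir_deriv_has_derivative has_derivative_linear by blast

lemma dir_deriv_line:
  assumes "f differentiable (at (x + t *\<^sub>R v))"
  shows "((\<lambda>s. f (x + s *\<^sub>R v)) has_real_derivative dir_deriv v f (x + t *\<^sub>R v)) (at t)"
proof -
  have "((\<lambda>s. x + s *\<^sub>R v) has_derivative (\<lambda>s. s *\<^sub>R v)) (at t)"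
    by (auto intro!: derivative_eq_intros)
  from has_derivative_compose[OF this dir_deriv_has_derivative[OF assms]]
  have "((\<lambda>s. f (x + s *\<^sub>R v)) has_derivative (\<lambda>s. dir_deriv (s *\<^sub>R v) f (x + t *\<^sub>R v))) (at t)" .
  moreover have "dir_deriv (s *\<^sub>R v) f (x + t *\<^sub>R v) = dir_deriv v f (x + t *\<^sub>R v) * s" for s
    using linear_scale[OF dir_deriv_linear[OF assms]] by simp
  ultimately show ?thesis by (simp add: has_field_derivative_def)
qed

lemma dir_deriv_cong:
  assumes "open S" "x \<in> S" "\<And>y. y \<in> S \<Longrightarrow> f y = g y"
  shows "dir_deriv v f x = dir_deriv v g x"
proof -
  have "(f has_derivative D) (at x) \<longleftrightarrow> (g has_derivative D) (at x)" for D
    using has_derivative_transform_within_open[OF _ assms(1,2), of f D UNIV g]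
      has_derivative_transform_within_open[OF _ assms(1,2), of g D UNIV f] assms(3) by auto
  then show ?thesis by (simp add: dir_deriv_def frechet_derivative_def)
qed

text \<open>The mean value theorem is applied first along \<open>u\<close> and then along
  \<open>v\<close>. The left side is symmetric in \<open>u\<close> and \<open>v\<close>, which is
  the source of \<open>dir_deriv_commute\<close>.\<close>

lemma second_difference_mvt:
  assumes "open S" "Ck_on 2 S f" "s > 0"
    and S: "\<And>a b. 0 \<le> a \<Longrightarrow> a \<le> s \<Longrightarrow> 0 \<le> b \<Longrightarrow> b \<le> s \<Longrightarrow> x + a *\<^sub>R u + b *\<^sub>R v \<in> S"
  shows "\<exists>a b. 0 < a \<and> a < s \<and> 0 < b \<and> b < s \<and>
    f (x + s *\<^sub>R u + s *\<^sub>R v) - f (x + s *\<^sub>R u) - f (x + s *\<^sub>R v) + f x =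
    s^2 * dir_deriv v (dir_deriv u f) (x + a *\<^sub>R u + b *\<^sub>R v)"
proof -
  have df: "f differentiable (at y)" if "y \<in> S" for y
    using Ck_on_differentiable[OF assms(1) _ that, of 1 f] assms(2) by (simp add: numeral_2_eq_2)
  have ddf: "dir_deriv u f differentiable (at y)" if "y \<in> S" for y
    using Ck_on_differentiable[OF assms(1) _ that, of 0] Ck_on_Suc_dir_deriv[of 1 S f u] assms(2)
    by (simp add: numeral_2_eq_2)
  define \<phi> where "\<phi> = (\<lambda>t. f ((x + s *\<^sub>R v) + t *\<^sub>R u) - f (x + t *\<^sub>R u))"
  have "(\<phi> has_real_derivative dir_deriv u f ((x + s *\<^sub>R v) + t *\<^sub>R u) - dir_deriv u f (x + t *\<^sub>R u)) (at t)"
    if "0 \<le> t" "t \<le> s" for t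
  proof -
    have "(x + s *\<^sub>R v) + t *\<^sub>R u \<in> S" "x + t *\<^sub>R u \<in> S"
      using S[of t s] S[of t 0] that \<open>s > 0\<close> by (simp_all add: algebra_simps)
    then show ?thesis unfolding \<phi>_def by (intro DERIV_diff dir_deriv_line df)
  qed
  from MVT2[OF \<open>s > 0\<close> this] obtain a where a: "0 < a" "a < s"
    "\<phi> s - \<phi> 0 = s * (dir_deriv u f ((x + s *\<^sub>R v) + a *\<^sub>R u) - dir_deriv u f (x + a *\<^sub>R u))"
    by auto
  have "((\<lambda>t. dir_deriv u f ((x + a *\<^sub>R u) + t *\<^sub>R v)) has_real_derivative
      dir_deriv v (dir_deriv u f) ((x + a *\<^sub>R u) + t *\<^sub>R v)) (at t)" if "0 \<le> t" "t \<le> s" for t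
    using S[of a t] a that by (intro dir_deriv_line ddf) auto
  from MVT2[OF \<open>s > 0\<close> this] obtain b where "0 < b" "b < s"
    "dir_deriv u f ((x + a *\<^sub>R u) + s *\<^sub>R v) - dir_deriv u f (x + a *\<^sub>R u) =
      s * dir_deriv v (dir_deriv u f) ((x + a *\<^sub>R u) + b *\<^sub>R v)"
    by auto
  with a show ?thesis
    by (intro exI[of _ a] exI[of _ b]) (simp add: \<phi>_def power2_eq_square algebra_simps)
qed

lemma dir_deriv_commute:
  assumes "open S" "Ck_on 2 S f" "x \<in> S"
  shows "dir_deriv u (dir_deriv v f) x = dir_deriv v (dir_deriv u f) x"
proof -
  obtain \<epsilon> where \<epsilon>: "\<epsilon> > 0" "ball x \<epsilon> \<subseteq> S" using assms(1,3) openE by blast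
  \<comment> \<open>Keeps the parallelogram spanned by \<open>\<delta> *\<^sub>R u\<close> and
    \<open>\<delta> *\<^sub>R v\<close> at \<open>x\<close> inside the ball; the summand
    \<open>1\<close> covers \<open>u = v = 0\<close>.\<close>
  define \<delta> where "\<delta> = \<epsilon> / (2 * (norm u + norm v + 1))"
  have pos: "norm u + norm v + 1 > 0" by (smt (verit) norm_ge_zero)
  then have \<delta>: "\<delta> > 0" using \<epsilon>(1) by (simp add: \<delta>_def)
  have near: "norm (a *\<^sub>R u + b *\<^sub>R v) \<le> s * (norm u + norm v)"
    if "0 \<le> a" "a \<le> s" "0 \<le> b" "b \<le> s" for a b s
  proof -
    have "norm (a *\<^sub>R u + b *\<^sub>R v) \<le> a * norm u + b * norm v"
      using norm_triangle_ineq[of "a *\<^sub>R u" "b *\<^sub>R v"] that by simp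
    also have "\<dots> \<le> s * norm u + s * norm v" using that by (intro add_mono mult_right_mono) auto
    finally show ?thesis by (simp add: algebra_simps)
  qed
  have inS: "x + a *\<^sub>R u + b *\<^sub>R v \<in> S"
    if "0 \<le> a" "a \<le> s" "0 \<le> b" "b \<le> s" "s \<le> \<delta>" for a b s
  proof -
    have "s * (norm u + norm v) \<le> \<delta> * (norm u + norm v + 1)" using that \<delta> by (intro mult_mono) auto
    also have "\<dots> = \<epsilon> / 2"
    proof -
      have "\<epsilon> / (2 * N) * N = \<epsilon> / 2" if "N > 0" for N :: real using that by simp
      then show ?thesis using pos unfolding \<delta>_def .
    qed
    finally have "norm (a *\<^sub>R u + b *\<^sub>R v) < \<epsilon>" using near[of a s b] that \<epsilon>(1) by linarith
    then have "x + (a *\<^sub>R u + b *\<^sub>R v) \<in> ball x \<epsilon>"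
      by (metis add_diff_cancel_left' dist_commute dist_norm mem_ball)
    then show ?thesis using \<epsilon>(2) by (auto simp: add.assoc)
  qed
  define s where "s = (\<lambda>n. \<delta> / real (Suc n))"
  have s: "s n > 0" "s n \<le> \<delta>" for n using \<delta> by (auto simp: s_def field_simps)
  have "s \<longlonglongrightarrow> 0"
    unfolding s_def using LIMSEQ_inverse_real_of_nat[THEN tendsto_mult_right_zero, of \<delta>]
    by (simp add: inverse_eq_divide mult.commute)
  then have s0: "(\<lambda>n. s n * (norm u + norm v)) \<longlonglongrightarrow> 0" by (rule tendsto_mult_left_zero)
  have ex: "\<exists>a b a' b'. 0 < a \<and> a < s n \<and> 0 < b \<and> b < s n \<and> 0 < a' \<and> a' < s n \<and> 0 < b' \<and> b' < s n \<and>
      dir_deriv v (dir_deriv u f) (x + (a *\<^sub>R u + b *\<^sub>R v)) =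
      dir_deriv u (dir_deriv v f) (x + (a' *\<^sub>R u + b' *\<^sub>R v))" for n
  proof -
    obtain a b where ab: "0 < a \<and> a < s n \<and> 0 < b \<and> b < s n"
      "f (x + s n *\<^sub>R u + s n *\<^sub>R v) - f (x + s n *\<^sub>R u) - f (x + s n *\<^sub>R v) + f x =
       (s n)^2 * dir_deriv v (dir_deriv u f) (x + a *\<^sub>R u + b *\<^sub>R v)"
      using second_difference_mvt[OF assms(1,2) s(1)[of n], of x u v] inS s(2)[of n] by blast
    have "x + a *\<^sub>R v + b *\<^sub>R u \<in> S" if "0 \<le> a" "a \<le> s n" "0 \<le> b" "b \<le> s n" for a b
      using inS[of b "s n" a] that s(2)[of n] by (simp add: algebra_simps)
    then obtain b' a' where ab': "0 < b' \<and> b' < s n \<and> 0 < a' \<and> a' < s n"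
      "f (x + s n *\<^sub>R v + s n *\<^sub>R u) - f (x + s n *\<^sub>R v) - f (x + s n *\<^sub>R u) + f x =
       (s n)^2 * dir_deriv u (dir_deriv v f) (x + b' *\<^sub>R v + a' *\<^sub>R u)"
      using second_difference_mvt[OF assms(1,2) s(1)[of n], of x v u] by blast
    have "(s n)^2 * dir_deriv v (dir_deriv u f) (x + (a *\<^sub>R u + b *\<^sub>R v)) =
        (s n)^2 * dir_deriv u (dir_deriv v f) (x + (a' *\<^sub>R u + b' *\<^sub>R v))"
      using ab(2) ab'(2) by (simp add: algebra_simps)
    then show ?thesis using ab(1) ab'(1) s(1)[of n] by (intro exI[of _ a] exI[of _ b] exI[of _ a'] exI[of _ b']) auto
  qed
  obtain a b a' b' where abs: "\<And>n. 0 < a n \<and> a n < s n \<and> 0 < b n \<and> b n < s n \<and> 0 < a' n \<and> a' n < s n \<and> 0 < b' n \<and> b' n < s n \<and>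
      dir_deriv v (dir_deriv u f) (x + (a n *\<^sub>R u + b n *\<^sub>R v)) =
      dir_deriv u (dir_deriv v f) (x + (a' n *\<^sub>R u + b' n *\<^sub>R v))"
    using ex by metis
  have "(\<lambda>n. a n *\<^sub>R u + b n *\<^sub>R v) \<longlonglongrightarrow> 0" "(\<lambda>n. a' n *\<^sub>R u + b' n *\<^sub>R v) \<longlonglongrightarrow> 0"
    using abs by (auto intro!: Lim_null_comparison[OF _ s0] always_eventually near simp: less_imp_le)
  then have lim: "(\<lambda>n. x + (a n *\<^sub>R u + b n *\<^sub>R v)) \<longlonglongrightarrow> x" "(\<lambda>n. x + (a' n *\<^sub>R u + b' n *\<^sub>R v)) \<longlonglongrightarrow> x"
    using tendsto_add[OF tendsto_const] by fastforce+
  have "continuous_on S (dir_deriv u (dir_deriv v f))" "continuous_on S (dir_deriv v (dir_deriv u f))"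
    using assms(2) Ck_on_Suc_dir_deriv[of 1 S f] Ck_on_Suc_dir_deriv[of 0 S]
    by (auto simp: numeral_2_eq_2)
  then have cont: "isCont (dir_deriv u (dir_deriv v f)) x" "isCont (dir_deriv v (dir_deriv u f)) x"
    using assms(1,3) continuous_on_eq_continuous_at by blast+
  show ?thesis
    using isCont_tendsto_compose[OF cont(1) lim(2)] isCont_tendsto_compose[OF cont(2) lim(1)] abs
    by (auto dest: LIMSEQ_unique)
qed

lemma dir_deriv_funpow_commute:
  assumes "open S" "Ck_on k S g" "Suc j \<le> k" "x \<in> S"
  shows "dir_deriv u ((dir_deriv w ^^ j) g) x = (dir_deriv w ^^ j) (dir_deriv u g) x"
  using assms(3,4)
proof (induction j arbitrary: x)
  case (Suc j)
  have "Ck_on (k - j) S ((dir_deriv w ^^ j) g)"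
    using Ck_on_funpow_dir_deriv[OF assms(2), of j w] Suc.prems by simp
  then have "Ck_on 2 S ((dir_deriv w ^^ j) g)" using Suc.prems by (auto elim!: Ck_on_mono)
  then have "dir_deriv u ((dir_deriv w ^^ Suc j) g) x = dir_deriv w (dir_deriv u ((dir_deriv w ^^ j) g)) x"
    using dir_deriv_commute[OF assms(1)] Suc.prems by simp
  also have "\<dots> = dir_deriv w ((dir_deriv w ^^ j) (dir_deriv u g)) x"
    using Suc by (intro dir_deriv_cong[OF assms(1)]) auto
  finally show ?case by simp
qed simp

section \<open>Mixed derivatives along two directions and their binomial expansion\<close>

definition partial_deriv :: "'a \<Rightarrow> 'a \<Rightarrow> ('a::euclidean_space \<Rightarrow> real) \<Rightarrow> nat \<Rightarrow> nat \<Rightarrow> 'a \<Rightarrow> real" where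
  "partial_deriv u w f i j = (dir_deriv w ^^ j) ((dir_deriv u ^^ i) f)"

lemma Ck_on_partial_deriv:
  assumes "Ck_on k S f" "i + j \<le> k"
  shows "Ck_on (k - (i + j)) S (partial_deriv u w f i j)"
  using Ck_on_funpow_dir_deriv[OF Ck_on_funpow_dir_deriv[OF assms(1), of i u], of j w] assms(2)
  by (simp add: partial_deriv_def)

lemma partial_deriv_line:
  assumes S: "open S" "Ck_on k S f" "Suc (i + j) \<le> k" "z + t *\<^sub>R (x *\<^sub>R u + y *\<^sub>R w) \<in> S"
  shows "((\<lambda>s. partial_deriv u w f i j (z + s *\<^sub>R (x *\<^sub>R u + y *\<^sub>R w))) has_real_derivative
    x * partial_deriv u w f (Suc i) j (z + t *\<^sub>R (x *\<^sub>R u + y *\<^sub>R w)) +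
    y * partial_deriv u w f i (Suc j) (z + t *\<^sub>R (x *\<^sub>R u + y *\<^sub>R w))) (at t)"
proof -
  let ?p = "z + t *\<^sub>R (x *\<^sub>R u + y *\<^sub>R w)"
  have "Ck_on (Suc (k - Suc (i + j))) S (partial_deriv u w f i j)"
    using Ck_on_partial_deriv[OF S(2), of i j u w] S(3) by (simp add: Suc_diff_Suc)
  then have d: "partial_deriv u w f i j differentiable (at ?p)"
    using Ck_on_differentiable[OF S(1)] S(4) by blast
  have "dir_deriv u (partial_deriv u w f i j) ?p = partial_deriv u w f (Suc i) j ?p"
    using dir_deriv_funpow_commute[OF S(1) Ck_on_funpow_dir_deriv[OF S(2), of i u], of j ?p u w] S(3,4)
    by (simp add: partial_deriv_def)
  moreover have "dir_deriv w (partial_deriv u w f i j) ?p = partial_deriv u w f i (Suc j) ?p"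
    by (simp add: partial_deriv_def)
  ultimately show ?thesis
    using dir_deriv_line[OF d] linear_add[OF dir_deriv_linear[OF d]] linear_scale[OF dir_deriv_linear[OF d]]
    by simp
qed

lemma funpow_dir_deriv_line:
  assumes "open S" "Ck_on k S f" "Suc i \<le> k" "z + t *\<^sub>R v \<in> S"
  shows "((\<lambda>s. (dir_deriv v ^^ i) f (z + s *\<^sub>R v)) has_real_derivative
    (dir_deriv v ^^ Suc i) f (z + t *\<^sub>R v)) (at t)"
  using partial_deriv_line[OF assms(1,2), of i 0 z t 1 v 0 0] assms(3,4)
  by (simp add: partial_deriv_def)

lemma sum_binomial_Suc:
  fixes a :: "nat \<Rightarrow> real"
  shows "(\<Sum>i\<le>k. real (k choose i) * (a (Suc i) + a i)) = (\<Sum>i\<le>Suc k. real (Suc k choose i) * a i)"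
proof -
  have "(\<Sum>i\<le>Suc k. real (Suc k choose i) * a i) =
      a 0 + (\<Sum>i\<le>k. real (k choose Suc i) * a (Suc i)) + (\<Sum>i\<le>k. real (k choose i) * a (Suc i))"
    by (subst sum.atMost_Suc_shift) (simp add: algebra_simps sum.distrib)
  also have "a 0 + (\<Sum>i\<le>k. real (k choose Suc i) * a (Suc i)) = (\<Sum>i\<le>Suc k. real (k choose i) * a i)"
    by (subst sum.atMost_Suc_shift) simp
  also have "\<dots> = (\<Sum>i\<le>k. real (k choose i) * a i)" by (simp add: binomial_eq_0)
  finally show ?thesis by (simp add: algebra_simps sum.distrib)
qed

text \<open>The induction differentiates the expansion itself, so its hypothesis is needed at all
  points near \<open>z\<close>; openness of \<open>S\<close> supplies them and Pascal's rule
  collects the terms. This is what makes Monge's equation polynomial in the direction.\<close>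

lemma funpow_dir_deriv_expand:
  assumes S: "open S" "Ck_on n S f" and "k \<le> n" "z \<in> S"
  shows "(dir_deriv (x *\<^sub>R u + y *\<^sub>R w) ^^ k) f z =
    (\<Sum>i\<le>k. real (k choose i) * (x ^ i * y ^ (k - i) * partial_deriv u w f i (k - i) z))"
  using assms(3,4)
proof (induction k arbitrary: z)
  case 0
  then show ?case by (simp add: partial_deriv_def)
next
  case (Suc k)
  let ?v = "x *\<^sub>R u + y *\<^sub>R w"
  let ?F = "partial_deriv u w f"
  have "((\<lambda>s. \<Sum>i\<le>k. real (k choose i) * (x ^ i * y ^ (k - i) * ?F i (k - i) (z + s *\<^sub>R ?v))) has_real_derivative
     (\<Sum>i\<le>k. real (k choose i) * (x ^ i * y ^ (k - i) *
        (x * ?F (Suc i) (k - i) (z + 0 *\<^sub>R ?v) + y * ?F i (Suc (k - i)) (z + 0 *\<^sub>R ?v))))) (at 0)"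
    using Suc.prems by (intro DERIV_sum DERIV_cmult partial_deriv_line[OF S]) auto
  moreover have "\<forall>\<^sub>F s in nhds 0. (\<Sum>i\<le>k. real (k choose i) * (x ^ i * y ^ (k - i) * ?F i (k - i) (z + s *\<^sub>R ?v)))
      = (dir_deriv ?v ^^ k) f (z + s *\<^sub>R ?v)"
  proof -
    have "open ((\<lambda>s. z + s *\<^sub>R ?v) -` S)"
      by (intro open_vimage S(1) continuous_intros)
    then have "\<forall>\<^sub>F s in nhds 0. z + s *\<^sub>R ?v \<in> S"
      using Suc.prems eventually_nhds_in_open[of "(\<lambda>s. z + s *\<^sub>R ?v) -` S" "0::real"] by simp
    then show ?thesis by eventually_elim (use Suc in auto)
  qed
  ultimately have "((\<lambda>s. (dir_deriv ?v ^^ k) f (z + s *\<^sub>R ?v)) has_real_derivative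
     (\<Sum>i\<le>k. real (k choose i) * (x ^ i * y ^ (k - i) * (x * ?F (Suc i) (k - i) z + y * ?F i (Suc (k - i)) z)))) (at 0)"
    by (subst (asm) DERIV_cong_ev) auto
  moreover have "((\<lambda>s. (dir_deriv ?v ^^ k) f (z + s *\<^sub>R ?v)) has_real_derivative (dir_deriv ?v ^^ Suc k) f z) (at 0)"
    using funpow_dir_deriv_line[OF S, of k z 0 ?v] Suc.prems by simp
  ultimately have "(dir_deriv ?v ^^ Suc k) f z =
     (\<Sum>i\<le>k. real (k choose i) * (x ^ i * y ^ (k - i) * (x * ?F (Suc i) (k - i) z + y * ?F i (Suc (k - i)) z)))"
    by (rule DERIV_unique[symmetric])
  also have "\<dots> = (\<Sum>i\<le>k. real (k choose i) *
      (x ^ Suc i * y ^ (Suc k - Suc i) * ?F (Suc i) (Suc k - Suc i) z + x ^ i * y ^ (Suc k - i) * ?F i (Suc k - i) z))"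
    by (intro sum.cong refl) (auto simp: algebra_simps Suc_diff_le)
  also have "\<dots> = (\<Sum>i\<le>Suc k. real (Suc k choose i) * (x ^ i * y ^ (Suc k - i) * ?F i (Suc k - i) z))"
    by (rule sum_binomial_Suc[where a = "\<lambda>i. x ^ i * y ^ (Suc k - i) * ?F i (Suc k - i) z"])
  finally show ?case .
qed

section \<open>The cubic form\<close>

text \<open>At a non-real root of the quadratic form the identity forces the cubic form to vanish, so the
  quadratic form divides the cubic one. The conclusion is this divisibility with the linear
  quotient eliminated.\<close>

lemma pick_relations:
  fixes E F G a b c d :: real
  assumes G: "G > 0" and disc: "E * G > F^2"
    and id: "\<And>m. 9 * (E + 2 * F * m + G * m^2)^2 * poly p5 m
      - 45 * (E + 2 * F * m + G * m^2) * (a + 3 * b * m + 3 * c * m^2 + d * m^3) * poly p4 m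
      + 40 * (a + 3 * b * m + 3 * c * m^2 + d * m^3)^3 = 0"
  shows "3 * b * E * G = d * E^2 + 2 * a * F * G" and "3 * c * E * G = a * G^2 + 2 * d * F * E"
proof -
  define q2 where "q2 = [:complex_of_real E, 2 * of_real F, of_real G:]"
  define q3 where "q3 = [:complex_of_real a, 3 * of_real b, 3 * of_real c, of_real d:]"
  define P4 P5 where "P4 = map_poly complex_of_real p4" and "P5 = map_poly complex_of_real p5"
  define q where "q = 9 * q2^2 * P5 - 45 * q2 * q3 * P4 + 40 * q3^3"
  have "poly (map_poly complex_of_real p) (of_real m) = of_real (poly p m)" for p m
    by (induction p) (simp_all add: map_poly_pCons)
  then have P: "poly P4 (of_real m) = of_real (poly p4 m)" "poly P5 (of_real m) = of_real (poly p5 m)" for m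
    by (simp_all add: P4_def P5_def)
  have "poly q (of_real m) = 0" for m
  proof -
    have "poly q2 (of_real m) = of_real (E + 2 * F * m + G * m^2)"
      "poly q3 (of_real m) = of_real (a + 3 * b * m + 3 * c * m^2 + d * m^3)"
      by (simp_all add: q2_def q3_def algebra_simps power_numeral_reduce)
    then have "poly q (of_real m) = of_real (9 * (E + 2 * F * m + G * m^2)^2 * poly p5 m
      - 45 * (E + 2 * F * m + G * m^2) * (a + 3 * b * m + 3 * c * m^2 + d * m^3) * poly p4 m
      + 40 * (a + 3 * b * m + 3 * c * m^2 + d * m^3)^3)"
      by (simp add: q_def P)
    then show ?thesis unfolding id by simp
  qed
  then have "range complex_of_real \<subseteq> {m. poly q m = 0}" by auto
  moreover have "infinite (range complex_of_real)"
    using range_inj_infinite[of complex_of_real] infinite_UNIV_char_0[where 'a = real]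
    by (metis finite_imageD inj_on_def of_real_eq_iff)
  ultimately have q: "q = 0" using poly_roots_finite finite_subset by blast
  \<comment> \<open>\<open>Complex s t\<close> is a root of \<open>E + 2 * F * m + G * m^2\<close>;
    the discriminant condition puts it off the real axis.\<close>
  define s t where "s = - F / G" and "t = sqrt (E / G - s^2)"
  have "E / G - s^2 > 0"
    using G disc by (simp add: s_def power_divide field_simps power2_eq_square)
  then have t: "t > 0" "t^2 = E / G - s^2" by (auto simp: t_def)
  have F': "F = - s * G" using G by (simp add: s_def)
  have E': "E = G * (s^2 + t^2)" using G t by (simp add: field_simps)
  have "poly q2 (Complex s t) = 0"
    unfolding q2_def E' F' by (simp add: complex_eq_iff algebra_simps power2_eq_square)
  then have "poly q3 (Complex s t) = 0"
    using arg_cong[OF q, of "\<lambda>p. poly p (Complex s t)"] by (simp add: q_def)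
  then have re: "a + 3 * b * s + 3 * c * (s^2 - t^2) + d * (s^3 - 3 * s * t^2) = 0"
    and im: "t * (3 * b + 6 * c * s + d * (3 * s^2 - t^2)) = 0"
    unfolding q3_def by (simp_all add: complex_eq_iff algebra_simps power_numeral_reduce)
  have b': "3 * b = - 6 * c * s - d * (3 * s^2 - t^2)" using im t(1) by simp
  then have a': "a = 3 * c * (s^2 + t^2) + 2 * d * s * (s^2 + t^2)" using re by algebra
  show "3 * b * E * G = d * E^2 + 2 * a * F * G" "3 * c * E * G = a * G^2 + 2 * d * F * E"
    unfolding b' a' E' F' by (simp_all add: algebra_simps power_numeral_reduce)
qed

text \<open>The numbers \<open>a\<close>, \<open>3 * b\<close>, \<open>3 * c\<close>,
  \<open>d\<close> are the coefficients of
  \<open>(E x^2 + 2 F x y + G y^2) (\<mu> x + \<nu> y)\<close>: the outer ones fix the quotient, and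
  the two relations then give the inner ones.\<close>

lemma pick_linear_factor:
  fixes E F G a b c d \<mu> \<nu> :: real
  assumes "E > 0" "G > 0" "a = \<mu> * E" "d = \<nu> * G"
    and "3 * b * E * G = d * E^2 + 2 * a * F * G" "3 * c * E * G = a * G^2 + 2 * d * F * E"
  shows "b = (\<nu> * E + 2 * \<mu> * F) / 3" "c = (\<mu> * G + 2 * \<nu> * F) / 3"
proof -
  have "3 * b * (E * G) = (\<nu> * E + 2 * \<mu> * F) * (E * G)" "3 * c * (E * G) = (\<mu> * G + 2 * \<nu> * F) * (E * G)"
    using assms(5,6) unfolding assms(3,4) by (simp_all add: algebra_simps power_numeral_reduce)
  then show "b = (\<nu> * E + 2 * \<mu> * F) / 3" "c = (\<mu> * G + 2 * \<nu> * F) / 3"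
    using assms(1,2) by simp_all
qed

text \<open>\<open>D1\<close>, \<open>D2\<close> and \<open>D3\<close>, \<open>D4\<close> are the derivatives of \<open>r1\<close> and \<open>r2\<close> in the two coordinate
  directions. In the proof \<open>p\<close>, \<open>r\<close>, \<open>s\<close>, \<open>q\<close> are the entries of \<open>d\<lambda> - \<lambda> \<otimes> \<lambda> / 3\<close>, where \<open>\<lambda> = (\<mu>, \<nu>)\<close> is the
  quotient of the cubic by the quadratic form.\<close>

lemma pick_curvature_const:
  fixes E F G a b c d f40 f31 f22 f13 f04 :: real
  assumes pos: "E > 0" "G > 0" and disc: "E * G > F^2"
    and r1: "3 * b * E * G = d * E^2 + 2 * a * F * G"
    and r2: "3 * c * E * G = a * G^2 + 2 * d * F * E"
    and D1: "3 * (f31 * E * G + b * a * G + b * E * c) = f13 * E^2 + 2 * d * E * a + 2 * (f40 * F * G + a * b * G + a * F * c)"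
    and D2: "3 * (f22 * E * G + b * b * G + b * E * d) = f04 * E^2 + 2 * d * E * b + 2 * (f31 * F * G + a * c * G + a * F * d)"
    and D3: "3 * (f22 * E * G + c * a * G + c * E * c) = f40 * G^2 + 2 * a * G * c + 2 * (f13 * F * E + d * b * E + d * F * a)"
    and D4: "3 * (f13 * E * G + c * b * G + c * E * d) = f31 * G^2 + 2 * a * G * d + 2 * (f04 * F * E + d * c * E + d * F * b)"
  shows "(f40 / E - 4 / 3 * (a / E)^2) / (6 * E) = (f04 / G - 4 / 3 * (d / G)^2) / (6 * G)"
proof -
  define \<mu> \<nu> where "\<mu> = a / E" and "\<nu> = d / G"
  have ad: "a = \<mu> * E" "d = \<nu> * G" using pos by (auto simp: \<mu>_def \<nu>_def)
  note bc = pick_linear_factor[OF pos ad r1 r2]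
  define p q r s where "p = (f40 - 4 / 3 * \<mu>^2 * E) / E" and "q = (f04 - 4 / 3 * \<nu>^2 * G) / G"
    and "r = (f31 - \<mu> * b) / E - \<mu> * \<nu> / 3" and "s = (f13 - \<nu> * c) / G - \<mu> * \<nu> / 3"
  have f: "f40 = p * E + 4 / 3 * \<mu>^2 * E" "f04 = q * G + 4 / 3 * \<nu>^2 * G"
    "f31 = (r + \<mu> * \<nu> / 3) * E + \<mu> * b" "f13 = (s + \<mu> * \<nu> / 3) * G + \<nu> * c"
    using pos by (simp_all add: p_def q_def r_def s_def)
  have "E * G * ((3 * r - s) * E - 2 * p * F) = 0"
    using D1 unfolding f unfolding bc ad by (simp add: field_simps power_numeral_reduce)
  then have e1: "(3 * r - s) * E = 2 * p * F" using pos by simp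
  have "E * G * ((3 * s - r) * G - 2 * q * F) = 0"
    using D4 unfolding f unfolding bc ad by (simp add: field_simps power_numeral_reduce)
  then have e2: "(3 * s - r) * G = 2 * q * F" using pos by simp
  \<comment> \<open>\<open>D2\<close> and \<open>D3\<close> both contain the derivative
    \<open>f22\<close>, taken twice in each direction; equating the two expressions eliminates
    it.\<close>
  have "f04 * E^2 + 2 * d * E * b + 2 * (f31 * F * G + a * c * G + a * F * d) - 3 * (b * b * G + b * E * d)
    = f40 * G^2 + 2 * a * G * c + 2 * (f13 * F * E + d * b * E + d * F * a) - 3 * (c * a * G + c * E * c)"
    using D2 D3 by (simp add: algebra_simps)
  then have "E * G * (q * E + 2 * r * F - p * G - 2 * s * F) = 0"
    unfolding f unfolding bc ad by (simp add: field_simps power_numeral_reduce)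
  then have e3: "q * E + 2 * r * F = p * G + 2 * s * F" using pos by simp
  \<comment> \<open>A homogeneous linear system for \<open>r - s\<close> and
    \<open>p / E - q / G\<close> arises; its determinant is a multiple of
    \<open>E * G - F^2\<close>, hence nonzero.\<close>
  have "4 * (r - s) = 2 * F * (p / E - q / G)"
  proof -
    have "3 * r - s = 2 * p * F / E" "3 * s - r = 2 * q * F / G" using e1 e2 pos by (auto simp: field_simps)
    then show ?thesis by (simp add: algebra_simps)
  qed
  moreover have "(p / E - q / G) * (E * G) = 2 * F * (r - s)"
  proof -
    have "(p / E - q / G) * (E * G) = p * G - q * E" using pos by (simp add: field_simps)
    then show ?thesis using e3 by (simp add: algebra_simps)
  qed
  ultimately have "(p / E - q / G) * (E * G - F^2) = 0" by algebra
  then have pq: "p / E = q / G" using disc by simp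
  have "(f40 / E - 4 / 3 * (a / E)^2) / (6 * E) = p / E / 6" "(f04 / G - 4 / 3 * (d / G)^2) / (6 * G) = q / G / 6"
    unfolding p_def q_def \<mu>_def \<nu>_def using pos by (auto simp: field_simps)
  then show ?thesis using pq by simp
qed

text \<open>Serves both relations: exchanging the two directions swaps \<open>E\<close> with
  \<open>G\<close>, \<open>a\<close> with \<open>d\<close> and \<open>b\<close> with
  \<open>c\<close>, and turns the first relation into the second.\<close>

lemma pick_relation_deriv:
  fixes E F G a b d :: "'a::euclidean_space \<Rightarrow> real"
  assumes "((\<lambda>s. b (z + s *\<^sub>R v)) has_real_derivative b') (at 0)"
    and "((\<lambda>s. E (z + s *\<^sub>R v)) has_real_derivative E') (at 0)"
    and "((\<lambda>s. G (z + s *\<^sub>R v)) has_real_derivative G') (at 0)"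
    and "((\<lambda>s. d (z + s *\<^sub>R v)) has_real_derivative d') (at 0)"
    and "((\<lambda>s. a (z + s *\<^sub>R v)) has_real_derivative a') (at 0)"
    and "((\<lambda>s. F (z + s *\<^sub>R v)) has_real_derivative F') (at 0)"
  shows "((\<lambda>s. (\<lambda>p. 3 * b p * E p * G p - (d p * (E p)^2 + 2 * a p * F p * G p)) (z + s *\<^sub>R v)) has_real_derivative
    3 * (b' * E z * G z + b z * E' * G z + b z * E z * G') - (d' * (E z)^2 + 2 * d z * E z * E' +
    2 * (a' * F z * G z + a z * F' * G z + a z * F z * G'))) (at 0)"
  using assms by (auto intro!: derivative_eq_intros simp: algebra_simps power2_eq_square)

text \<open>On the plane of \<open>u\<close> and \<open>w\<close> the cubic form is a linear form
  \<open>\<lambda>\<close> times the quadratic one, and the first quotient is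
  \<open>\<lambda> / 3\<close>, hence additive. For the second claim the divisibility relations are
  differentiated. They hold only on \<open>S \<inter> V\<close>, which suffices because
  \<open>u\<close> and \<open>w\<close> lie in \<open>V\<close>.\<close>

lemma osculating_coefficients:
  fixes f :: "'a::euclidean_space \<Rightarrow> real"
  assumes S: "open S" "Ck_on 6 S f" and V: "subspace V"
    and pos: "\<And>z v. z \<in> S \<inter> V \<Longrightarrow> v \<in> V \<Longrightarrow> v \<noteq> 0 \<Longrightarrow> (dir_deriv v ^^ 2) f z > 0"
    and monge: "\<And>z v. z \<in> S \<inter> V \<Longrightarrow> v \<in> V \<Longrightarrow> v \<noteq> 0 \<Longrightarrow>
      9 * ((dir_deriv v ^^ 2) f z)^2 * (dir_deriv v ^^ 5) f z
      - 45 * (dir_deriv v ^^ 2) f z * (dir_deriv v ^^ 3) f z * (dir_deriv v ^^ 4) f z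
      + 40 * ((dir_deriv v ^^ 3) f z)^3 = 0"
    and z: "z \<in> S \<inter> V" and uw: "u \<in> V" "w \<in> V" and indep: "\<And>x y. x *\<^sub>R u + y *\<^sub>R w = 0 \<Longrightarrow> x = 0 \<and> y = 0"
  defines "L \<equiv> \<lambda>k v. (dir_deriv v ^^ k) f z"
  shows "L 3 (u + w) / (3 * L 2 (u + w)) = L 3 u / (3 * L 2 u) + L 3 w / (3 * L 2 w)"
    and "(L 4 u / L 2 u - 4 / 3 * (L 3 u / L 2 u)^2) / (6 * L 2 u) =
         (L 4 w / L 2 w - 4 / 3 * (L 3 w / L 2 w)^2) / (6 * L 2 w)"
proof -
  define P where "P = partial_deriv u w f"
  define E F G where "E = P 2 0" and "F = P 1 1" and "G = P 0 2"
  define a b c d where "a = P 3 0" and "b = P 2 1" and "c = P 1 2" and "d = P 0 3"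
  note defs = E_def F_def G_def a_def b_def c_def d_def
  have comb: "x *\<^sub>R u + y *\<^sub>R w \<in> V" for x y using uw V by (simp add: subspace_add subspace_scale)
  have pure: "P k 0 y = (dir_deriv u ^^ k) f y" "P 0 k y = (dir_deriv w ^^ k) f y" for k y
    by (simp_all add: P_def partial_deriv_def)
  have exp2: "(dir_deriv (x *\<^sub>R u + y *\<^sub>R w) ^^ 2) f p = x^2 * E p + 2 * x * y * F p + y^2 * G p"
    if "p \<in> S" for x y p
    using funpow_dir_deriv_expand[OF S, of 2 p x u y w] that
    by (simp add: defs P_def numeral_eq_Suc algebra_simps)
  have exp3: "(dir_deriv (x *\<^sub>R u + y *\<^sub>R w) ^^ 3) f p =
      x^3 * a p + 3 * x^2 * y * b p + 3 * x * y^2 * c p + y^3 * d p"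
    if "p \<in> S" for x y p
    using funpow_dir_deriv_expand[OF S, of 3 p x u y w] that
    by (simp add: defs P_def numeral_eq_Suc algebra_simps)
  have nz: "x *\<^sub>R u + y *\<^sub>R w \<noteq> 0" if "x \<noteq> 0 \<or> y \<noteq> 0" for x y using indep that by blast
  have EG: "E p > 0 \<and> G p > 0 \<and> E p * G p > (F p)^2" if "p \<in> S \<inter> V" for p
  proof -
    have q: "x^2 * E p + 2 * x * y * F p + y^2 * G p > 0" if "x \<noteq> 0 \<or> y \<noteq> 0" for x y
      using pos[OF \<open>p \<in> S \<inter> V\<close> comb nz[OF that]] exp2[of p x y] \<open>p \<in> S \<inter> V\<close> by simp
    have "E p > 0" "G p > 0" using q[of 1 0] q[of 0 1] by auto
    \<comment> \<open>The quadratic form takes this value at the coefficient pair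
      \<open>(- F p, E p)\<close>.\<close>
    moreover have "E p * (E p * G p - (F p)^2) > 0"
      using q[of "- F p" "E p"] \<open>E p > 0\<close> by (simp add: algebra_simps power2_eq_square)
    ultimately show ?thesis by (simp add: zero_less_mult_iff)
  qed
  have rel: "3 * b p * E p * G p = d p * (E p)^2 + 2 * a p * F p * G p \<and>
      3 * c p * E p * G p = a p * (G p)^2 + 2 * d p * F p * E p" if p: "p \<in> S \<inter> V" for p
  proof -
    \<comment> \<open>Fourth and fifth derivatives along \<open>u + m *\<^sub>R w\<close> as
      functions of \<open>m\<close>; their being polynomials is what \<open>pick_relations\<close>
      asks of them.\<close>
    define p4 p5 where "p4 = (\<Sum>i\<le>4. monom (real (4 choose i) * P i (4 - i) p) (4 - i))"
      and "p5 = (\<Sum>i\<le>5. monom (real (5 choose i) * P i (5 - i) p) (5 - i))"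
    have e4: "(dir_deriv (1 *\<^sub>R u + m *\<^sub>R w) ^^ 4) f p = poly p4 m" for m
      using funpow_dir_deriv_expand[OF S, of 4 p 1 u m w] p
      by (simp add: p4_def P_def poly_sum poly_monom algebra_simps)
    have e5: "(dir_deriv (1 *\<^sub>R u + m *\<^sub>R w) ^^ 5) f p = poly p5 m" for m
      using funpow_dir_deriv_expand[OF S, of 5 p 1 u m w] p
      by (simp add: p5_def P_def poly_sum poly_monom algebra_simps)
    have "9 * (E p + 2 * F p * m + G p * m^2)^2 * poly p5 m
      - 45 * (E p + 2 * F p * m + G p * m^2) * (a p + 3 * b p * m + 3 * c p * m^2 + d p * m^3) * poly p4 m
      + 40 * (a p + 3 * b p * m + 3 * c p * m^2 + d p * m^3)^3 = 0" for m
    proof -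
      have "(dir_deriv (1 *\<^sub>R u + m *\<^sub>R w) ^^ 2) f p = E p + 2 * F p * m + G p * m^2"
        "(dir_deriv (1 *\<^sub>R u + m *\<^sub>R w) ^^ 3) f p = a p + 3 * b p * m + 3 * c p * m^2 + d p * m^3"
        using exp2[of p 1 m] exp3[of p 1 m] p by (simp_all add: algebra_simps)
      then show ?thesis using monge[OF p comb nz, of 1 m] e4[of m] e5[of m] by simp
    qed
    from pick_relations[OF _ _ this] EG[OF p] show ?thesis by blast
  qed
  have zS: "z \<in> S" "z \<in> V" using z by auto
  have near: "\<forall>\<^sub>F s in nhds 0. z + s *\<^sub>R v \<in> S \<inter> V" if "v \<in> V" for v
  proof -
    have "open ((\<lambda>s. z + s *\<^sub>R v) -` S)" by (intro open_vimage S(1) continuous_intros)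
    then have "\<forall>\<^sub>F s in nhds 0. z + s *\<^sub>R v \<in> S"
      using zS(1) eventually_nhds_in_open[of "(\<lambda>s. z + s *\<^sub>R v) -` S" "0::real"] by simp
    then show ?thesis
      by eventually_elim (use zS(2) that V in \<open>simp add: subspace_add subspace_scale\<close>)
  qed
  have zero: "D = 0" if "v \<in> V" "((\<lambda>s. R (z + s *\<^sub>R v)) has_real_derivative D) (at 0)"
    "\<And>p. p \<in> S \<inter> V \<Longrightarrow> R p = 0" for R D v
  proof -
    have "\<forall>\<^sub>F s in nhds 0. R (z + s *\<^sub>R v) = 0" using near[OF that(1)] by eventually_elim (rule that(3))
    then have "((\<lambda>s. 0) has_real_derivative D) (at 0)" using that(2) by (subst (asm) DERIV_cong_ev) auto
    then show ?thesis using DERIV_unique DERIV_const by blast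
  qed
  have du: "((\<lambda>s. P i j (z + s *\<^sub>R u)) has_real_derivative P (Suc i) j z) (at 0)" if "i + j \<le> 3" for i j
    using partial_deriv_line[OF S, of i j z 0 1 u 0 w] that zS by (simp add: P_def)
  have dw: "((\<lambda>s. P i j (z + s *\<^sub>R w)) has_real_derivative P i (Suc j) z) (at 0)" if "i + j \<le> 3" for i j
    using partial_deriv_line[OF S, of i j z 0 0 u 1 w] that zS by (simp add: P_def)
  have dus: "((\<lambda>s. E (z + s *\<^sub>R u)) has_real_derivative a z) (at 0)"
    "((\<lambda>s. F (z + s *\<^sub>R u)) has_real_derivative b z) (at 0)"
    "((\<lambda>s. G (z + s *\<^sub>R u)) has_real_derivative c z) (at 0)"
    "((\<lambda>s. a (z + s *\<^sub>R u)) has_real_derivative P 4 0 z) (at 0)"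
    "((\<lambda>s. b (z + s *\<^sub>R u)) has_real_derivative P 3 1 z) (at 0)"
    "((\<lambda>s. c (z + s *\<^sub>R u)) has_real_derivative P 2 2 z) (at 0)"
    "((\<lambda>s. d (z + s *\<^sub>R u)) has_real_derivative P 1 3 z) (at 0)"
    using du[of 2 0] du[of 1 1] du[of 0 2] du[of 3 0] du[of 2 1] du[of 1 2] du[of 0 3]
    by (simp_all add: defs numeral_eq_Suc)
  have dws: "((\<lambda>s. E (z + s *\<^sub>R w)) has_real_derivative b z) (at 0)"
    "((\<lambda>s. F (z + s *\<^sub>R w)) has_real_derivative c z) (at 0)"
    "((\<lambda>s. G (z + s *\<^sub>R w)) has_real_derivative d z) (at 0)"
    "((\<lambda>s. a (z + s *\<^sub>R w)) has_real_derivative P 3 1 z) (at 0)"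
    "((\<lambda>s. b (z + s *\<^sub>R w)) has_real_derivative P 2 2 z) (at 0)"
    "((\<lambda>s. c (z + s *\<^sub>R w)) has_real_derivative P 1 3 z) (at 0)"
    "((\<lambda>s. d (z + s *\<^sub>R w)) has_real_derivative P 0 4 z) (at 0)"
    using dw[of 2 0] dw[of 1 1] dw[of 0 2] dw[of 3 0] dw[of 2 1] dw[of 1 2] dw[of 0 3]
    by (simp_all add: defs numeral_eq_Suc)
  have D1: "3 * (P 3 1 z * E z * G z + b z * a z * G z + b z * E z * c z) -
      (P 1 3 z * (E z)^2 + 2 * d z * E z * a z + 2 * (P 4 0 z * F z * G z + a z * b z * G z + a z * F z * c z)) = 0"
    using zero[OF uw(1) pick_relation_deriv[OF dus(5) dus(1) dus(3) dus(7) dus(4) dus(2)]] rel by (simp add: algebra_simps)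
  have D2: "3 * (P 2 2 z * E z * G z + b z * b z * G z + b z * E z * d z) -
      (P 0 4 z * (E z)^2 + 2 * d z * E z * b z + 2 * (P 3 1 z * F z * G z + a z * c z * G z + a z * F z * d z)) = 0"
    using zero[OF uw(2) pick_relation_deriv[OF dws(5) dws(1) dws(3) dws(7) dws(4) dws(2)]] rel by (simp add: algebra_simps)
  have D3: "3 * (P 2 2 z * E z * G z + c z * a z * G z + c z * E z * c z) -
      (P 4 0 z * (G z)^2 + 2 * a z * G z * c z + 2 * (P 1 3 z * F z * E z + d z * b z * E z + d z * F z * a z)) = 0"
    using zero[OF uw(1) pick_relation_deriv[OF dus(6) dus(3) dus(1) dus(4) dus(7) dus(2)]] rel by (simp add: algebra_simps)
  have D4: "3 * (P 1 3 z * E z * G z + c z * b z * G z + c z * E z * d z) -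
      (P 3 1 z * (G z)^2 + 2 * a z * G z * d z + 2 * (P 0 4 z * F z * E z + d z * c z * E z + d z * F z * b z)) = 0"
    using zero[OF uw(2) pick_relation_deriv[OF dws(6) dws(3) dws(1) dws(4) dws(7) dws(2)]] rel by (simp add: algebra_simps)
  have Lu: "L 2 u = E z" "L 3 u = a z" "L 4 u = P 4 0 z" and Lw: "L 2 w = G z" "L 3 w = d z" "L 4 w = P 0 4 z"
    by (simp_all add: L_def defs pure)
  show "(L 4 u / L 2 u - 4 / 3 * (L 3 u / L 2 u)^2) / (6 * L 2 u) =
         (L 4 w / L 2 w - 4 / 3 * (L 3 w / L 2 w)^2) / (6 * L 2 w)"
    unfolding Lu Lw
    by (rule pick_curvature_const[of "E z" "G z" "F z" "b z" "d z" "a z" "c z" "P 3 1 z" "P 1 3 z" "P 4 0 z" "P 2 2 z" "P 0 4 z"])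
      (use EG[OF z] rel[OF z] D1 D2 D3 D4 in auto)
  define \<mu> \<nu> where "\<mu> = a z / E z" and "\<nu> = d z / G z"
  have ad: "a z = \<mu> * E z" "d z = \<nu> * G z" using EG[OF z] by (auto simp: \<mu>_def \<nu>_def)
  have bc: "b z = (\<nu> * E z + 2 * \<mu> * F z) / 3" "c z = (\<mu> * G z + 2 * \<nu> * F z) / 3"
    using pick_linear_factor[OF _ _ ad] EG[OF z] rel[OF z] by blast+
  have Luw: "L 2 (u + w) = E z + 2 * F z + G z" "L 3 (u + w) = a z + 3 * b z + 3 * c z + d z"
    using exp2[OF zS(1), of 1 1] exp3[OF zS(1), of 1 1] by (simp_all add: L_def)
  have "L 2 (u + w) > 0" using pos[OF z comb nz, of 1 1] by (simp add: L_def)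
  moreover have "L 3 (u + w) = (\<mu> + \<nu>) * L 2 (u + w)"
    unfolding Luw unfolding bc ad by (simp add: field_simps)
  ultimately show "L 3 (u + w) / (3 * L 2 (u + w)) = L 3 u / (3 * L 2 u) + L 3 w / (3 * L 2 w)"
    using EG[OF z] unfolding Lu Lw by (simp add: ad field_simps)
qed

section \<open>Graphs of strictly convex functions\<close>

locale convex_graph =
  fixes e :: "'a::euclidean_space" and U :: "'a set" and f :: "'a \<Rightarrow> real"
  assumes dim: "2 \<le> DIM('a)" and norm_e: "norm e = 1" and open_U: "open U" and smooth: "Ck_on 6 U f"
    and convex: "strictly_convex_on (U \<inter> {y. e \<bullet> y = 0}) f"
begin

definition H :: "'a set" where "H = {y. e \<bullet> y = 0}"
definition D :: "'a set" where "D = U \<inter> H"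
definition lift :: "'a \<Rightarrow> 'a" where "lift y = y + f y *\<^sub>R e"
definition graph :: "'a set" where "graph = lift ` D"
definition proj :: "'a \<Rightarrow> 'a" where "proj x = x - (e \<bullet> x) *\<^sub>R e"
text \<open>The outward normal scaled to have \<open>e\<close>-component \<open>-1\<close>. The
  basis vectors are projected because \<open>graph\<close> sees \<open>f\<close> only on
  \<open>H\<close>. In this scaling the normal is affine in the gradient, unlike the unit
  normal.\<close>

definition conormal :: "'a \<Rightarrow> 'a" where
  "conormal y = (\<Sum>b\<in>Basis. dir_deriv (proj b) f y *\<^sub>R b) - e"

lemma inner_e: "e \<bullet> e = 1" using norm_e by (simp add: norm_eq_1)

lemma subspace_H: "subspace H" unfolding H_def by (rule subspace_hyperplane)

lemma H_inner: "w \<in> H \<Longrightarrow> e \<bullet> w = 0" "w \<in> H \<Longrightarrow> w \<bullet> e = 0"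
  by (auto simp: H_def inner_commute)

lemma H_line: "z \<in> H \<Longrightarrow> w \<in> H \<Longrightarrow> z + t *\<^sub>R w \<in> H"
  using subspace_H by (simp add: subspace_add subspace_scale)

lemma H_nontrivial: "\<exists>w\<in>H. w \<noteq> 0"
  using orthogonal_to_vector_exists[OF dim, of e] by (auto simp: H_def orthogonal_def)

lemma proj_in_H: "proj x \<in> H" by (simp add: proj_def H_def inner_diff_right inner_e)

lemma proj_H: "w \<in> H \<Longrightarrow> proj w = w" by (simp add: proj_def H_def)

lemma proj_decomp: "x = proj x + (e \<bullet> x) *\<^sub>R e" by (simp add: proj_def)

lemma proj_linear: "linear proj"
  unfolding proj_def by (rule linearI) (simp_all add: inner_right_distrib algebra_simps)

lemma proj_e: "proj e = 0" by (simp add: proj_def inner_e)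

lemma eq_if_inner_eq:
  assumes "a \<bullet> e = b \<bullet> e" "\<And>w. w \<in> H \<Longrightarrow> a \<bullet> w = b \<bullet> w"
  shows "a = b"
proof -
  have "a \<bullet> x = b \<bullet> x" for x
    using assms(1) assms(2)[OF proj_in_H[of x]]
    by (subst (1 2) proj_decomp[of x]) (simp add: inner_add_right)
  then show ?thesis by (metis vector_eq_rdot)
qed

lemma D_U: "y \<in> D \<Longrightarrow> y \<in> U" and D_H: "y \<in> D \<Longrightarrow> y \<in> H" by (auto simp: D_def)

lemma differentiable: "y \<in> U \<Longrightarrow> f differentiable (at y)"
  using Ck_on_differentiable[OF open_U, of 5] smooth by simp

lemma dir_deriv_differentiable: "y \<in> U \<Longrightarrow> dir_deriv w f differentiable (at y)"
  using Ck_on_differentiable[OF open_U, of 4] Ck_on_Suc_dir_deriv[of 5 U f w] smooth by simp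

lemma conormal_inner:
  assumes "y \<in> U"
  shows "conormal y \<bullet> x = dir_deriv (proj x) f y - e \<bullet> x"
proof -
  define L where "L = (\<lambda>x. dir_deriv (proj x) f y)"
  have L: "linear L"
    using linear_compose[OF proj_linear dir_deriv_linear[OF differentiable[OF assms]]]
    by (simp add: L_def o_def)
  have "L x = L (\<Sum>b\<in>Basis. (x \<bullet> b) *\<^sub>R b)" by (simp add: euclidean_representation)
  also have "\<dots> = (\<Sum>b\<in>Basis. (x \<bullet> b) * L b)"
    using L by (simp add: linear_sum linear_scale)
  finally show ?thesis
    by (simp add: conormal_def inner_diff_left inner_sum_left L_def inner_commute[of x] mult.commute)
qed

lemma conormal_inner_H: "y \<in> U \<Longrightarrow> w \<in> H \<Longrightarrow> conormal y \<bullet> w = dir_deriv w f y"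
  by (simp add: conormal_inner proj_H H_inner)

lemma conormal_inner_e: "y \<in> U \<Longrightarrow> conormal y \<bullet> e = -1"
  using linear_0[OF dir_deriv_linear[OF differentiable]] by (simp add: conormal_inner proj_e inner_e)

lemma conormal_nonzero: "y \<in> U \<Longrightarrow> conormal y \<noteq> 0"
  using conormal_inner_e by force

lemma line_deriv:
  "z + t *\<^sub>R w \<in> U \<Longrightarrow>
    ((\<lambda>s. f (z + s *\<^sub>R w)) has_real_derivative dir_deriv w f (z + t *\<^sub>R w)) (at t)"
  by (rule dir_deriv_line[OF differentiable])

lemma strictly_convex:
  assumes "x \<in> D" "y \<in> D" "x \<noteq> y" "0 < t" "t < 1"
  shows "f (x + t *\<^sub>R (y - x)) < (1 - t) * f x + t * f y"
proof -
  have "x + t *\<^sub>R (y - x) = (1 - t) *\<^sub>R x + t *\<^sub>R y" by (simp add: algebra_simps)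
  then show ?thesis using convex assms by (simp add: strictly_convex_on_def D_def H_def)
qed

lemma convex_D: "convex D"
  using convex by (simp add: strictly_convex_on_def D_def H_def)

lemma D_segment:
  assumes "x \<in> D" "y \<in> D" "0 \<le> t" "t \<le> 1"
  shows "x + t *\<^sub>R (y - x) \<in> D"
proof -
  have "x + t *\<^sub>R (y - x) = (1 - t) *\<^sub>R x + t *\<^sub>R y" by (simp add: algebra_simps)
  then show ?thesis using convexD_alt[OF convex_D assms(1,2), of t] assms(3,4) by simp
qed

lemma gradient_inequality_weak:
  assumes "y \<in> D" "y' \<in> D"
  shows "f y + dir_deriv (y' - y) f y \<le> f y'"
proof (cases "y = y'")
  case True
  then show ?thesis using linear_0[OF dir_deriv_linear[OF differentiable]] D_U[OF assms(1)] by simp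
next
  case False
  define g where "g = (\<lambda>t. f (y + t *\<^sub>R (y' - y)))"
  have "(g has_real_derivative dir_deriv (y' - y) f y) (at 0)"
    unfolding g_def using line_deriv[of y 0 "y' - y"] D_U[OF assms(1)] by simp
  then have "((\<lambda>t. (g t - g 0) / (t - 0)) \<longlongrightarrow> dir_deriv (y' - y) f y) (at 0)"
    by (simp add: has_field_derivative_iff)
  then have lim: "((\<lambda>t. (g t - g 0) / t) \<longlongrightarrow> dir_deriv (y' - y) f y) (at_right 0)"
    by (auto intro: tendsto_mono[OF at_le])
  have "\<forall>\<^sub>F t in at_right 0. t < (1::real)"
    by (rule eventually_at_rightI[of 0 1]) auto
  then have "\<forall>\<^sub>F t in at_right 0. (g t - g 0) / t \<le> f y' - f y"
    using eventually_at_right_less[of 0]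
  proof eventually_elim
    case (elim t)
    then have "g t - g 0 \<le> t * (f y' - f y)"
      using strictly_convex[OF assms False, of t] by (simp add: g_def algebra_simps)
    then show ?case using elim by (simp add: divide_le_eq mult.commute)
  qed
  from tendsto_upperbound[OF lim this] show ?thesis by simp
qed

text \<open>Strictness comes from the midpoint, where the weak inequality bounds \<open>f\<close>
  from below and strict convexity bounds it from above.\<close>

lemma gradient_inequality:
  assumes "y \<in> D" "y' \<in> D" "y \<noteq> y'"
  shows "f y + dir_deriv (y' - y) f y < f y'"
proof -
  let ?m = "y + (1/2) *\<^sub>R (y' - y)"
  have "?m \<in> D" using D_segment[OF assms(1,2), of "1/2"] by simp
  from gradient_inequality_weak[OF assms(1) this]
  have "f y + dir_deriv (y' - y) f y / 2 \<le> f ?m"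
    using linear_scale[OF dir_deriv_linear[OF differentiable[OF D_U[OF assms(1)]]], of "1/2"] by simp
  also have "f ?m < (f y + f y') / 2"
    using strictly_convex[OF assms, of "1/2"] by simp
  finally show ?thesis by simp
qed

text \<open>\<open>D\<close> is only relatively open, so derivatives along a horizontal
  \<open>w\<close> are taken over this open set of parameters.\<close>

lemma line_neighbourhood:
  assumes "y \<in> D" "w \<in> H"
  shows "open {t. y + t *\<^sub>R w \<in> U}" "0 \<in> {t. y + t *\<^sub>R w \<in> U}"
    "\<And>t. t \<in> {t. y + t *\<^sub>R w \<in> U} \<Longrightarrow> y + t *\<^sub>R w \<in> D"
proof -
  have "open ((\<lambda>t. y + t *\<^sub>R w) -` U)" by (intro open_vimage open_U continuous_intros)
  then show "open {t. y + t *\<^sub>R w \<in> U}" by (simp add: vimage_def)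
  show "0 \<in> {t. y + t *\<^sub>R w \<in> U}" using D_U[OF assms(1)] by simp
  show "y + t *\<^sub>R w \<in> D" if "t \<in> {t. y + t *\<^sub>R w \<in> U}" for t
    using that H_line[OF D_H[OF assms(1)] assms(2)] by (simp add: D_def)
qed

lemma D_other_point: "y \<in> D \<Longrightarrow> \<exists>y'\<in>D. y' \<noteq> y"
proof -
  assume y: "y \<in> D"
  obtain w where w: "w \<in> H" "w \<noteq> 0" using H_nontrivial by auto
  obtain \<epsilon> where "\<epsilon> > 0" "ball 0 \<epsilon> \<subseteq> {t. y + t *\<^sub>R w \<in> U}"
    using line_neighbourhood(1,2)[OF y w(1)] openE by blast
  then have "\<epsilon>/2 \<in> {t. y + t *\<^sub>R w \<in> U}" by (auto simp: dist_real_def subset_iff)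
  from line_neighbourhood(3)[OF y w(1) this] have "y + (\<epsilon>/2) *\<^sub>R w \<in> D" .
  moreover have "y + (\<epsilon>/2) *\<^sub>R w \<noteq> y" using \<open>\<epsilon> > 0\<close> w by simp
  ultimately show ?thesis by blast
qed

lemma proj_lift: "y \<in> H \<Longrightarrow> proj (lift y) = y"
  by (simp add: proj_def lift_def inner_add_right inner_e H_inner)

lemma e_lift: "y \<in> H \<Longrightarrow> e \<bullet> lift y = f y"
  by (simp add: lift_def inner_add_right inner_e H_inner)

lemma lift_inj: "y \<in> H \<Longrightarrow> y' \<in> H \<Longrightarrow> lift y = lift y' \<Longrightarrow> y = y'"
  using proj_lift by metis

section \<open>Tangent spaces, exterior normals and the second fundamental form of the graph\<close>

lemma lift_line_deriv:
  assumes "y \<in> U"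
  shows "((\<lambda>t. lift (y + t *\<^sub>R w)) has_vector_derivative w + dir_deriv w f y *\<^sub>R e) (at 0)"
  unfolding lift_def using line_deriv[of y 0 w] assms
  by (auto intro!: derivative_eq_intros simp: has_real_derivative_iff_has_vector_derivative[symmetric])

lemma tangent_space_lift:
  assumes y: "y \<in> D"
  shows "tangent_space graph (lift y) = {w + dir_deriv w f y *\<^sub>R e | w. w \<in> H}"
proof (intro equalityI subsetI)
  fix v assume "v \<in> {w + dir_deriv w f y *\<^sub>R e | w. w \<in> H}"
  then obtain w where w: "w \<in> H" "v = w + dir_deriv w f y *\<^sub>R e" by blast
  \<comment> \<open>The curve must be total and stay in \<open>graph\<close>, so it is frozen at the
    base point wherever the line leaves \<open>U\<close>; the derivative at \<open>0\<close> is
    unaffected.\<close>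
  define \<gamma> where "\<gamma> = (\<lambda>t. if y + t *\<^sub>R w \<in> U then lift (y + t *\<^sub>R w) else lift y)"
  have "(\<gamma> has_vector_derivative v) (at 0)"
    using has_vector_derivative_transform_within_open[OF lift_line_deriv[OF D_U[OF y], of w]
        line_neighbourhood(1,2)[OF y w(1)], of \<gamma>] w(2)
    by (simp add: \<gamma>_def)
  moreover have "range \<gamma> \<subseteq> graph" "\<gamma> 0 = lift y"
    using line_neighbourhood(3)[OF y w(1)] y by (auto simp: \<gamma>_def graph_def)
  ultimately show "v \<in> tangent_space graph (lift y)" unfolding tangent_space_def by blast
next
  fix v assume "v \<in> tangent_space graph (lift y)"
  then obtain \<gamma> where \<gamma>: "range \<gamma> \<subseteq> graph" "\<gamma> 0 = lift y" "(\<gamma> has_vector_derivative v) (at (0::real))"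
    unfolding tangent_space_def by blast
  have eq: "e \<bullet> \<gamma> t = f (proj (\<gamma> t))" for t
  proof -
    obtain y' where "y' \<in> D" "\<gamma> t = lift y'" using \<gamma>(1) by (auto simp: graph_def)
    then show ?thesis by (simp add: proj_lift e_lift D_H)
  qed
  have \<gamma>': "(\<gamma> has_derivative (\<lambda>t. t *\<^sub>R v)) (at 0)"
    using \<gamma>(3) by (simp add: has_vector_derivative_def)
  have "((\<lambda>t. proj (\<gamma> t)) has_derivative (\<lambda>t. proj (t *\<^sub>R v))) (at 0)"
    using bounded_linear.has_derivative[OF linear_conv_bounded_linear[THEN iffD1, OF proj_linear] \<gamma>'] .
  moreover have "(f has_derivative (\<lambda>w. dir_deriv w f y)) (at (proj (\<gamma> 0)))"
    using dir_deriv_has_derivative[OF differentiable[OF D_U[OF y]]] proj_lift[OF D_H[OF y]] \<gamma>(2) by simp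
  ultimately have "((\<lambda>t. f (proj (\<gamma> t))) has_derivative (\<lambda>t. dir_deriv (proj (t *\<^sub>R v)) f y)) (at 0)"
    using has_derivative_compose by blast
  moreover have "((\<lambda>t. e \<bullet> \<gamma> t) has_derivative (\<lambda>t. e \<bullet> (t *\<^sub>R v))) (at 0)"
    using \<gamma>' by (auto intro!: derivative_eq_intros)
  ultimately have "(\<lambda>t. dir_deriv (proj (t *\<^sub>R v)) f y) = (\<lambda>t. e \<bullet> (t *\<^sub>R v))"
    unfolding eq by (rule has_derivative_unique)
  from fun_cong[OF this, of 1] have "dir_deriv (proj v) f y = e \<bullet> v" by simp
  then have "v = proj v + dir_deriv (proj v) f y *\<^sub>R e" using proj_decomp[of v] by simp
  then show "v \<in> {w + dir_deriv w f y *\<^sub>R e | w. w \<in> H}" using proj_in_H by blast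
qed

lemma conormal_chord:
  assumes "y \<in> D" "y' \<in> D"
  shows "conormal y \<bullet> (lift y' - lift y) = dir_deriv (y' - y) f y - (f y' - f y)"
proof -
  have "lift y' - lift y = (y' - y) + (f y' - f y) *\<^sub>R e" by (simp add: lift_def algebra_simps)
  moreover have "y' - y \<in> H" using assms D_H subspace_H by (simp add: subspace_diff)
  ultimately show ?thesis
    using conormal_inner_H[of y "y' - y"] conormal_inner_e[of y] D_U[OF assms(1)]
    by (simp add: inner_add_right)
qed

lemma exterior_normal_lift:
  assumes y: "y \<in> D"
  shows "exterior_normal graph (lift y) = conormal y /\<^sub>R norm (conormal y)"
  unfolding exterior_normal_def
proof (rule the_equality)
  let ?n = "conormal y"
  have n: "norm ?n > 0" using conormal_nonzero[OF D_U[OF y]] by simp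
  have "?n \<bullet> v = 0" if "v \<in> tangent_space graph (lift y)" for v
    using that conormal_inner_H[OF D_U[OF y]] conormal_inner_e[OF D_U[OF y]]
    unfolding tangent_space_lift[OF y] by (auto simp: inner_add_right)
  moreover have "?n \<bullet> (B - lift y) \<le> 0" if "B \<in> graph" for B
    using that conormal_chord[OF y] gradient_inequality_weak[OF y] by (force simp: graph_def)
  ultimately show "norm (?n /\<^sub>R norm ?n) = 1 \<and> (\<forall>v\<in>tangent_space graph (lift y). (?n /\<^sub>R norm ?n) \<bullet> v = 0) \<and>
      (\<forall>B\<in>graph. (?n /\<^sub>R norm ?n) \<bullet> (B - lift y) \<le> 0)"
    using n by (auto simp: mult_le_0_iff divide_le_0_iff)
next
  let ?n = "conormal y"
  fix u
  assume u: "norm u = 1 \<and> (\<forall>v\<in>tangent_space graph (lift y). u \<bullet> v = 0) \<and> (\<forall>B\<in>graph. u \<bullet> (B - lift y) \<le> 0)"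
  define c where "c = - (u \<bullet> e)"
  have uc: "u = c *\<^sub>R ?n"
  proof (rule eq_if_inner_eq)
    show "u \<bullet> e = (c *\<^sub>R ?n) \<bullet> e" using conormal_inner_e[OF D_U[OF y]] by (simp add: c_def)
    fix w assume w: "w \<in> H"
    then have "u \<bullet> (w + dir_deriv w f y *\<^sub>R e) = 0" using u unfolding tangent_space_lift[OF y] by blast
    then show "u \<bullet> w = (c *\<^sub>R ?n) \<bullet> w"
      using conormal_inner_H[OF D_U[OF y] w]
      by (simp add: c_def inner_add_right mult.commute eq_neg_iff_add_eq_0)
  qed
  \<comment> \<open>So far \<open>u\<close> is a multiple of \<open>conormal y\<close> of either
    sign. A second point lies strictly to one side of the tangent hyperplane, which decides the sign
    of \<open>c\<close>.\<close>
  obtain y' where y': "y' \<in> D" "y' \<noteq> y" using D_other_point[OF y] by blast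
  have "c * (?n \<bullet> (lift y' - lift y)) \<le> 0" using u uc y' by (auto simp: graph_def)
  moreover have "?n \<bullet> (lift y' - lift y) < 0"
    using conormal_chord[OF y y'(1)] gradient_inequality[OF y y'(1)] y'(2) by simp
  ultimately have "c \<ge> 0" by (simp add: mult_le_0_iff)
  moreover have "\<bar>c\<bar> * norm ?n = 1" using u uc by auto
  ultimately have "norm ?n * c = 1" by (simp add: mult.commute)
  then have "inverse (norm ?n) = c" by (rule inverse_unique)
  then show "u = ?n /\<^sub>R norm ?n" using uc by (simp only:)
qed

text \<open>Strict monotonicity of the gradient: add the strict gradient inequalities at the two
  points.\<close>

lemma conormal_inj:
  assumes "y \<in> D" "y' \<in> D" "conormal y = conormal y'"
  shows "y = y'"
proof (rule ccontr)
  assume ne: "y \<noteq> y'"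
  have h: "y' - y \<in> H" using assms D_H subspace_H by (simp add: subspace_diff)
  have "dir_deriv (y' - y) f y = dir_deriv (y' - y) f y'"
    using conormal_inner_H[OF D_U h] assms by metis
  moreover have "dir_deriv (y - y') f y' = - dir_deriv (y' - y) f y'"
    using linear_neg[OF dir_deriv_linear[OF differentiable[OF D_U[OF assms(2)]]], of "y' - y"] by simp
  ultimately show False
    using gradient_inequality[OF assms(1,2) ne] gradient_inequality[OF assms(2,1) ne[symmetric]] by linarith
qed

lemma exterior_normal_inj:
  assumes "A \<in> graph" "B \<in> graph" "exterior_normal graph A = exterior_normal graph B"
  shows "A = B"
proof -
  obtain y y' where y: "y \<in> D" "A = lift y" "y' \<in> D" "B = lift y'" using assms by (auto simp: graph_def)
  have eq: "conormal y /\<^sub>R norm (conormal y) = conormal y' /\<^sub>R norm (conormal y')"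
    using assms(3) y exterior_normal_lift by simp
  \<comment> \<open>The \<open>e\<close>-component of a unit normal is minus the inverse length of
    the conormal, so equal normals belong to conormals of equal length.\<close>
  from arg_cong[OF this, of "\<lambda>u. u \<bullet> e"] have "norm (conormal y) = norm (conormal y')"
    using conormal_inner_e D_U y by simp
  with eq have "conormal y = conormal y'" using conormal_nonzero[OF D_U[OF y(1)]] by auto
  then show ?thesis using conormal_inj y by blast
qed

lemma conormal_differentiable: "y \<in> U \<Longrightarrow> conormal differentiable (at y)"
  unfolding conormal_def
  by (intro differentiable_diff differentiable_sum differentiable_scaleR dir_deriv_differentiable
      differentiable_const ballI) auto

text \<open>Along the curve over \<open>y + t *\<^sub>R w\<close>, the exterior normal paired with
  the fixed tangent vector \<open>v\<close> and multiplied by the length of the conormal is the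
  increment of \<open>dir_deriv w f\<close>. The pairing vanishes at \<open>y\<close>, so the length
  need only be continuous, and the Hessian is the second fundamental form times that length.\<close>

lemma hessian_positive:
  assumes y: "y \<in> D" and w: "w \<in> H" "w \<noteq> 0" and pd: "positive_definite_at graph (lift y)"
  shows "dir_deriv w (dir_deriv w f) y > 0"
proof -
  \<comment> \<open>Extends the exterior normal to a neighbourhood of \<open>lift y\<close> in the
    ambient space. This yields differentiability within \<open>graph\<close>, without which the
    \<open>frechet_derivative\<close> in the second fundamental form carries no information.\<close>
  define N where "N = (\<lambda>x. conormal (proj x) /\<^sub>R norm (conormal (proj x)))"
  have A: "lift y \<in> graph" using y by (simp add: graph_def)
  have N_eq: "exterior_normal graph x = N x" if x: "x \<in> graph" for x
    
  proof -
    obtain y' where "y' \<in> D" "x = lift y'" using x unfolding graph_def by blast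
    then show ?thesis by (simp add: N_def exterior_normal_lift proj_lift D_H)
  qed
  have pl: "proj (lift y) = y" by (simp add: proj_lift D_H y)
  have "(\<lambda>x. conormal (proj x)) differentiable (at (lift y))"
    using differentiable_chain_at[of proj "lift y" conormal] conormal_differentiable[OF D_U[OF y]]
      linear_imp_differentiable[OF proj_linear] pl by (simp add: o_def)
  moreover have "norm differentiable (at (conormal (proj (lift y))))"
    using conormal_nonzero[OF D_U[OF y]] by (simp add: pl differentiable_norm_at)
  ultimately have "(\<lambda>x. norm (conormal (proj x))) differentiable (at (lift y))"
    using differentiable_chain_at[of "\<lambda>x. conormal (proj x)" "lift y" norm] by (simp add: o_def)
  then have "N differentiable (at (lift y))"
    unfolding N_def using conormal_nonzero[OF D_U[OF y]] \<open>(\<lambda>x. conormal (proj x)) differentiable (at (lift y))\<close>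
    by (intro differentiable_scaleR differentiable_inverse) (auto simp: pl)
  then obtain N' where "(N has_derivative N') (at (lift y) within graph)"
    unfolding differentiable_def using has_derivative_at_withinI by blast
  then have "(exterior_normal graph has_derivative N') (at (lift y) within graph)"
    using has_derivative_transform[OF A, of "exterior_normal graph" N N'] N_eq by blast
  then have "exterior_normal graph differentiable (at (lift y) within graph)"
    unfolding differentiable_def by blast
  define L where "L = frechet_derivative (exterior_normal graph) (at (lift y) within graph)"
  have L: "(exterior_normal graph has_derivative L) (at (lift y) within graph)"
    using \<open>exterior_normal graph differentiable _\<close> unfolding L_def by (simp add: frechet_derivative_works[symmetric])
  define v where "v = w + dir_deriv w f y *\<^sub>R e"
  have "v \<in> tangent_space graph (lift y)" using w unfolding tangent_space_lift[OF y] v_def by blast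
  moreover have "v \<noteq> 0"
  proof
    assume "v = 0"
    then have "v \<bullet> e = 0" by simp
    then have "dir_deriv w f y = 0" using H_inner[OF w(1)] by (simp add: v_def inner_add_left inner_e)
    then show False using \<open>v = 0\<close> w(2) by (simp add: v_def)
  qed
  ultimately have Lv: "L v \<bullet> v > 0"
    using pd by (simp add: positive_definite_at_def second_fundamental_form_def L_def)
  define T where "T = {t. y + t *\<^sub>R w \<in> U}"
  note T = line_neighbourhood[OF y w(1), folded T_def]
  have "((\<lambda>t. lift (y + t *\<^sub>R w)) has_derivative (\<lambda>t. t *\<^sub>R v)) (at 0 within T)"
    using lift_line_deriv[OF D_U[OF y], of w] has_derivative_at_withinI
    by (fastforce simp: has_vector_derivative_def v_def)
  moreover have "(exterior_normal graph has_derivative L) (at (lift (y + 0 *\<^sub>R w)) within (\<lambda>t. lift (y + t *\<^sub>R w)) ` T)"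
    using has_derivative_subset[OF L, of "(\<lambda>t. lift (y + t *\<^sub>R w)) ` T"] T(3) by (auto simp: graph_def)
  ultimately have "((\<lambda>t. exterior_normal graph (lift (y + t *\<^sub>R w))) has_derivative (\<lambda>t. L (t *\<^sub>R v))) (at 0 within T)"
    using has_derivative_in_compose by blast
  then have "((\<lambda>t. exterior_normal graph (lift (y + t *\<^sub>R w))) has_derivative (\<lambda>t. L (t *\<^sub>R v))) (at 0)"
    using at_within_open[OF T(2,1)] by simp
  then have "((\<lambda>t. exterior_normal graph (lift (y + t *\<^sub>R w)) \<bullet> v) has_derivative (\<lambda>t. L (t *\<^sub>R v) \<bullet> v)) (at 0)"
    by (auto intro!: derivative_eq_intros)
  moreover have "L (t *\<^sub>R v) \<bullet> v = (L v \<bullet> v) * t" for t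
    using linear_scale[OF has_derivative_linear[OF L]] by simp
  ultimately have "((\<lambda>t. exterior_normal graph (lift (y + t *\<^sub>R w)) \<bullet> v) has_real_derivative L v \<bullet> v) (at 0)"
    by (simp add: has_field_derivative_def)
  then have lim1: "((\<lambda>t. (exterior_normal graph (lift (y + t *\<^sub>R w)) \<bullet> v - exterior_normal graph (lift y) \<bullet> v) / t) \<longlongrightarrow> L v \<bullet> v) (at 0)"
    by (simp add: has_field_derivative_iff)
  have "isCont (\<lambda>t. norm (conormal (y + t *\<^sub>R w))) 0"
  proof -
    have "isCont conormal (y + 0 *\<^sub>R w)"
      using conormal_differentiable[OF D_U[OF y]] differentiable_imp_continuous_within by simp
    then have "isCont (\<lambda>t. conormal (y + t *\<^sub>R w)) 0"
      using isCont_o2[of 0 "\<lambda>t. y + t *\<^sub>R w" conormal] by simp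
    then show ?thesis by (rule continuous_norm)
  qed
  then have lim2: "((\<lambda>t. norm (conormal (y + t *\<^sub>R w))) \<longlongrightarrow> norm (conormal y)) (at 0)"
    by (simp add: isCont_def)
  have key: "conormal p \<bullet> v = dir_deriv w f p - dir_deriv w f y" if "p \<in> D" for p
    using conormal_inner_H[OF D_U[OF that] w(1)] conormal_inner_e[OF D_U[OF that]]
    by (simp add: v_def inner_add_right)
  have "\<forall>\<^sub>F t in at 0. t \<in> T" using T(1,2) by (simp add: eventually_at_topological) blast
  then have "\<forall>\<^sub>F t in at 0. (exterior_normal graph (lift (y + t *\<^sub>R w)) \<bullet> v - exterior_normal graph (lift y) \<bullet> v) / t
      * norm (conormal (y + t *\<^sub>R w)) = (dir_deriv w f (y + t *\<^sub>R w) - dir_deriv w f y) / t"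
  proof eventually_elim
    case (elim t)
    have "conormal (y + t *\<^sub>R w) \<noteq> 0" using conormal_nonzero[OF D_U[OF T(3)[OF elim]]] .
    then show ?case
      unfolding exterior_normal_lift[OF T(3)[OF elim]] exterior_normal_lift[OF y]
      using key[OF y] key[OF T(3)[OF elim]] by (simp add: field_simps)
  qed
  then have "((\<lambda>t. (dir_deriv w f (y + t *\<^sub>R w) - dir_deriv w f y) / t) \<longlongrightarrow> (L v \<bullet> v) * norm (conormal y)) (at 0)"
    by (rule Lim_transform_eventually[OF tendsto_mult[OF lim1 lim2]])
  moreover have "((\<lambda>t. (dir_deriv w f (y + t *\<^sub>R w) - dir_deriv w f y) / t) \<longlongrightarrow> dir_deriv w (dir_deriv w f) y) (at 0)"
    using dir_deriv_line[of "dir_deriv w f" y 0 w] dir_deriv_differentiable[OF D_U[OF y]]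
    by (simp add: has_field_derivative_iff)
  ultimately have "dir_deriv w (dir_deriv w f) y = (L v \<bullet> v) * norm (conormal y)"
    using LIM_unique by blast
  then show ?thesis using Lv conormal_nonzero[OF D_U[OF y]] by simp
qed

text \<open>The point is found as a minimum of \<open>f\<close> minus a linear function, which needs only strict
  convexity and no inverse function theorem.\<close>

lemma conormal_perturbation:
  assumes y0: "y0 \<in> D" and \<eta>: "\<eta> \<in> H"
  shows "\<exists>\<delta>>0. \<forall>\<epsilon>. \<bar>\<epsilon>\<bar> < \<delta> \<longrightarrow> (\<exists>y\<in>D. conormal y = conormal y0 + \<epsilon> *\<^sub>R \<eta>)"
proof -
  obtain r where r: "r > 0" "cball y0 r \<subseteq> U" using open_U D_U[OF y0] open_contains_cball by blast
  define K where "K = cball y0 r \<inter> H"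
  define \<Phi> where "\<Phi> = (\<lambda>y. f y - conormal y0 \<bullet> y)"
  have KD: "K \<subseteq> D" using r(2) by (auto simp: K_def D_def)
  have closed_H: "closed H" using closed_subspace subspace_H by blast
  have K: "compact K" unfolding K_def by (intro compact_Int_closed compact_cball closed_H)
  have cont: "continuous_on D \<Phi>"
    unfolding \<Phi>_def using continuous_on_subset[OF Ck_on_continuous_on[OF smooth]]
    by (intro continuous_intros) (auto simp: D_def)
  define S where "S = sphere y0 r \<inter> H"
  have S: "compact S" "S \<subseteq> K" unfolding S_def K_def by (auto intro!: compact_Int_closed compact_sphere closed_H)
  have gt: "\<Phi> y > \<Phi> y0" if "y \<in> D" "y \<noteq> y0" for y
  proof -
    have h: "y - y0 \<in> H" using that y0 D_H subspace_H by (simp add: subspace_diff)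
    then show ?thesis
      using gradient_inequality[OF y0 that(1)] that(2) conormal_inner_H[OF D_U[OF y0] h]
      by (simp add: \<Phi>_def inner_diff_right)
  qed
  have "\<exists>m>0. \<forall>y\<in>S. \<Phi> y \<ge> \<Phi> y0 + m"
  proof (cases "S = {}")
    case True
    then show ?thesis by (intro exI[of _ 1]) auto
  next
    case False
    then obtain y1 where y1: "y1 \<in> S" "\<And>y. y \<in> S \<Longrightarrow> \<Phi> y1 \<le> \<Phi> y"
      using continuous_attains_inf[OF S(1)] continuous_on_subset[OF cont] S(2) KD by (metis subset_trans)
    have "y1 \<noteq> y0" using y1(1) r(1) by (auto simp: S_def)
    then have "\<Phi> y1 > \<Phi> y0" using gt y1(1) S(2) KD by blast
    then show ?thesis using y1(2) by (intro exI[of _ "\<Phi> y1 - \<Phi> y0"]) auto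
  qed
  then obtain m where m: "m > 0" "\<And>y. y \<in> S \<Longrightarrow> \<Phi> y \<ge> \<Phi> y0 + m" by blast
  \<comment> \<open>On the sphere the perturbation changes \<open>\<Phi> y - \<Phi> y0\<close> by at
    most \<open>\<bar>\<epsilon>\<bar> * norm \<eta> * r\<close>, which is kept below the margin
    \<open>m\<close>, so the minimum is interior; the \<open>+ 1\<close> covers
    \<open>\<eta> = 0\<close>.\<close>
  define \<delta> where "\<delta> = m / (r * (norm \<eta> + 1))"
  have rn: "r * (norm \<eta> + 1) > 0" using r(1) by (simp add: add_nonneg_pos)
  then have "\<delta> > 0" using m(1) by (simp add: \<delta>_def)
  moreover have "\<exists>y\<in>D. conormal y = conormal y0 + \<epsilon> *\<^sub>R \<eta>" if \<epsilon>: "\<bar>\<epsilon>\<bar> < \<delta>" for \<epsilon>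
  proof -
    define \<Psi> where "\<Psi> = (\<lambda>y. \<Phi> y - (\<epsilon> *\<^sub>R \<eta>) \<bullet> y)"
    have "y0 \<in> K" using y0 r(1) D_H by (simp add: K_def)
    moreover have "continuous_on K \<Psi>"
      unfolding \<Psi>_def by (intro continuous_intros continuous_on_subset[OF cont KD])
    ultimately obtain y where y: "y \<in> K" "\<And>x. x \<in> K \<Longrightarrow> \<Psi> y \<le> \<Psi> x"
      using continuous_attains_inf[OF K] by (metis empty_iff)
    have yD: "y \<in> D" using y(1) KD by blast
    have "y \<notin> S"
    proof
      assume yS: "y \<in> S"
      have "\<Phi> y - \<Phi> y0 \<le> (\<epsilon> *\<^sub>R \<eta>) \<bullet> (y - y0)"
        using y(2)[OF \<open>y0 \<in> K\<close>] by (simp add: \<Psi>_def inner_diff_right)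
      also have "\<dots> \<le> norm (\<epsilon> *\<^sub>R \<eta>) * norm (y - y0)" by (rule norm_cauchy_schwarz)
      also have "\<dots> = \<bar>\<epsilon>\<bar> * (norm \<eta> * r)" using yS by (simp add: S_def dist_norm norm_minus_commute)
      also have "\<dots> \<le> \<bar>\<epsilon>\<bar> * (r * (norm \<eta> + 1))" using r(1) by (intro mult_left_mono) (auto simp: algebra_simps)
      also have "\<dots> < \<delta> * (r * (norm \<eta> + 1))" using \<epsilon> rn by (rule mult_strict_right_mono)
      also have "\<dots> = m" unfolding \<delta>_def using rn by (metis less_irrefl nonzero_divide_eq_eq)
      finally show False using m(2)[OF yS] by simp
    qed
    then have yball: "y \<in> ball y0 r" using y(1) by (auto simp: S_def K_def)
    have "conormal y = conormal y0 + \<epsilon> *\<^sub>R \<eta>"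
    proof (rule eq_if_inner_eq)
      show "conormal y \<bullet> e = (conormal y0 + \<epsilon> *\<^sub>R \<eta>) \<bullet> e"
        using conormal_inner_e D_U y0 yD H_inner[OF \<eta>] by (simp add: inner_add_left)
      fix w assume w: "w \<in> H"
      define g where "g = (\<lambda>t. \<Psi> (y + t *\<^sub>R w))"
      have "(g has_real_derivative dir_deriv w f y - conormal y0 \<bullet> w - (\<epsilon> *\<^sub>R \<eta>) \<bullet> w) (at 0)"
        unfolding g_def \<Psi>_def \<Phi>_def using line_deriv[of y 0 w] D_U[OF yD]
        by (auto intro!: derivative_eq_intros simp: inner_add_right)
      moreover have "open ((\<lambda>t. y + t *\<^sub>R w) -` ball y0 r)" by (intro open_vimage open_ball continuous_intros)
      then obtain \<theta> where "\<theta> > 0" "ball 0 \<theta> \<subseteq> (\<lambda>t. y + t *\<^sub>R w) -` ball y0 r"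
        using yball openE[of "(\<lambda>t. y + t *\<^sub>R w) -` ball y0 r" 0] by auto
      have "g 0 \<le> g t" if "\<bar>0 - t\<bar> < \<theta>" for t
      proof -
        have "t \<in> ball 0 \<theta>" using that by (simp add: dist_real_def)
        then have "y + t *\<^sub>R w \<in> ball y0 r"
          using \<open>ball 0 \<theta> \<subseteq> (\<lambda>t. y + t *\<^sub>R w) -` ball y0 r\<close> by blast
        then have "y + t *\<^sub>R w \<in> K" using H_line[OF D_H[OF yD] w] by (simp add: K_def)
        then show ?thesis using y(2) by (simp add: g_def)
      qed
      then have "\<forall>t. \<bar>0 - t\<bar> < \<theta> \<longrightarrow> g 0 \<le> g t" by blast
      ultimately have "dir_deriv w f y - conormal y0 \<bullet> w - (\<epsilon> *\<^sub>R \<eta>) \<bullet> w = 0"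
        using DERIV_local_min \<open>\<theta> > 0\<close> by blast
      then show "conormal y \<bullet> w = (conormal y0 + \<epsilon> *\<^sub>R \<eta>) \<bullet> w"
        using conormal_inner_H[OF D_U[OF yD] w] by (simp add: inner_add_left)
    qed
    then show ?thesis using yD by blast
  qed
  ultimately show ?thesis by blast
qed

end

section \<open>The involution of a class of parallel lines\<close>

definition lines_along :: "'a::euclidean_space \<Rightarrow> 'a set set" where
  "lines_along v = {\<Lambda>. affine_line \<Lambda> \<and> affine_parallel (span {v}) \<Lambda>}"

lemma affine_line_translate_span:
  assumes "v \<noteq> 0"
  shows "affine_line ((\<lambda>x. A + x) ` span {v})"
proof -
  have "aff_dim (span {v}) = 1" using assms by (simp add: aff_dim_subspace dim_singleton)
  then show ?thesis
    by (simp add: affine_line_def affine_translation[symmetric] aff_dim_translation_eq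
        subspace_imp_affine)
qed

lemma translate_span: "(\<lambda>x. A + x) ` span {v} = range (\<lambda>t. A + t *\<^sub>R v)"
  by (auto simp: span_singleton)

lemma lines_along_iff:
  assumes "v \<noteq> 0"
  shows "\<Lambda> \<in> lines_along v \<longleftrightarrow> (\<exists>A. \<Lambda> = range (\<lambda>t. A + t *\<^sub>R v))"
  using affine_line_translate_span[OF assms]
  by (auto simp: lines_along_def affine_parallel_def translate_span)

lemma lines_along_through:
  assumes "v \<noteq> 0" "\<Lambda> \<in> lines_along v" "A \<in> \<Lambda>"
  shows "\<Lambda> = range (\<lambda>t. A + t *\<^sub>R v)"
proof -
  obtain A0 where A0: "\<Lambda> = range (\<lambda>t. A0 + t *\<^sub>R v)" using assms lines_along_iff by blast
  with assms(3) obtain t0 where t0: "A = A0 + t0 *\<^sub>R v" by blast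
  have e: "A0 + t *\<^sub>R v = A + (t - t0) *\<^sub>R v" "A + t *\<^sub>R v = A0 + (t0 + t) *\<^sub>R v" for t
    by (simp_all add: t0 algebra_simps)
  show ?thesis
  proof (intro equalityI subsetI)
    fix x assume "x \<in> \<Lambda>"
    then obtain t where "x = A0 + t *\<^sub>R v" unfolding A0 by blast
    then show "x \<in> range (\<lambda>t. A + t *\<^sub>R v)" unfolding e(1) by blast
  next
    fix x assume "x \<in> range (\<lambda>t. A + t *\<^sub>R v)"
    then obtain t where "x = A + t *\<^sub>R v" by blast
    then show "x \<in> \<Lambda>" unfolding A0 e(2) by blast
  qed
qed

lemma parallel_class_lines_along:
  assumes "v \<noteq> 0"
  shows "parallel_class (lines_along v)"
proof -
  have "affine_line (span {v})" using affine_line_translate_span[OF assms, of 0] by simp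
  then show ?thesis unfolding parallel_class_def lines_along_def by blast
qed

text \<open>Only one line of the class passes through \<open>A\<close>. Together with
  \<open>exterior_normal_inj\<close> this makes the value described in
  \<open>line_involution\<close> unique.\<close>

lemma meets_at_unique:
  assumes "v \<noteq> 0" "meets_at S (lines_along v) A B" "meets_at S (lines_along v) A B'"
  shows "B = B'"
proof -
  obtain \<Lambda> \<Lambda>' where L: "\<Lambda> \<in> lines_along v" "\<Lambda> \<inter> S = {A, B}" "\<Lambda>' \<in> lines_along v" "\<Lambda>' \<inter> S = {A, B'}"
    using assms(2,3) unfolding meets_at_def by blast
  then have "A \<in> \<Lambda>" "A \<in> \<Lambda>'" by blast+
  then have "\<Lambda> = \<Lambda>'" using L lines_along_through[OF assms(1)] by metis
  then have "{A, B} = {A, B'}" using L by simp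
  then show ?thesis by (auto simp: doubleton_eq_iff)
qed

lemma meets_at_sym: "meets_at S \<L> A B \<Longrightarrow> meets_at S \<L> B A"
  unfolding meets_at_def by (auto simp: insert_commute)

lemma linear_scalar_plus_rank_one:
  fixes T :: "'a::euclidean_space \<Rightarrow> 'a"
  assumes "linear T" "v \<noteq> 0" "\<And>x. x \<bullet> v = 0 \<Longrightarrow> T x = \<mu> *\<^sub>R x"
  shows "\<exists>k. \<forall>x. T x = \<mu> *\<^sub>R x + (x \<bullet> v) *\<^sub>R k"
proof (intro exI allI)
  fix x
  define c where "c = (x \<bullet> v) / (v \<bullet> v)"
  have "(x - c *\<^sub>R v) \<bullet> v = 0" using assms(2) by (simp add: c_def inner_diff_left)
  from assms(3)[OF this] have "T x - c *\<^sub>R T v = \<mu> *\<^sub>R (x - c *\<^sub>R v)"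
    using assms(1) by (simp add: linear_diff linear_scale)
  then have "T x = \<mu> *\<^sub>R x + c *\<^sub>R (T v - \<mu> *\<^sub>R v)" by (simp add: algebra_simps)
  then show "T x = \<mu> *\<^sub>R x + (x \<bullet> v) *\<^sub>R ((T v - \<mu> *\<^sub>R v) /\<^sub>R (v \<bullet> v))"
    by (simp add: c_def divide_inverse)
qed

text \<open>\<open>p\<close> and \<open>q\<close> stand for the pairings of the two end conormals
  with \<open>v\<close>, and \<open>ke\<close>, \<open>kv\<close> for those of the rank-one vector
  \<open>k\<close> with \<open>e\<close> and \<open>v\<close>. The equations say that the map
  exchanges the conormals up to factors. Eliminating \<open>kv\<close> leaves a factor
  \<open>q - p\<close>, which the signs make nonzero.\<close>

lemma reciprocal_sum_eq:
  fixes p q \<mu> \<rho> \<rho>' ke kv :: real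
  assumes "p < 0" "q > 0" "\<mu> \<noteq> 0"
    and "- \<mu> + p * ke = - \<rho>" "\<mu> * p + p * kv = \<rho> * q"
    and "- \<mu> + q * ke = - \<rho>'" "\<mu> * q + q * kv = \<rho>' * p"
  shows "1 / p + 1 / q = ke / \<mu>"
proof -
  have r: "\<rho> = \<mu> - p * ke" "\<rho>' = \<mu> - q * ke" using assms(4,6) by simp_all
  have "q * (\<mu> * p + p * kv) = p * (\<mu> * q + q * kv)" by (simp add: algebra_simps)
  then have "q * ((\<mu> - p * ke) * q) = p * ((\<mu> - q * ke) * p)" using assms(5,7) r by simp
  then have "(q - p) * (\<mu> * (p + q) - ke * (p * q)) = 0" by (simp add: algebra_simps)
  then have "\<mu> * (p + q) = ke * (p * q)" using assms(1,2) by simp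
  then show ?thesis using assms(1-3) by (simp add: field_simps)
qed

section \<open>The lifted projective map on the conormals of chords and tangencies\<close>

context convex_graph
begin

text \<open>The case \<open>y = y'\<close> is included: at a tangency the conormal is an eigenvector
  of \<open>T\<close>.\<close>

lemma lifting_scales_conormal:
  assumes "v \<noteq> 0" and J: "is_lifting_of (line_involution graph (lines_along v)) J"
    and T: "linear T" "\<forall>l\<in>projective_space. J l = T ` l"
    and y: "y \<in> D" "y' \<in> D" and m: "meets_at graph (lines_along v) (lift y) (lift y')"
  shows "\<exists>\<rho>. T (conormal y) = \<rho> *\<^sub>R conormal y'"
proof -
  let ?n = "exterior_normal graph"
  let ?R = "line_involution graph (lines_along v)"
  have G: "A \<in> graph \<and> B \<in> graph" if "meets_at graph (lines_along v) A B" for A B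
    using that unfolding meets_at_def by blast
  have "(THE w. \<exists>A B. meets_at graph (lines_along v) A B \<and> ?n A = ?n (lift y) \<and> ?n B = w) = ?n (lift y')"
  proof (rule the_equality)
    show "\<exists>A B. meets_at graph (lines_along v) A B \<and> ?n A = ?n (lift y) \<and> ?n B = ?n (lift y')"
      using m by blast
    fix w assume "\<exists>A B. meets_at graph (lines_along v) A B \<and> ?n A = ?n (lift y) \<and> ?n B = w"
    then obtain A B where AB: "meets_at graph (lines_along v) A B" "?n A = ?n (lift y)" "?n B = w" by blast
    then have "A = lift y" using exterior_normal_inj[OF _ _ AB(2)] G[OF AB(1)] G[OF m] by blast
    then show "w = ?n (lift y')" using meets_at_unique[OF assms(1) m] AB by blast
  qed
  then have R: "?R (?n (lift y)) = Some (?n (lift y'))"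
    unfolding line_involution_def using m by auto
  then have "?n (lift y) \<in> dom ?R" by blast
  with J have "tautological_projection (the (?R (?n (lift y)))) = J (tautological_projection (?n (lift y)))"
    unfolding is_lifting_of_def by blast
  then have "span {?n (lift y')} = J (span {?n (lift y)})"
    unfolding R by (simp add: tautological_projection_def)
  moreover have sp: "span {?n (lift z)} = span {conormal z}" if "z \<in> D" for z
  proof -
    have "inverse (norm (conormal z)) \<noteq> 0" using conormal_nonzero[OF D_U[OF that]] by simp
    then show ?thesis
      unfolding exterior_normal_lift[OF that] using span_image_scale[of "{conormal z}" "\<lambda>_. inverse (norm (conormal z))"]
      by simp
  qed
  moreover have "J (span {conormal y}) = T ` span {conormal y}"
    using conormal_nonzero[OF D_U[OF y(1)]] by (intro bspec[OF T(2)]) (simp add: projective_space_def dim_singleton)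
  ultimately have "T ` span {conormal y} = span {conormal y'}" using y by simp
  moreover have "conormal y \<in> span {conormal y}" by (rule span_base) simp
  ultimately have "T (conormal y) \<in> span {conormal y'}" by blast
  then show ?thesis by (auto simp: span_singleton)
qed

lemma no_three_on_line:
  assumes "w \<noteq> 0" "z + t1 *\<^sub>R w \<in> D" "z + t3 *\<^sub>R w \<in> D" "t1 < t2" "t2 < t3"
    and "f (z + t2 *\<^sub>R w) = f (z + t1 *\<^sub>R w) + (t2 - t1) * s"
    and "f (z + t3 *\<^sub>R w) = f (z + t1 *\<^sub>R w) + (t3 - t1) * s"
  shows False
proof -
  define t where "t = (t2 - t1) / (t3 - t1)"
  have t: "0 < t" "t < 1" "t * (t3 - t1) = t2 - t1" using assms(4,5) by (auto simp: t_def)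
  have ne: "z + t1 *\<^sub>R w \<noteq> z + t3 *\<^sub>R w" using assms(1,4,5) by auto
  have "z + t1 *\<^sub>R w + t *\<^sub>R (z + t3 *\<^sub>R w - (z + t1 *\<^sub>R w)) = z + (t1 + t * (t3 - t1)) *\<^sub>R w"
    by (simp add: algebra_simps)
  then have eq: "z + t1 *\<^sub>R w + t *\<^sub>R (z + t3 *\<^sub>R w - (z + t1 *\<^sub>R w)) = z + t2 *\<^sub>R w"
    using t(3) by simp
  have "f (z + t2 *\<^sub>R w) < (1 - t) * f (z + t1 *\<^sub>R w) + t * f (z + t3 *\<^sub>R w)"
    using strictly_convex[OF assms(2,3) ne t(1,2)] unfolding eq .
  also have "\<dots> = f (z + t1 *\<^sub>R w) + (t * (t3 - t1)) * s" unfolding assms(7) by (simp add: algebra_simps)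
  finally show False unfolding t(3) assms(6) by simp
qed

lemma lift_on_line_iff:
  assumes "y \<in> H" "w \<in> H"
  shows "lift y + t *\<^sub>R (w + s *\<^sub>R e) \<in> graph \<longleftrightarrow> y + t *\<^sub>R w \<in> D \<and> f (y + t *\<^sub>R w) = f y + t * s"
proof
  let ?P = "lift y + t *\<^sub>R (w + s *\<^sub>R e)"
  have proj: "proj ?P = y + t *\<^sub>R w" "e \<bullet> ?P = f y + t * s"
    using assms by (auto simp: proj_def lift_def inner_add_right inner_e H_inner algebra_simps)
  assume "?P \<in> graph"
  then obtain y' where y': "y' \<in> D" "?P = lift y'" unfolding graph_def by blast
  then have "y' = y + t *\<^sub>R w" using proj proj_lift[OF D_H[OF y'(1)]] by simp
  moreover have "f y' = f y + t * s" using proj(2) e_lift[OF D_H[OF y'(1)]] y'(2) by simp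
  ultimately show "y + t *\<^sub>R w \<in> D \<and> f (y + t *\<^sub>R w) = f y + t * s" using y'(1) by simp
next
  assume h: "y + t *\<^sub>R w \<in> D \<and> f (y + t *\<^sub>R w) = f y + t * s"
  then have "lift y + t *\<^sub>R (w + s *\<^sub>R e) = lift (y + t *\<^sub>R w)" by (simp add: lift_def algebra_simps)
  then show "lift y + t *\<^sub>R (w + s *\<^sub>R e) \<in> graph" using h by (simp add: graph_def)
qed

lemma sloped_nonzero: "w \<in> H \<Longrightarrow> w \<noteq> 0 \<Longrightarrow> w + s *\<^sub>R e \<noteq> 0"
proof
  assume w: "w \<in> H" "w \<noteq> 0" "w + s *\<^sub>R e = 0"
  from arg_cong[OF w(3), of "\<lambda>x. x \<bullet> e"] have "s = 0" using H_inner[OF w(1)] by (simp add: inner_add_left inner_e)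
  then show False using w by simp
qed

lemma chord_line:
  assumes w: "w \<in> H" "w \<noteq> 0" and y: "y \<in> D" and t: "t \<noteq> 0" "y + t *\<^sub>R w \<in> D" "f (y + t *\<^sub>R w) = f y + t * s"
  defines "\<Lambda> \<equiv> range (\<lambda>r. lift y + r *\<^sub>R (w + s *\<^sub>R e))"
  shows "\<Lambda> \<in> lines_along (w + s *\<^sub>R e)" "\<Lambda> \<inter> graph = {lift y, lift (y + t *\<^sub>R w)}"
    "lift y \<noteq> lift (y + t *\<^sub>R w)"
proof -
  show "\<Lambda> \<in> lines_along (w + s *\<^sub>R e)"
    unfolding \<Lambda>_def using lines_along_iff[OF sloped_nonzero[OF w]] by blast
  have e: "lift (y + t *\<^sub>R w) = lift y + t *\<^sub>R (w + s *\<^sub>R e)"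
    using t(3) by (simp add: lift_def algebra_simps)
  have only: "r = 0 \<or> r = t" if "lift y + r *\<^sub>R (w + s *\<^sub>R e) \<in> graph" for r
  proof (rule ccontr)
    assume "\<not> (r = 0 \<or> r = t)"
    then have r: "r \<noteq> 0" "r \<noteq> t" by auto
    have h: "y + r *\<^sub>R w \<in> D" "f (y + r *\<^sub>R w) = f y + r * s"
      using that lift_on_line_iff[OF D_H[OF y] w(1)] by auto
    define P where "P = (\<lambda>r. y + r *\<^sub>R w \<in> D \<and> f (y + r *\<^sub>R w) = f y + r * s)"
    have P: "P 0" "P t" "P r" using y t h by (auto simp: P_def)
    have no: False if "P t1" "P t2" "P t3" "t1 < t2" "t2 < t3" for t1 t2 t3
      using no_three_on_line[OF w(2), of y t1 t3 t2 s] that by (simp add: P_def algebra_simps)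
    consider "0 < r" "r < t" | "0 < t" "t < r" | "r < 0" "0 < t" | "r < t" "t < 0" | "t < r" "r < 0" | "t < 0" "0 < r"
      using r t(1) by linarith
    then show False
      by cases (use no P in blast)+
  qed
  have "\<Lambda> \<inter> graph \<subseteq> {lift y, lift (y + t *\<^sub>R w)}"
  proof
    fix x assume x: "x \<in> \<Lambda> \<inter> graph"
    then obtain r where r: "x = lift y + r *\<^sub>R (w + s *\<^sub>R e)" unfolding \<Lambda>_def by blast
    then have "r = 0 \<or> r = t" using x only by blast
    then show "x \<in> {lift y, lift (y + t *\<^sub>R w)}" using r e by auto
  qed
  moreover have "lift y + 0 *\<^sub>R (w + s *\<^sub>R e) \<in> \<Lambda>" "lift y + t *\<^sub>R (w + s *\<^sub>R e) \<in> \<Lambda>" unfolding \<Lambda>_def by blast+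
  moreover have "lift y \<in> graph" "lift (y + t *\<^sub>R w) \<in> graph" using y t(2) by (auto simp: graph_def)
  ultimately show "\<Lambda> \<inter> graph = {lift y, lift (y + t *\<^sub>R w)}" using e by auto
  show "lift y \<noteq> lift (y + t *\<^sub>R w)"
    using lift_inj[OF D_H[OF y] D_H[OF t(2)]] t(1) w(2) by auto
qed

lemma tangent_line_meets:
  assumes w: "w \<in> H" "w \<noteq> 0" and y: "y \<in> D" and s: "dir_deriv w f y = s"
  shows "meets_at graph (lines_along (w + s *\<^sub>R e)) (lift y) (lift y)"
proof -
  define \<Lambda> where "\<Lambda> = range (\<lambda>r. lift y + r *\<^sub>R (w + s *\<^sub>R e))"
  have "\<Lambda> \<in> lines_along (w + s *\<^sub>R e)"
    unfolding \<Lambda>_def using lines_along_iff[OF sloped_nonzero[OF w]] by blast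
  moreover have "\<Lambda> \<inter> graph = {lift y, lift y}"
  proof -
    have "r = 0" if "lift y + r *\<^sub>R (w + s *\<^sub>R e) \<in> graph" for r
    proof (rule ccontr)
      assume "r \<noteq> 0"
      have h: "y + r *\<^sub>R w \<in> D" "f (y + r *\<^sub>R w) = f y + r * s"
        using that lift_on_line_iff[OF D_H[OF y] w(1)] by auto
      have "f y + dir_deriv (r *\<^sub>R w) f y < f (y + r *\<^sub>R w)"
        using gradient_inequality[OF y h(1)] \<open>r \<noteq> 0\<close> w(2) by simp
      then show False
        using h(2) s linear_scale[OF dir_deriv_linear[OF differentiable[OF D_U[OF y]]]] by simp
    qed
    moreover have "lift y \<in> \<Lambda>" unfolding \<Lambda>_def by (rule rev_image_eqI[of 0]) auto
    moreover have "lift y \<in> graph" using y by (auto simp: graph_def)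
    ultimately show ?thesis unfolding \<Lambda>_def by auto
  qed
  moreover have "x - lift y \<in> tangent_space graph (lift y)" if x: "x \<in> \<Lambda>" for x
  proof -
    obtain r where r: "x = lift y + r *\<^sub>R (w + s *\<^sub>R e)" using x unfolding \<Lambda>_def by blast
    have "x - lift y = r *\<^sub>R w + dir_deriv (r *\<^sub>R w) f y *\<^sub>R e"
      using r s linear_scale[OF dir_deriv_linear[OF differentiable[OF D_U[OF y]]]]
      by (simp add: algebra_simps)
    then show ?thesis
      unfolding tangent_space_lift[OF y] using w(1) subspace_H subspace_scale by blast
  qed
  ultimately show ?thesis unfolding meets_at_def by blast
qed

text \<open>Both \<open>conormal m + \<epsilon> \<eta>\<close> and \<open>conormal m - \<epsilon> \<eta>\<close> are eigenvectors for small \<open>\<epsilon>\<close>, which forces the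
  eigenvalues to agree.\<close>

lemma lifting_scalar_on_tangents:
  assumes w: "w \<in> H" "w \<noteq> 0" and m: "m \<in> D" "dir_deriv w f m = s"
    and T: "linear T" and eig: "\<And>y. y \<in> D \<Longrightarrow> dir_deriv w f y = s \<Longrightarrow> \<exists>\<rho>. T (conormal y) = \<rho> *\<^sub>R conormal y"
  shows "\<exists>\<mu>. \<forall>x. x \<bullet> (w + s *\<^sub>R e) = 0 \<longrightarrow> T x = \<mu> *\<^sub>R x"
proof -
  obtain \<mu> where \<mu>: "T (conormal m) = \<mu> *\<^sub>R conormal m" using eig[OF m] by blast
  have T\<eta>: "T \<eta> = \<mu> *\<^sub>R \<eta>" if \<eta>: "\<eta> \<in> H" "\<eta> \<bullet> w = 0" for \<eta>
  proof (cases "\<eta> = 0")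
    case True
    then show ?thesis using linear_0[OF T] by simp
  next
    case False
    obtain \<delta> where \<delta>: "\<delta> > 0" "\<And>\<epsilon>. \<bar>\<epsilon>\<bar> < \<delta> \<Longrightarrow> \<exists>y\<in>D. conormal y = conormal m + \<epsilon> *\<^sub>R \<eta>"
      using conormal_perturbation[OF m(1) \<eta>(1)] by blast
    have ev: "\<exists>\<rho>. T (conormal m + \<epsilon> *\<^sub>R \<eta>) = \<rho> *\<^sub>R (conormal m + \<epsilon> *\<^sub>R \<eta>)" if \<epsilon>: "\<bar>\<epsilon>\<bar> < \<delta>" for \<epsilon>
    proof -
      obtain y where y: "y \<in> D" "conormal y = conormal m + \<epsilon> *\<^sub>R \<eta>" using \<delta>(2)[OF \<epsilon>] by blast
      have "dir_deriv w f y = s"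
        using conormal_inner_H[OF D_U[OF y(1)] w(1)] conormal_inner_H[OF D_U[OF m(1)] w(1)] y(2) m(2) \<eta>(2)
        by (simp add: inner_add_left)
      from eig[OF y(1) this] y(2) show ?thesis by simp
    qed
    define \<epsilon> where "\<epsilon> = \<delta> / 2"
    have \<epsilon>: "\<epsilon> > 0" "\<bar>\<epsilon>\<bar> < \<delta>" "\<bar>- \<epsilon>\<bar> < \<delta>" using \<delta>(1) by (auto simp: \<epsilon>_def)
    obtain \<rho>1 \<rho>2 where \<rho>: "T (conormal m + \<epsilon> *\<^sub>R \<eta>) = \<rho>1 *\<^sub>R (conormal m + \<epsilon> *\<^sub>R \<eta>)"
      "T (conormal m + (- \<epsilon>) *\<^sub>R \<eta>) = \<rho>2 *\<^sub>R (conormal m + (- \<epsilon>) *\<^sub>R \<eta>)"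
      using ev[OF \<epsilon>(2)] ev[OF \<epsilon>(3)] by blast
    have eq1: "\<mu> *\<^sub>R conormal m + \<epsilon> *\<^sub>R T \<eta> = \<rho>1 *\<^sub>R (conormal m + \<epsilon> *\<^sub>R \<eta>)"
      and eq2: "\<mu> *\<^sub>R conormal m - \<epsilon> *\<^sub>R T \<eta> = \<rho>2 *\<^sub>R (conormal m - \<epsilon> *\<^sub>R \<eta>)"
      using \<rho> T \<mu> by (simp_all add: linear_add linear_diff linear_scale)
    \<comment> \<open>Adding cancels \<open>T \<eta>\<close>. Since \<open>\<eta>\<close> is
      horizontal and \<open>conormal m\<close> has \<open>e\<close>-component \<open>-1\<close>, the
      coefficients of the two vectors can be compared separately.\<close>
    from arg_cong2[OF eq1 eq2, of "(+)"]
    have sum: "\<mu> *\<^sub>R conormal m + \<mu> *\<^sub>R conormal m = (\<rho>1 + \<rho>2) *\<^sub>R conormal m + (\<epsilon> * (\<rho>1 - \<rho>2)) *\<^sub>R \<eta>"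
      by (simp add: algebra_simps)
    from arg_cong[OF this, of "\<lambda>x. x \<bullet> e"] have "\<mu> + \<mu> = \<rho>1 + \<rho>2"
      using conormal_inner_e[OF D_U[OF m(1)]] H_inner[OF \<eta>(1)] by (simp add: inner_add_left)
    moreover from this have "\<mu> *\<^sub>R conormal m + \<mu> *\<^sub>R conormal m = (\<rho>1 + \<rho>2) *\<^sub>R conormal m"
      by (metis scaleR_left_distrib)
    with sum have "(\<epsilon> * (\<rho>1 - \<rho>2)) *\<^sub>R \<eta> = 0" by simp
    then have "\<rho>1 = \<rho>2" using \<epsilon>(1) False by simp
    ultimately have "\<rho>1 = \<mu>" by simp
    then have "\<epsilon> *\<^sub>R T \<eta> = \<epsilon> *\<^sub>R (\<mu> *\<^sub>R \<eta>)" using eq1 by (simp add: algebra_simps)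
    with \<epsilon>(1) show ?thesis by (simp only: scaleR_cancel_left less_imp_neq[symmetric] simp_thms)
  qed
  show ?thesis
  proof (intro exI allI impI)
    fix x assume x: "x \<bullet> (w + s *\<^sub>R e) = 0"
    \<comment> \<open>\<open>conormal m\<close> is itself orthogonal to
      \<open>w + s *\<^sub>R e\<close>, so adding the multiple that cancels the
      \<open>e\<close>-component makes \<open>x\<close> horizontal without leaving the
      hyperplane.\<close>
    define \<eta> where "\<eta> = x + (x \<bullet> e) *\<^sub>R conormal m"
    have "\<eta> \<in> H" using conormal_inner_e[OF D_U[OF m(1)]]
      by (simp add: H_def \<eta>_def inner_add_left inner_commute[of e])
    moreover have "\<eta> \<bullet> w = 0"
      using x conormal_inner_H[OF D_U[OF m(1)] w(1)] m(2)
      by (simp add: \<eta>_def inner_add_left inner_add_right mult.commute)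
    ultimately have "T \<eta> = \<mu> *\<^sub>R \<eta>" by (rule T\<eta>)
    then show "T x = \<mu> *\<^sub>R x"
      using \<mu> T by (simp add: \<eta>_def linear_add linear_scale algebra_simps)
  qed
qed

text \<open>A first chord is needed to apply \<open>lifting\<close>; if there is none, the claim is
  vacuous. \<open>J\<close> and \<open>T\<close> are chosen once for the class, so
  \<open>(k \<bullet> e) / \<mu>\<close> serves all chords of slope \<open>s\<close>.\<close>

lemma chord_relation:
  assumes w: "w \<in> H" "w \<noteq> 0" and z: "z \<in> H"
    and lifting: "\<And>\<L>. parallel_class \<L> \<Longrightarrow> \<exists>\<Lambda>\<in>\<L>. card (\<Lambda> \<inter> graph) = 2 \<Longrightarrow>
           \<exists>J. projective_involution J \<and> is_lifting_of (line_involution graph \<L>) J"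
  shows "\<exists>c. \<forall>a b. a < b \<longrightarrow> z + a *\<^sub>R w \<in> D \<longrightarrow> z + b *\<^sub>R w \<in> D \<longrightarrow>
    f (z + b *\<^sub>R w) - f (z + a *\<^sub>R w) = (b - a) * s \<longrightarrow>
    1 / (dir_deriv w f (z + a *\<^sub>R w) - s) + 1 / (dir_deriv w f (z + b *\<^sub>R w) - s) = c"
proof (cases "\<exists>a b. a < b \<and> z + a *\<^sub>R w \<in> D \<and> z + b *\<^sub>R w \<in> D \<and> f (z + b *\<^sub>R w) - f (z + a *\<^sub>R w) = (b - a) * s")
  case False
  then show ?thesis by blast
next
  case True
  then obtain a0 b0 where ab0: "a0 < b0" "z + a0 *\<^sub>R w \<in> D" "z + b0 *\<^sub>R w \<in> D"
    "f (z + b0 *\<^sub>R w) - f (z + a0 *\<^sub>R w) = (b0 - a0) * s" by blast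
  define v where "v = w + s *\<^sub>R e"
  have v: "v \<noteq> 0" using sloped_nonzero[OF w] by (simp add: v_def)
  have meets: "meets_at graph (lines_along v) (lift (z + a *\<^sub>R w)) (lift (z + b *\<^sub>R w)) \<and>
      (\<exists>\<Lambda>\<in>lines_along v. card (\<Lambda> \<inter> graph) = 2)"
    if "a < b" "z + a *\<^sub>R w \<in> D" "z + b *\<^sub>R w \<in> D" "f (z + b *\<^sub>R w) - f (z + a *\<^sub>R w) = (b - a) * s" for a b
  proof -
    have eq: "z + a *\<^sub>R w + (b - a) *\<^sub>R w = z + b *\<^sub>R w" by (simp add: algebra_simps)
    have t: "b - a \<noteq> 0" "z + a *\<^sub>R w + (b - a) *\<^sub>R w \<in> D"
      "f (z + a *\<^sub>R w + (b - a) *\<^sub>R w) = f (z + a *\<^sub>R w) + (b - a) * s"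
      unfolding eq using that by simp_all
    note c = chord_line[OF w that(2) t, unfolded eq, folded v_def]
    define \<Lambda> where "\<Lambda> = range (\<lambda>r. lift (z + a *\<^sub>R w) + r *\<^sub>R v)"
    have "card (\<Lambda> \<inter> graph) = 2" unfolding \<Lambda>_def c(2) using c(3) by simp
    moreover have "\<Lambda> \<in> lines_along v" using c(1) unfolding \<Lambda>_def .
    moreover have "\<Lambda> \<inter> graph = {lift (z + a *\<^sub>R w), lift (z + b *\<^sub>R w)}" using c(2) unfolding \<Lambda>_def .
    ultimately show ?thesis unfolding meets_at_def using c(3) by blast
  qed
  obtain J where J: "projective_involution J" "is_lifting_of (line_involution graph (lines_along v)) J"
    using lifting[OF parallel_class_lines_along[OF v] conjunct2[OF meets[OF ab0]]] by blast
  have "projective_transformation J" using J(1) unfolding projective_involution_def by (rule conjunct1)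
  then obtain T where T: "linear T" "inj T" "\<forall>l\<in>projective_space. J l = T ` l"
    unfolding projective_transformation_def by blast
  note scales = lifting_scales_conormal[OF v J(2) T(1,3)]
  have inD: "z + t *\<^sub>R w \<in> D" if "a0 \<le> t" "t \<le> b0" for t
  proof -
    have "z + a0 *\<^sub>R w + ((t - a0) / (b0 - a0)) *\<^sub>R (z + b0 *\<^sub>R w - (z + a0 *\<^sub>R w)) \<in> D"
      using that ab0(1) by (intro D_segment ab0) auto
    moreover have "z + a0 *\<^sub>R w + r *\<^sub>R (z + b0 *\<^sub>R w - (z + a0 *\<^sub>R w)) = z + (a0 + r * (b0 - a0)) *\<^sub>R w" for r
      by (simp add: algebra_simps)
    moreover have "a0 + (t - a0) / (b0 - a0) * (b0 - a0) = t" using ab0(1) by simp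
    ultimately show ?thesis by (simp only:)
  qed
  have "((\<lambda>r. f (z + r *\<^sub>R w)) has_real_derivative dir_deriv w f (z + r *\<^sub>R w)) (at r)"
    if "a0 \<le> r" "r \<le> b0" for r
    using line_deriv[OF D_U[OF inD[OF that]]] .
  \<comment> \<open>Between the ends of a chord of slope \<open>s\<close> there is a point of slope
    \<open>s\<close>: the tangency required by \<open>lifting_scalar_on_tangents\<close>.\<close>
  from MVT2[OF ab0(1) this] obtain t where t: "a0 < t" "t < b0"
    "f (z + b0 *\<^sub>R w) - f (z + a0 *\<^sub>R w) = (b0 - a0) * dir_deriv w f (z + t *\<^sub>R w)"
    by blast
  define m where "m = z + t *\<^sub>R w"
  have "(b0 - a0) * dir_deriv w f m = (b0 - a0) * s" by (rule trans[OF t(3)[symmetric] ab0(4), folded m_def])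
  then have m: "m \<in> D" "dir_deriv w f m = s" using inD[of t] t ab0(1) by (simp_all add: m_def)
  have eig: "\<exists>\<rho>. T (conormal y) = \<rho> *\<^sub>R conormal y" if y: "y \<in> D" "dir_deriv w f y = s" for y
    by (rule scales[OF y(1) y(1) tangent_line_meets[OF w y, folded v_def]])
  obtain \<mu> where \<mu>: "\<forall>x. x \<bullet> v = 0 \<longrightarrow> T x = \<mu> *\<^sub>R x"
    using lifting_scalar_on_tangents[OF w m T(1) eig, folded v_def] by blast
  then obtain k where k: "T x = \<mu> *\<^sub>R x + (x \<bullet> v) *\<^sub>R k" for x
    using linear_scalar_plus_rank_one[OF T(1) v, of \<mu>] by blast
  have nv: "conormal y \<bullet> v = dir_deriv w f y - s" "conormal y \<bullet> e = -1" if "y \<in> D" for y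
    using conormal_inner_H[OF D_U[OF that] w(1)] conormal_inner_e[OF D_U[OF that]]
    by (simp_all add: v_def inner_add_right)
  have "\<mu> \<noteq> 0"
  proof
    assume "\<mu> = 0"
    then have "T (conormal m) = 0" using k nv(1)[OF m(1)] m(2) by simp
    then have "T (conormal m) = T 0" using linear_0[OF T(1)] by simp
    then have "conormal m = 0" using T(2) by (simp add: inj_eq)
    then show False using conormal_nonzero[OF D_U[OF m(1)]] by simp
  qed
  have "1 / (dir_deriv w f (z + a *\<^sub>R w) - s) + 1 / (dir_deriv w f (z + b *\<^sub>R w) - s) = (k \<bullet> e) / \<mu>"
    if ab: "a < b" "z + a *\<^sub>R w \<in> D" "z + b *\<^sub>R w \<in> D" "f (z + b *\<^sub>R w) - f (z + a *\<^sub>R w) = (b - a) * s" for a b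
  proof -
    let ?A = "z + a *\<^sub>R w" and ?B = "z + b *\<^sub>R w"
    have mA: "meets_at graph (lines_along v) (lift ?A) (lift ?B)" using meets[OF ab] by blast
    obtain \<rho> \<rho>' where \<rho>: "T (conormal ?A) = \<rho> *\<^sub>R conormal ?B" "T (conormal ?B) = \<rho>' *\<^sub>R conormal ?A"
      using scales[OF ab(2,3) mA] scales[OF ab(3,2) meets_at_sym[OF mA]] by blast
    define p q where "p = dir_deriv w f ?A - s" and "q = dir_deriv w f ?B - s"
    have A: "conormal ?A \<bullet> v = p" "conormal ?A \<bullet> e = -1" and B: "conormal ?B \<bullet> v = q" "conormal ?B \<bullet> e = -1"
      using nv[OF ab(2)] nv[OF ab(3)] by (auto simp: p_def q_def)
    have ne: "?A \<noteq> ?B" using ab(1) w(2) by auto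
    have BA: "?B - ?A = (b - a) *\<^sub>R w" "?A - ?B = (a - b) *\<^sub>R w" by (simp_all add: algebra_simps)
    have sA: "dir_deriv (r *\<^sub>R w) f ?A = r * dir_deriv w f ?A"
      and sB: "dir_deriv (r *\<^sub>R w) f ?B = r * dir_deriv w f ?B" for r
      using linear_scale[OF dir_deriv_linear[OF differentiable[OF D_U[OF ab(2)]]]]
        linear_scale[OF dir_deriv_linear[OF differentiable[OF D_U[OF ab(3)]]]] by simp_all
    have "(b - a) * dir_deriv w f ?A < (b - a) * s"
      using gradient_inequality[OF ab(2,3) ne, unfolded BA(1) sA] ab(4) by linarith
    then have "p < 0" using ab(1) by (simp add: p_def)
    have "f ?B + (a - b) * dir_deriv w f ?B < f ?A"
      using gradient_inequality[OF ab(3,2) ne[symmetric], unfolded BA(2) sB] .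
    then have "(b - a) * s < (b - a) * dir_deriv w f ?B" using ab(4) by (simp add: algebra_simps)
    then have "q > 0" using ab(1) by (simp add: q_def)
    have eA: "\<mu> *\<^sub>R conormal ?A + p *\<^sub>R k = \<rho> *\<^sub>R conormal ?B"
      and eB: "\<mu> *\<^sub>R conormal ?B + q *\<^sub>R k = \<rho>' *\<^sub>R conormal ?A"
      using \<rho> k[of "conormal ?A"] k[of "conormal ?B"] A(1) B(1) by simp_all
    have "1 / p + 1 / q = (k \<bullet> e) / \<mu>"
    proof (rule reciprocal_sum_eq[OF \<open>p < 0\<close> \<open>q > 0\<close> \<open>\<mu> \<noteq> 0\<close>])
      show "- \<mu> + p * (k \<bullet> e) = - \<rho>" "- \<mu> + q * (k \<bullet> e) = - \<rho>'"
        using arg_cong[OF eA, of "\<lambda>x. x \<bullet> e"] arg_cong[OF eB, of "\<lambda>x. x \<bullet> e"] A(2) B(2)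
        by (simp_all add: inner_add_left)
      show "\<mu> * p + p * (k \<bullet> v) = \<rho> * q" "\<mu> * q + q * (k \<bullet> v) = \<rho>' * p"
        using arg_cong[OF eA, of "\<lambda>x. x \<bullet> v"] arg_cong[OF eB, of "\<lambda>x. x \<bullet> v"] A(1) B(1)
        by (simp_all add: inner_add_left)
    qed
    then show ?thesis by (simp add: p_def q_def)
  qed
  then show ?thesis by blast
qed

end

section \<open>Conic sections and the quadric\<close>

text \<open>Brings an equation centred at \<open>p\<close> into the form of \<open>quadric\<close>:
  the forms are represented by inner products, and the translation is absorbed by the linear and
  constant coefficients.\<close>

lemma quadric_of_bilinear:
  fixes p :: "'a::euclidean_space"
  assumes \<beta>: "\<And>x. linear (\<beta> x)" "\<And>y. linear (\<lambda>x. \<beta> x y)" and l: "linear l" and nz: "\<beta> x0 x0 \<noteq> (0::real)"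
  shows "quadric {z. \<beta> (z - p) (z - p) + l (z - p) = 0}"
proof -
  have rep: "g x = (\<Sum>b\<in>Basis. g b *\<^sub>R b) \<bullet> x" if "linear g" for g :: "'a \<Rightarrow> real" and x
  proof -
    have "g x = g (\<Sum>b\<in>Basis. (x \<bullet> b) *\<^sub>R b)" by (simp add: euclidean_representation)
    also have "\<dots> = (\<Sum>b\<in>Basis. (x \<bullet> b) * g b)" using that by (simp add: linear_sum linear_scale)
    finally show ?thesis by (simp add: inner_sum_left inner_commute[of x] mult.commute)
  qed
  define M where "M = (\<lambda>x. \<Sum>b\<in>Basis. \<beta> x b *\<^sub>R b)"
  have M: "M x \<bullet> y = \<beta> x y" for x y unfolding M_def by (rule rep[OF \<beta>(1), symmetric])
  have "linear M"
    unfolding M_def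
    by (intro linearI) (simp_all add: linear_add[OF \<beta>(2)] linear_scale[OF \<beta>(2)] sum.distrib
        scaleR_left_distrib scaleR_sum_right)
  define L where "L = (\<lambda>x. l x - \<beta> x p - \<beta> p x)"
  have "linear L" unfolding L_def
    by (intro linearI) (simp_all add: linear_add[OF \<beta>(1)] linear_scale[OF \<beta>(1)] linear_add[OF \<beta>(2)]
        linear_scale[OF \<beta>(2)] linear_add[OF l] linear_scale[OF l] algebra_simps)
  define b where "b = (\<Sum>k\<in>Basis. L k *\<^sub>R k)"
  have b: "b \<bullet> x = L x" for x unfolding b_def by (rule rep[OF \<open>linear L\<close>, symmetric])
  have "\<beta> (z - p) (z - p) + l (z - p) = M z \<bullet> z + b \<bullet> z + (\<beta> p p - l p)" for z
    by (simp add: M b L_def linear_diff[OF \<beta>(1)] linear_diff[OF \<beta>(2)] linear_diff[OF l])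
  then have "{z. \<beta> (z - p) (z - p) + l (z - p) = 0} = {z. M z \<bullet> z + b \<bullet> z + (\<beta> p p - l p) = 0}" by simp
  moreover have "M x0 \<bullet> x0 \<noteq> 0" using nz M by simp
  ultimately show ?thesis using \<open>linear M\<close> unfolding quadric_def by blast
qed

context convex_graph
begin

lemma funpow_line_deriv:
  assumes "i \<le> 5" "z + t *\<^sub>R v \<in> U"
  shows "((\<lambda>s. (dir_deriv v ^^ i) f (z + s *\<^sub>R v)) has_real_derivative
    (dir_deriv v ^^ Suc i) f (z + t *\<^sub>R v)) (at t)"
  using funpow_dir_deriv_line[OF open_U smooth, of i z t v] assms by simp

text \<open>\<open>G\<close> is the family of derivatives along a line after subtracting the tangent
  line at \<open>z\<close>, which alters only orders 0 and 1. It serves as \<open>H\<close> in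
  \<open>monge_of_chords\<close> and as \<open>G\<close> in \<open>conic_of_monge\<close>.\<close>

lemma shifted_line_deriv:
  fixes z v
  defines "G \<equiv> \<lambda>i t. (dir_deriv v ^^ i) f (z + t *\<^sub>R v)
    - (if i = 0 then f z + t * dir_deriv v f z else if i = 1 then dir_deriv v f z else 0)"
  assumes "i \<le> 5" "z + t *\<^sub>R v \<in> U"
  shows "(G i has_real_derivative G (Suc i) t) (at t)"
proof -
  note d = funpow_line_deriv[OF assms(2,3)]
  consider "i = 0" | "i = 1" | "i \<ge> 2" by linarith
  then show ?thesis
  proof cases
    case 1
    have "((\<lambda>t. f (z + t *\<^sub>R v) - (f z + t * dir_deriv v f z)) has_real_derivative
        dir_deriv v f (z + t *\<^sub>R v) - (0 + 1 * dir_deriv v f z)) (at t)"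
      using d 1 by (auto intro!: derivative_eq_intros)
    then show ?thesis using 1 by (simp add: G_def)
  next
    case 2
    have "((\<lambda>s. (dir_deriv v ^^ i) f (z + s *\<^sub>R v) - dir_deriv v f z) has_real_derivative
        (dir_deriv v ^^ Suc i) f (z + t *\<^sub>R v) - 0) (at t)"
      by (intro DERIV_diff d DERIV_const)
    then show ?thesis using 2 by (simp add: G_def)
  next
    case 3
    then show ?thesis using d by (simp add: G_def)
  qed
qed

lemma monge_equation:
  assumes z: "z \<in> D" and v: "v \<in> H" "v \<noteq> 0" and pos: "(dir_deriv v ^^ 2) f z > 0"
    and lifting: "\<And>\<L>. parallel_class \<L> \<Longrightarrow> \<exists>\<Lambda>\<in>\<L>. card (\<Lambda> \<inter> graph) = 2 \<Longrightarrow>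
           \<exists>J. projective_involution J \<and> is_lifting_of (line_involution graph \<L>) J"
  shows "9 * ((dir_deriv v ^^ 2) f z)^2 * (dir_deriv v ^^ 5) f z
      - 45 * (dir_deriv v ^^ 2) f z * (dir_deriv v ^^ 3) f z * (dir_deriv v ^^ 4) f z
      + 40 * ((dir_deriv v ^^ 3) f z)^3 = 0"
proof -
  define s where "s = dir_deriv v f z"
  obtain c where c: "\<And>a b. a < b \<Longrightarrow> z + a *\<^sub>R v \<in> D \<Longrightarrow> z + b *\<^sub>R v \<in> D \<Longrightarrow>
      f (z + b *\<^sub>R v) - f (z + a *\<^sub>R v) = (b - a) * s \<Longrightarrow>
      1 / (dir_deriv v f (z + a *\<^sub>R v) - s) + 1 / (dir_deriv v f (z + b *\<^sub>R v) - s) = c"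
    using chord_relation[OF v D_H[OF z] lifting, of s] by blast
  note nb = line_neighbourhood[OF z v(1)]
  obtain \<epsilon> where \<epsilon>: "\<epsilon> > 0" "ball 0 \<epsilon> \<subseteq> {t. z + t *\<^sub>R v \<in> U}" using nb(1,2) openE by blast
  have inU: "z + t *\<^sub>R v \<in> U" if "\<bar>t\<bar> < \<epsilon>" for t
  proof -
    have "t \<in> ball 0 \<epsilon>" using that by (simp add: dist_real_def)
    then show ?thesis using \<epsilon>(2) by blast
  qed
  have inD: "z + t *\<^sub>R v \<in> D" if "\<bar>t\<bar> < \<epsilon>" for t
    using nb(3)[of t] inU[OF that] by simp
  define G where "G = (\<lambda>i t. (dir_deriv v ^^ i) f (z + t *\<^sub>R v)
    - (if i = 0 then f z + t * dir_deriv v f z else if i = 1 then dir_deriv v f z else 0))"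
  have der: "(G i has_real_derivative G (Suc i) t) (at t)" if "i \<le> 5" "\<bar>t\<bar> < \<epsilon>" for i t
    unfolding G_def by (rule shifted_line_deriv[OF that(1) inU[OF that(2)]])
  have G01: "G 0 t = f (z + t *\<^sub>R v) - (f z + t * s)" "G 1 t = dir_deriv v f (z + t *\<^sub>R v) - s" for t
    by (simp_all add: G_def s_def)
  have Gk: "G k 0 = (dir_deriv v ^^ k) f z" if "k \<ge> 2" for k using that by (simp add: G_def)
  have "9 * (G 2 0)^2 * G 5 0 - 45 * G 2 0 * G 3 0 * G 4 0 + 40 * (G 3 0)^3 = 0"
  proof (rule monge_of_chords[OF \<epsilon>(1), of G c])
    show "(G i has_real_derivative G (Suc i) t) (at t)" if "i < 5" "\<bar>t\<bar> < \<epsilon>" for i t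
      using der that by simp
    show "isCont (G 5) 0" using DERIV_isCont[OF der[of 5 0]] \<epsilon>(1) by simp
    show "G 0 0 = 0" "G 1 0 = 0" unfolding G01 by (simp_all add: s_def)
    show "G 2 0 > 0" using pos by (simp add: Gk)
    fix a b :: real
    assume ab: "- \<epsilon> < a" "a < 0" "0 < b" "b < \<epsilon>" "G 0 a = G 0 b"
    have "f (z + b *\<^sub>R v) - f (z + a *\<^sub>R v) = (b - a) * s"
      using ab(5) unfolding G01 by (simp add: algebra_simps)
    then show "1 / G 1 a + 1 / G 1 b = c" unfolding G01 using ab by (intro c inD) auto
  qed
  then show ?thesis by (simp add: Gk)
qed

lemma line_in_D_convex: "convex {t. z + t *\<^sub>R v \<in> D}"
proof (rule convexI)
  fix a b p q :: real
  assume h: "a \<in> {t. z + t *\<^sub>R v \<in> D}" "b \<in> {t. z + t *\<^sub>R v \<in> D}" "0 \<le> p" "0 \<le> q" "p + q = 1"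
  have "p *\<^sub>R (z + a *\<^sub>R v) + q *\<^sub>R (z + b *\<^sub>R v) = (p + q) *\<^sub>R z + (p * a + q * b) *\<^sub>R v"
    by (simp add: algebra_simps)
  then show "p *\<^sub>R a + q *\<^sub>R b \<in> {t. z + t *\<^sub>R v \<in> D}"
    using convexD[OF convex_D _ _ h(3,4,5), of "z + a *\<^sub>R v" "z + b *\<^sub>R v"] h by simp
qed

text \<open>The whole displacement is put into \<open>v\<close>, so the parameter is
  \<open>1\<close> and \<open>\<tau>\<close> is the height above the tangent hyperplane. Convexity
  of \<open>D\<close> makes the parameter set an interval, so the equation holds throughout
  \<open>D\<close> and not only near \<open>z\<close>.\<close>

lemma conic_section:
  assumes z: "z \<in> D" and v: "v \<in> H" "v \<noteq> 0" "z + v \<in> D"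
    and pos: "\<And>y. y \<in> D \<Longrightarrow> (dir_deriv v ^^ 2) f y > 0"
    and monge: "\<And>y. y \<in> D \<Longrightarrow> 9 * ((dir_deriv v ^^ 2) f y)^2 * (dir_deriv v ^^ 5) f y
      - 45 * (dir_deriv v ^^ 2) f y * (dir_deriv v ^^ 3) f y * (dir_deriv v ^^ 4) f y
      + 40 * ((dir_deriv v ^^ 3) f y)^3 = 0"
  defines "L \<equiv> \<lambda>k. (dir_deriv v ^^ k) f z" and "\<tau> \<equiv> f (z + v) - f z - dir_deriv v f z"
  shows "L 2 / 2 + L 3 / (3 * L 2) * \<tau> + (L 4 / L 2 - 4 / 3 * (L 3 / L 2)^2) / (6 * L 2) * \<tau>^2 = \<tau>"
proof -
  define S where "S = {t. z + t *\<^sub>R v \<in> D}"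
  have S_U: "S = {t. z + t *\<^sub>R v \<in> U}"
    using line_neighbourhood(3)[OF z v(1)] D_U by (auto simp: S_def)
  define G where "G = (\<lambda>i t. (dir_deriv v ^^ i) f (z + t *\<^sub>R v)
    - (if i = 0 then f z + t * dir_deriv v f z else if i = 1 then dir_deriv v f z else 0))"
  have Gk: "G k t = (dir_deriv v ^^ k) f (z + t *\<^sub>R v)" if "k \<ge> 2" for k t using that by (simp add: G_def)
  have L: "G k 0 = L k" if "k \<ge> 2" for k using Gk[OF that] by (simp add: L_def)
  have "G 2 0 / 2 * 1^2 + G 3 0 / (3 * G 2 0) * 1 * G 0 1
      + (G 4 0 / G 2 0 - 4 / 3 * (G 3 0 / G 2 0)^2) / (6 * G 2 0) * (G 0 1)^2 = G 0 1"
  proof (rule conic_of_monge[of S])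
    show "convex S" unfolding S_def by (rule line_in_D_convex)
    show "open S" "0 \<in> S" using line_neighbourhood(1,2)[OF z v(1)] by (simp_all add: S_U)
    show "1 \<in> S" using v(3) by (simp add: S_def)
    show "(G i has_real_derivative G (Suc i) t) (at t)" if "i < 5" "t \<in> S" for i t
      unfolding G_def by (rule shifted_line_deriv) (use that in \<open>auto simp: S_U\<close>)
    show "G 0 0 = 0" "G 1 0 = 0" by (simp_all add: G_def)
    show "G 2 t > 0" if "t \<in> S" for t using pos that by (simp add: Gk S_def)
    show "9 * (G 2 t)^2 * G 5 t - 45 * G 2 t * G 3 t * G 4 t + 40 * (G 3 t)^3 = 0" if "t \<in> S" for t
      using monge that by (simp add: Gk S_def)
  qed
  moreover have "G 0 1 = \<tau>" by (simp add: G_def \<tau>_def)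
  ultimately show ?thesis by (simp add: L)
qed

lemma germ_of_quadric:
  assumes y0: "y0 \<in> D" and pd: "\<And>A. A \<in> graph \<Longrightarrow> positive_definite_at graph A"
    and lifting: "\<And>\<L>. parallel_class \<L> \<Longrightarrow> \<exists>\<Lambda>\<in>\<L>. card (\<Lambda> \<inter> graph) = 2 \<Longrightarrow>
           \<exists>J. projective_involution J \<and> is_lifting_of (line_involution graph \<L>) J"
  shows "\<exists>Q. quadric Q \<and> same_germ_at (lift y0) graph Q"
proof -
  have pos: "(dir_deriv v ^^ 2) f y > 0" if "y \<in> D" "v \<in> H" "v \<noteq> 0" for y v
    using hessian_positive[OF that pd] that(1) by (simp add: graph_def numeral_2_eq_2)
  note monge = monge_equation[OF _ _ _ pos lifting]
  define L where "L = (\<lambda>k v. (dir_deriv v ^^ k) f y0)"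
  define B where "B = (\<lambda>v. L 3 v / (3 * L 2 v))"
  define C where "C = (\<lambda>v. (L 4 v / L 2 v - 4 / 3 * (L 3 v / L 2 v)^2) / (6 * L 2 v))"
  have L_pos: "L 2 v > 0" if "v \<in> H" "v \<noteq> 0" for v using pos[OF y0 that] by (simp add: L_def)
  have osc: "B (u + w) = B u + B w \<and> C u = C w"
    if "u \<in> H" "w \<in> H" "\<And>x y. x *\<^sub>R u + y *\<^sub>R w = 0 \<Longrightarrow> x = 0 \<and> y = 0" for u w
    using osculating_coefficients[OF open_U smooth subspace_H pos monge _ that] y0
    by (simp add: D_def B_def C_def L_def)
  have scale: "L k (c *\<^sub>R v) = c ^ k * L k v" if "k \<le> 4" for k c v
  proof -
    have "L k (c *\<^sub>R v) = (\<Sum>i\<le>k. real (k choose i) * (c ^ i * 0 ^ (k - i) * partial_deriv v 0 f i (k - i) y0))"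
      using funpow_dir_deriv_expand[OF open_U smooth _ D_U[OF y0], of k c v 0 0] that by (simp add: L_def)
    also have "\<dots> = (\<Sum>i\<le>k. if i = k then c ^ k * L k v else 0)"
      by (intro sum.cong refl) (auto simp: L_def partial_deriv_def)
    finally show ?thesis by simp
  qed
  \<comment> \<open>At \<open>c = 0\<close> both sides vanish because division by zero gives
    zero.\<close>
  have B_scale: "B (c *\<^sub>R v) = c * B v" for c v
    by (simp add: B_def scale power_numeral_reduce)
  have C_scale: "C (c *\<^sub>R v) = C v" if "c \<noteq> 0" for c v
  proof -
    have "L 4 (c *\<^sub>R v) / L 2 (c *\<^sub>R v) = c^2 * (L 4 v / L 2 v)" "L 3 (c *\<^sub>R v) / L 2 (c *\<^sub>R v) = c * (L 3 v / L 2 v)"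
      using that by (simp_all add: scale power_numeral_reduce)
    moreover have "(c^2 * X - 4 / 3 * (c * Y)^2) / (6 * (c^2 * Z)) = (X - 4 / 3 * Y^2) / (6 * Z)" for X Y Z
    proof -
      have "c^2 * X - 4 / 3 * (c * Y)^2 = c^2 * (X - 4 / 3 * Y^2)" "6 * (c^2 * Z) = c^2 * (6 * Z)"
        by (simp_all add: algebra_simps power_mult_distrib)
      then show ?thesis using that by simp
    qed
    ultimately show ?thesis by (simp only: C_def scale[of 2, simplified])
  qed
  \<comment> \<open>\<open>osc\<close> covers independent pairs only; all other pairs are reduced to
    the scaling rules.\<close>
  have dep: "u = 0 \<or> (\<exists>c. w = c *\<^sub>R u) \<or> (\<forall>x y. x *\<^sub>R u + y *\<^sub>R w = 0 \<longrightarrow> x = 0 \<and> y = 0)" for u w :: 'a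
  proof -
    have "u = 0 \<or> (\<exists>c. w = c *\<^sub>R u)" if "x *\<^sub>R u + y *\<^sub>R w = 0" "\<not> (x = 0 \<and> y = 0)" for x y
    proof (cases "y = 0")
      case True
      then show ?thesis using that by simp
    next
      case False
      have "y *\<^sub>R w = y *\<^sub>R ((- x / y) *\<^sub>R u)" using that False by (simp add: eq_neg_iff_add_eq_0 add.commute)
      then have "w = (- x / y) *\<^sub>R u" using False by (simp only: scaleR_cancel_left simp_thms)
      then show ?thesis by blast
    qed
    then show ?thesis by blast
  qed
  have B_add: "B (u + w) = B u + B w" if "u \<in> H" "w \<in> H" for u w
    using dep[of u w]
  proof (elim disjE)
    assume "u = 0"
    then show ?thesis using B_scale[of 0 0] by simp
  next
    assume "\<exists>c. w = c *\<^sub>R u"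
    then obtain c where c: "w = c *\<^sub>R u" by blast
    then have eq: "u + w = (1 + c) *\<^sub>R u" by (simp add: algebra_simps)
    show ?thesis unfolding eq B_scale unfolding c B_scale by (simp add: algebra_simps)
  qed (use osc that in blast)
  obtain w0 where w0: "w0 \<in> H" "w0 \<noteq> 0" using H_nontrivial by blast
  have C_const: "C w = C w0" if "w \<in> H" "w \<noteq> 0" for w
    using dep[of w0 w]
  proof (elim disjE)
    assume "\<exists>c. w = c *\<^sub>R w0"
    then obtain c where c: "w = c *\<^sub>R w0" by blast
    then show ?thesis using that C_scale[of c] by auto
  next
    assume "\<forall>x y. x *\<^sub>R w0 + y *\<^sub>R w = 0 \<longrightarrow> x = 0 \<and> y = 0"
    then show ?thesis using osc[OF w0(1) that(1)] by simp
  qed (use w0 in simp)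
  define c0 where "c0 = C w0"
  define Bp where "Bp = (\<lambda>x. B (proj x))"
  define \<tau> where "\<tau> = (\<lambda>x. - (conormal y0 \<bullet> x))"
  define Hs where "Hs = (\<lambda>x y. dir_deriv (proj y) (dir_deriv (proj x) f) y0)"
  \<comment> \<open>Copies the conic equation with \<open>\<tau>\<close> as the height. The middle
    term is not symmetric, which is harmless because \<open>quadric\<close> asks only for a linear
    \<open>M\<close> and evaluates it on the diagonal.\<close>
  define \<beta> where "\<beta> = (\<lambda>x y. Hs x y / 2 + Bp x * \<tau> y + c0 * \<tau> x * \<tau> y)"
  have Bp: "linear Bp"
    unfolding Bp_def
    by (rule linearI) (simp_all add: linear_add[OF proj_linear] linear_scale[OF proj_linear] B_add proj_in_H B_scale)
  have \<tau>: "linear \<tau>" unfolding \<tau>_def by (rule linearI) (simp_all add: inner_add_right)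
  have Hs1: "linear (Hs x)" for x
    using linear_compose[OF proj_linear dir_deriv_linear[OF dir_deriv_differentiable[OF D_U[OF y0]]]]
    by (simp add: Hs_def o_def)
  have "Hs x y = Hs y x" for x y
    unfolding Hs_def using dir_deriv_commute[OF open_U Ck_on_mono[OF smooth] D_U[OF y0]] by simp
  then have "(\<lambda>x. Hs x y) = Hs y" for y by (intro ext)
  then have Hs2: "linear (\<lambda>x. Hs x y)" for y using Hs1[of y] by (simp only:)
  have \<beta>_lin: "linear (\<beta> x)" "linear (\<lambda>x. \<beta> x y)" for x y
    unfolding \<beta>_def
    by (rule linearI; simp add: linear_add[OF Hs1] linear_scale[OF Hs1] linear_add[OF Hs2] linear_scale[OF Hs2]
        linear_add[OF \<tau>] linear_scale[OF \<tau>] linear_add[OF Bp] linear_scale[OF Bp] field_simps)+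
  have \<beta>_diag: "\<beta> x x = L 2 (proj x) / 2 + B (proj x) * \<tau> x + c0 * (\<tau> x)^2" for x
    by (simp add: \<beta>_def Hs_def L_def Bp_def numeral_2_eq_2)
  define p where "p = lift y0"
  define Q where "Q = {z. \<beta> (z - p) (z - p) + - \<tau> (z - p) = 0}"
  \<comment> \<open>On a tangent vector \<open>\<tau>\<close> vanishes, and half the positive second
    derivative is left.\<close>
  have "\<beta> (w0 + dir_deriv w0 f y0 *\<^sub>R e) (w0 + dir_deriv w0 f y0 *\<^sub>R e) \<noteq> 0"
  proof -
    let ?x = "w0 + dir_deriv w0 f y0 *\<^sub>R e"
    have "proj ?x = w0"
      by (simp add: linear_add[OF proj_linear] linear_scale[OF proj_linear] proj_H[OF w0(1)] proj_e)
    moreover have "\<tau> ?x = 0"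
      using conormal_inner_H[OF D_U[OF y0] w0(1)] conormal_inner_e[OF D_U[OF y0]]
      by (simp add: \<tau>_def inner_add_right)
    ultimately show ?thesis using L_pos[OF w0] by (simp add: \<beta>_diag)
  qed
  then have "quadric Q"
    unfolding Q_def using \<beta>_lin linear_compose_neg[OF \<tau>] by (intro quadric_of_bilinear) auto
  have proj_p: "proj (z - p) = proj z - y0" for z
    using proj_lift[OF D_H[OF y0]] by (simp add: linear_diff[OF proj_linear] p_def)
  have \<tau>_lift: "\<tau> (lift y - p) = f y - f y0 - dir_deriv (y - y0) f y0" if "y \<in> D" for y
    using conormal_chord[OF y0 that] by (simp add: \<tau>_def p_def)
  have graph_Q: "lift y \<in> Q" if y: "y \<in> D" for y
  proof (cases "y = y0")
    case True
    then show ?thesis using linear_0[OF \<tau>] linear_0[OF \<beta>_lin(1)] by (simp add: Q_def p_def)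
  next
    case False
    define v where "v = y - y0"
    have v: "v \<in> H" "v \<noteq> 0" "y0 + v \<in> D" "y0 + v = y"
      using False y D_H y0 subspace_H by (auto simp: v_def subspace_diff)
    have pv: "proj (lift y - p) = v" using proj_p proj_lift[OF D_H[OF y]] by (simp add: v_def)
    have "L 2 v / 2 + B v * \<tau> (lift y - p) + C v * (\<tau> (lift y - p))^2 = \<tau> (lift y - p)"
      using conic_section[OF y0 v(1,2,3) pos[OF _ v(1,2)] monge[OF _ v(1,2)]] v(1,2,4)
      unfolding \<tau>_lift[OF y] by (simp add: L_def B_def C_def v_def[symmetric])
    then show ?thesis using C_const[OF v(1,2)] by (simp add: Q_def \<beta>_diag pv c0_def)
  qed
  \<comment> \<open>On a vertical line the equation of \<open>Q\<close> has degree at most two in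
    the height, and the graph point is a solution. Subtracting it from the equation at
    \<open>z\<close> leaves the factor \<open>\<phi> z - 1\<close> beside the height difference, so
    \<open>\<phi> z < 1\<close> near \<open>p\<close> excludes a second solution.\<close>
  define \<phi> where "\<phi> = (\<lambda>z. Bp (z - p) + c0 * (\<tau> (z - p) + \<tau> (lift (proj z) - p)))"
  have pp: "proj p = y0" using proj_lift[OF D_H[OF y0]] by (simp add: p_def)
  have lin_cont: "continuous_on UNIV g" if "linear g" for g :: "'a \<Rightarrow> 'b::real_normed_vector"
    using that linear_continuous_on linear_conv_bounded_linear by blast
  have isC: "isCont g x" if "linear g" for g :: "'a \<Rightarrow> 'b::real_normed_vector" and x
    using lin_cont[OF that] continuous_on_eq_continuous_at[OF open_UNIV] by blast
  have cont_lift: "isCont (\<lambda>z. lift (proj z)) p"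
  proof -
    have "isCont f (proj p)" unfolding pp using differentiable_imp_continuous_within[OF differentiable[OF D_U[OF y0]]] by simp
    then have "isCont (\<lambda>z. f (proj z)) p" using isCont_o2[OF isC[OF proj_linear]] by blast
    then show ?thesis unfolding lift_def using isC[OF proj_linear] by (intro continuous_intros)
  qed
  have c1: "isCont (\<lambda>z. z - p) p" by (intro continuous_intros)
  have c2: "isCont (\<lambda>z. lift (proj z) - p) p" by (intro continuous_intros cont_lift)
  have "isCont \<phi> p"
    unfolding \<phi>_def
    by (intro isCont_add isCont_mult continuous_const isCont_o2[OF c1 isC[OF Bp]]
        isCont_o2[OF c1 isC[OF \<tau>]] isCont_o2[OF c2 isC[OF \<tau>]])
  moreover have "\<phi> p = 0" by (simp add: \<phi>_def linear_0[OF Bp] linear_0[OF \<tau>] pp) (simp add: p_def linear_0[OF \<tau>])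
  ultimately have "(\<phi> \<longlongrightarrow> 0) (nhds p)" 
    by (metis isCont_def tendsto_at_iff_tendsto_nhds)
  then have ev1: "\<forall>\<^sub>F z in nhds p. \<phi> z < 1" by (rule order_tendstoD(2)) simp
  have "open (proj -` U)" by (intro open_vimage open_U lin_cont proj_linear)
  then have ev2: "\<forall>\<^sub>F z in nhds p. proj z \<in> U"
    using eventually_nhds_in_open[of "proj -` U" p] pp D_U[OF y0] by simp
  have "\<forall>\<^sub>F z in nhds p. z \<in> graph \<longleftrightarrow> z \<in> Q"
    using ev1 ev2
  proof eventually_elim
    case (elim z)
    show ?case
    proof
      assume "z \<in> graph"
      then show "z \<in> Q" using graph_Q unfolding graph_def by blast
    next
      assume "z \<in> Q"
      define y where "y = proj z"
      have y: "y \<in> D" using elim(2) proj_in_H by (simp add: D_def y_def)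
      have pl: "proj (lift y - p) = proj (z - p)" unfolding proj_p y_def by (simp add: proj_lift proj_in_H)
      have z_eq: "z = lift y + (e \<bullet> z - f y) *\<^sub>R e"
        using proj_decomp[of z] by (simp add: lift_def y_def algebra_simps)
      define t t' where "t = \<tau> (z - p)" and "t' = \<tau> (lift y - p)"
      have "z - p = (lift y - p) + (e \<bullet> z - f y) *\<^sub>R e" using z_eq by (simp add: algebra_simps)
      then have tt: "t = t' + (e \<bullet> z - f y) * \<tau> e"
        unfolding t_def t'_def by (metis linear_add[OF \<tau>] linear_scale[OF \<tau>] real_scaleR_def)
      have \<tau>e: "\<tau> e = 1" using conormal_inner_e[OF D_U[OF y0]] by (simp add: \<tau>_def)
      have "L 2 (proj (z - p)) / 2 + B (proj (z - p)) * t + c0 * t^2 = t"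
        using \<open>z \<in> Q\<close> by (simp add: Q_def \<beta>_diag t_def)
      moreover have "L 2 (proj (z - p)) / 2 + B (proj (z - p)) * t' + c0 * t'^2 = t'"
        using graph_Q[OF y] by (simp add: Q_def \<beta>_diag t'_def pl)
      ultimately have "(t - t') * (B (proj (z - p)) + c0 * (t + t') - 1) = 0"
        by (simp add: algebra_simps power2_eq_square)
      moreover have "B (proj (z - p)) + c0 * (t + t') < 1"
        using elim(1) by (simp add: \<phi>_def Bp_def t_def t'_def y_def)
      ultimately have "t = t'" by simp
      then have "e \<bullet> z = f y" using tt \<tau>e by simp
      then have "z = lift y" using z_eq by simp
      then show "z \<in> graph" using y by (simp add: graph_def)
    qed
  qed
  then have "same_germ_at p graph Q" by (simp add: same_germ_at_def)
  then show ?thesis using \<open>quadric Q\<close> p_def by blast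
qed

end

theorem theorem1p12:
  fixes \<alpha> :: "(real ^ 'n) set" and p :: "real ^ 'n"
  assumes "CARD('n) \<ge> 2"
    and "p \<in> \<alpha>"
    and "strictly_convex_hypersurface 6 \<alpha>"
    and "\<And>A. A \<in> \<alpha> \<Longrightarrow> positive_definite_at \<alpha> A"
    and "\<And>\<L>. parallel_class \<L> \<Longrightarrow> \<exists>\<Lambda>\<in>\<L>. card (\<Lambda> \<inter> \<alpha>) = 2 \<Longrightarrow>
           \<exists>J. projective_involution J \<and> is_lifting_of (line_involution \<alpha> \<L>) J"
  shows "\<exists>Q. quadric Q \<and> same_germ_at p \<alpha> Q"
proof -
  obtain e U f where euf: "norm e = 1" "open U" "Ck_on 6 U f"
    "strictly_convex_on (U \<inter> {y. e \<bullet> y = 0}) f" "\<alpha> = (\<lambda>y. y + f y *\<^sub>R e) ` (U \<inter> {y. e \<bullet> y = 0})"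
    using assms(3) unfolding strictly_convex_hypersurface_def by blast
  interpret convex_graph e U f
    using euf assms(1) by unfold_locales simp_all
  have \<alpha>: "\<alpha> = graph" unfolding euf(5) graph_def lift_def D_def H_def ..
  obtain y0 where y0: "y0 \<in> D" "p = lift y0" using assms(2) unfolding \<alpha> graph_def by blast
  show ?thesis
    using germ_of_quadric[OF y0(1)] assms(4,5) unfolding \<alpha> y0(2) by blast
qed

end
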